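(* Let $1\le p_0<p<q_0\le\infty$, let $\mathcal S\subset\mathcal D$ be a sparse family, and let $(w,\sigma)$ be a pair of weights. Put $$u:=w^{\frac{p_0}{p_0-p}},\qquad v:=\sigma^{\frac{q_0'}{q_0'-p'}},$$ which are assumed to be weights (locally integrable). Let $\mathcal N\in[0,\infty]$ be the best constant such that $$\sum_{Q\in\mathcal S}\langle |f|^{p_0}\rangle_Q^{\frac1{p_0}}\,\langle |g|^{q_0'}\rangle_Q^{\frac1{q_0'}}\,|Q|\le \mathcal N\,\|f\|_{L^p(w)}\,\|g\|_{L^{p'}(\sigma)}$$ holds for all $f\in L^p(w)$ and $g\in L^{p'}(\sigma)$. Let $\Phi,\Psi:[1/2,\infty)\to(0,\infty)$ be increasing functions such that $$\int_{1/2}^\infty\Big(\frac1{\Phi(t)^{p}}+\frac1{\Psi(t)^{p'}}\Big)\frac{dt}t<\infty .$$ Then $$\mathcal N\lesssim [v,u]_{(A_r)(\Phi(A_\infty^{\exp}))}+[u,v]_{(A_{r'})(\Psi(A_\infty^{\exp}))} .$$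
   Context: Setting: $(X,d)$ is a locally compact separable metric space equipped with a doubling Borel measure $\mu$, finite on compact sets and strictly positive on nonempty open sets. Write $|E|:=\mu(E)$ and $dx$ for $d\mu$. $\mathcal D$ is a fixed dyadic system on $X$: $\mathcal D=\bigcup_{k\in\mathbb Z}\mathcal D_k$, where each $\mathcal D_k$ is a countable partition of $X$ into Borel sets ("cubes"), any two cubes are either disjoint or nested (with $\mathcal D_{k+1}$ refining $\mathcal D_k$), and, for some fixed $\delta\in(0,1)$ and $0<c\le C<\infty$, each $Q\in\mathcal D_k$ has a point $z_Q$ with $B(z_Q,c\delta^k)\subset Q\subset B(z_Q,C\delta^k)$. (On $\mathbb R^n$ with Lebesgue measure one may take the usual dyadic cubes.) A family $\mathcal S\subset\mathcal D$ is sparse if $\big|\bigcup_{Q'\in\mathcal S,\,Q'\subsetneq Q}Q'\big|\le\frac12|Q|$ for every $Q\in\mathcal S$. A weight is a locally integrable, a.e. positive function; for a weight $w$, $\|f\|_{L^p(w)}=(\int|f|^p w\,dx)^{1/p}$. Averages: $\langle h\rangle_Q:=\frac1{|Q|}\int_Q h\,dx$. For an exponent $t$, $t'$ is its conjugate exponent, $1/t+1/t'=1$, with $1/\infty=0$ and $\infty'=1$. Definitions. $r:=\big(\frac{q_0}p\big)'\big(\frac p{p_0}-1\big)+1$. For a cube $Q$, $$A_r(v,u,Q):=\langle v\rangle_Q^{\frac1p-\frac1{q_0}}\langle u\rangle_Q^{(\frac1p-\frac1{q_0})(r-1)},\qquad A_{r'}(u,v,Q):=\langle u\rangle_Q^{\frac1{p'}-\frac1{p_0'}}\langle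 v\rangle_Q^{(\frac1{p'}-\frac1{p_0'})(r'-1)},$$ $$A_\infty^{\exp}(v,Q):=\langle v\rangle_Q\exp\big(\langle\log v^{-1}\rangle_Q\big)$$ (so $A_\infty^{\exp}(v,Q)\ge 1$, possibly $+\infty$). Finally $$[v,u]_{(A_r)(\Phi(A_\infty^{\exp}))}:=\sup_Q A_r(v,u,Q)\,A_\infty^{\exp}(v,Q)^{\frac1{p'}}\,\Phi(A_\infty^{\exp}(v,Q)),$$ $$[u,v]_{(A_{r'})(\Psi(A_\infty^{\exp}))}:=\sup_Q A_{r'}(u,v,Q)\,A_\infty^{\exp}(u,Q)^{\frac1p}\,\Psi(A_\infty^{\exp}(u,Q)),$$ with suprema over all cubes $Q$ (an expression is $+\infty$ when its $A_\infty^{\exp}(\cdot,Q)$ factor is $+\infty$). The notation $a\lesssim b$ means $a\le Cb$ with $C$ independent of $w,\sigma,\mathcal S$ (it may depend on $p_0,q_0,p,\Phi,\Psi$ and the underlying space). *)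

theory Defs
  imports "HOL-Analysis.Analysis"
begin

text \<open>Local finiteness and doubling make every ball, hence every cube, of finite measure.\<close>

definition doubling_measure :: "'a::metric_space measure \<Rightarrow> bool" where
  "doubling_measure M \<longleftrightarrow>
     sets M = sets borel \<and>
     (\<forall>K. compact K \<longrightarrow> emeasure M K < \<infinity>) \<and>
     (\<forall>U. open U \<and> U \<noteq> {} \<longrightarrow> 0 < emeasure M U) \<and>
     (\<exists>A::real. \<forall>x r. 0 < r \<longrightarrow> emeasure M (ball x (2 * r)) \<le> ennreal A * emeasure M (ball x r))"

text \<open>A cube is a set without its generation: one set may belong to several \<open>D k\<close>
  (for instance an isolated point), and it is then one and the same cube.\<close>

definition cubes :: "(int \<Rightarrow> 'a set set) \<Rightarrow> 'a set set" where
  "cubes D = (\<Union>k. D k)"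

definition dyadic_system :: "(int \<Rightarrow> 'a::metric_space set set) \<Rightarrow> bool" where
  "dyadic_system D \<longleftrightarrow>
     (\<forall>k. countable (D k) \<and> partition_on UNIV (D k) \<and> D k \<subseteq> sets borel) \<and>
     (\<forall>Q\<in>cubes D. \<forall>R\<in>cubes D. Q \<inter> R = {} \<or> Q \<subseteq> R \<or> R \<subseteq> Q) \<and>
     (\<forall>k. \<forall>Q\<in>D (k + 1). \<exists>R\<in>D k. Q \<subseteq> R) \<and>
     (\<exists>\<delta> c C :: real. 0 < \<delta> \<and> \<delta> < 1 \<and> 0 < c \<and> c \<le> C \<and>
        (\<forall>k. \<forall>Q\<in>D k. \<exists>z. ball z (c * \<delta> powi k) \<subseteq> Q \<and> Q \<subseteq> ball z (C * \<delta> powi k)))"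

definition sparse_family :: "'a measure \<Rightarrow> (int \<Rightarrow> 'a set set) \<Rightarrow> 'a set set \<Rightarrow> bool" where
  "sparse_family M D S \<longleftrightarrow> S \<subseteq> cubes D \<and>
     (\<forall>Q\<in>S. emeasure M (\<Union>{Q'\<in>S. Q' \<subset> Q}) \<le> emeasure M Q / 2)"

definition weight :: "'a::metric_space measure \<Rightarrow> ('a \<Rightarrow> real) \<Rightarrow> bool" where
  "weight M w \<longleftrightarrow> w \<in> borel_measurable M \<and>
     (\<forall>K. compact K \<longrightarrow> set_integrable M K w) \<and> (AE x in M. 0 < w x)"

text \<open>In \<^typ>\<open>ereal\<close>, \<open>1 / \<infinity> = 0\<close> and \<open>1 / 0 = \<infinity>\<close>, so the endpoints \<open>1\<close> and \<open>\<infinity>\<close>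
  are conjugate to each other.\<close>

definition conj_exp :: "ereal \<Rightarrow> ereal" where
  "conj_exp t = 1 / (1 - 1 / t)"

text \<open>For use where the conjugate exponent is finite, that is, for \<open>1 < t\<close>.\<close>

definition rconj :: "ereal \<Rightarrow> real" where
  "rconj t = real_of_ereal (conj_exp t)"

definition r_exp :: "real \<Rightarrow> real \<Rightarrow> ereal \<Rightarrow> real" where
  "r_exp p0 p q0 = rconj (q0 / ereal p) * (p / p0 - 1) + 1"

text \<open>Powers of extended nonnegative numbers; only positive exponents occur below.\<close>

definition epowr :: "ennreal \<Rightarrow> real \<Rightarrow> ennreal" where
  "epowr x a = (if x = \<infinity> then \<infinity> else ennreal (enn2real x powr a))"

definition avg :: "'a measure \<Rightarrow> 'a set \<Rightarrow> ('a \<Rightarrow> ennreal) \<Rightarrow> ennreal" where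
  "avg M Q h = (\<integral>\<^sup>+x\<in>Q. h x \<partial>M) / emeasure M Q"

definition A_r :: "'a measure \<Rightarrow> real \<Rightarrow> real \<Rightarrow> ereal \<Rightarrow> ('a \<Rightarrow> real) \<Rightarrow> ('a \<Rightarrow> real) \<Rightarrow> 'a set \<Rightarrow> ennreal" where
  "A_r M p0 p q0 v u Q =
     (let a = 1 / p - real_of_ereal (1 / q0); r = r_exp p0 p q0
      in epowr (avg M Q (\<lambda>x. ennreal (v x))) a *
         epowr (avg M Q (\<lambda>x. ennreal (u x))) (a * (r - 1)))"

definition A_r' :: "'a measure \<Rightarrow> real \<Rightarrow> real \<Rightarrow> ereal \<Rightarrow> ('a \<Rightarrow> real) \<Rightarrow> ('a \<Rightarrow> real) \<Rightarrow> 'a set \<Rightarrow> ennreal" where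
  "A_r' M p0 p q0 u v Q =
     (let a = 1 / rconj p - real_of_ereal (1 / conj_exp p0); r' = rconj (r_exp p0 p q0)
      in epowr (avg M Q (\<lambda>x. ennreal (u x))) a *
         epowr (avg M Q (\<lambda>x. ennreal (v x))) (a * (r' - 1)))"

text \<open>The positive part of \<open>ln v\<close> is at most \<open>v\<close>. Hence if \<open>v\<close> is integrable over \<open>Q\<close>, the average
  of \<open>ln (1 / v)\<close> exists in \<open>(-\<infinity>, \<infinity>]\<close>, and it is \<open>\<infinity>\<close> exactly when \<open>ln v\<close> is not
  integrable over \<open>Q\<close>. If closed balls are not compact, a weight can fail to be integrable
  over a cube; the value is then \<open>\<infinity>\<close> as well.\<close>

definition A_exp :: "'a measure \<Rightarrow> ('a \<Rightarrow> real) \<Rightarrow> 'a set \<Rightarrow> ennreal" where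
  "A_exp M v Q =
     (if set_integrable M Q v \<and> set_integrable M Q (\<lambda>x. ln (inverse (v x)))
      then avg M Q (\<lambda>x. ennreal (v x)) *
           ennreal (exp ((LINT x:Q|M. ln (inverse (v x))) / measure M Q))
      else \<infinity>)"

definition bump_r :: "'a measure \<Rightarrow> (int \<Rightarrow> 'a set set) \<Rightarrow> real \<Rightarrow> real \<Rightarrow> ereal \<Rightarrow> (real \<Rightarrow> real) \<Rightarrow>
    ('a \<Rightarrow> real) \<Rightarrow> ('a \<Rightarrow> real) \<Rightarrow> ennreal" where
  "bump_r M D p0 p q0 \<Phi> v u =
     (SUP Q\<in>cubes D. if A_exp M v Q = \<infinity> then \<infinity>
        else A_r M p0 p q0 v u Q * epowr (A_exp M v Q) (1 / rconj p) *
             ennreal (\<Phi> (enn2real (A_exp M v Q))))"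

definition bump_r' :: "'a measure \<Rightarrow> (int \<Rightarrow> 'a set set) \<Rightarrow> real \<Rightarrow> real \<Rightarrow> ereal \<Rightarrow> (real \<Rightarrow> real) \<Rightarrow>
    ('a \<Rightarrow> real) \<Rightarrow> ('a \<Rightarrow> real) \<Rightarrow> ennreal" where
  "bump_r' M D p0 p q0 \<Psi> u v =
     (SUP Q\<in>cubes D. if A_exp M u Q = \<infinity> then \<infinity>
        else A_r' M p0 p q0 u v Q * epowr (A_exp M u Q) (1 / p) *
             ennreal (\<Psi> (enn2real (A_exp M u Q))))"

definition Lp_norm :: "'a measure \<Rightarrow> ('a \<Rightarrow> real) \<Rightarrow> real \<Rightarrow> ('a \<Rightarrow> real) \<Rightarrow> ennreal" where
  "Lp_norm M w p f = epowr (\<integral>\<^sup>+x. ennreal (\<bar>f x\<bar> powr p * w x) \<partial>M) (1 / p)"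

definition Lp_space :: "'a measure \<Rightarrow> ('a \<Rightarrow> real) \<Rightarrow> real \<Rightarrow> ('a \<Rightarrow> real) set" where
  "Lp_space M w p = {f \<in> borel_measurable M. Lp_norm M w p f < \<infinity>}"

definition sparse_form :: "'a measure \<Rightarrow> 'a set set \<Rightarrow> real \<Rightarrow> ereal \<Rightarrow> ('a \<Rightarrow> real) \<Rightarrow> ('a \<Rightarrow> real) \<Rightarrow> ennreal" where
  "sparse_form M S p0 q0 f g =
     (\<Sum>\<^sub>\<infinity>Q\<in>S. epowr (avg M Q (\<lambda>x. ennreal (\<bar>f x\<bar> powr p0))) (1 / p0) *
            epowr (avg M Q (\<lambda>x. ennreal (\<bar>g x\<bar> powr rconj q0))) (1 / rconj q0) *
            emeasure M Q)"

definition best_const :: "'a measure \<Rightarrow> 'a set set \<Rightarrow> real \<Rightarrow> real \<Rightarrow> ereal \<Rightarrow>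
    ('a \<Rightarrow> real) \<Rightarrow> ('a \<Rightarrow> real) \<Rightarrow> ennreal" where
  "best_const M S p0 p q0 w \<sigma> =
     Inf {N. \<forall>f\<in>Lp_space M w p. \<forall>g\<in>Lp_space M \<sigma> (rconj p).
            sparse_form M S p0 q0 f g \<le> N * Lp_norm M w p f * Lp_norm M \<sigma> (rconj p) g}"

end

theory Submission
  imports Defs
begin

text \<open>
  Write \<open>|f| powr p0 = \<phi> u\<close> and \<open>|g| powr q0' = \<psi> v\<close>. Then the norms of \<open>f\<close> and \<open>g\<close> become norms of \<open>\<phi>\<close>
  in \<open>L powr (p/p0)\<close> with respect to \<open>u\<close> and of \<open>\<psi>\<close> in \<open>L powr (p'/q0')\<close> with respect to \<open>v\<close>, where both
  exponents exceed \<open>1\<close>. The two expressions \<open>A_r\<close> and \<open>A_r'\<close> are the same number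
  \<open>A(Q) = \<langle>u\<rangle> powr \<alpha> * \<langle>v\<rangle> powr \<beta>\<close> with \<open>\<alpha> = 1/p0 - 1/p\<close> and \<open>\<beta> = 1/p - 1/q0\<close>, and the term of \<open>Q\<close> in
  the sparse form is \<open>A(Q) u(Q) powr (1/p) v(Q) powr (1/p')\<close> times powers of the \<open>u\<close>-average of \<open>\<phi>\<close> and of
  the \<open>v\<close>-average of \<open>\<psi>\<close>. It is enough to treat finite subfamilies of the sparse family uniformly.

  Replace the averages by their maxima over the ancestors of \<open>Q\<close> in the family. These stopping values
  decrease on the way up, and one records only their dyadic sizes, called levels. Going up from a
  cube, either the \<open>\<psi>\<close>-level changes no later than the \<open>\<phi>\<close>-level, or the other way round; this splits the
  sum into two symmetric halves, the first controlled by the bump in \<open>u\<close>, the second by the bump in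
  \<open>v\<close> (\<open>finite_sparse_bound\<close>). This plays the part of a parallel corona decomposition.

  In the first half sort the cubes by the sizes of \<open>A\<close>, of \<open>A_inf(u)\<close> and of the two stopping values.
  In one class \<open>A\<close> is nearly constant. Using a slightly larger power of it than the first, the terms
  below a cube \<open>R\<close> of the class become geometric means of \<open>u(Q)\<close>, \<open>v(Q)\<close> and a positive power of
  \<open>|Q|\<close>, whose sum over a sparse family is comparable to the term of \<open>R\<close>
  (\<open>geometric_mean_packing\<close>). So only maximal cubes of classes matter, and Hoelder's inequality separates
  \<open>\<phi>\<close> from \<open>\<psi>\<close> (\<open>one_sided_sparse_bound\<close>). The sum for \<open>\<phi>\<close> runs over \<open>u(Q) / A_inf(u, Q)\<close>,
  which is \<open>|Q| exp \<langle>ln u\<rangle>\<close> and satisfies a Carleson embedding because it is at most \<open>|Q| \<langle>sqrt u\<rangle>\<^sup>2\<close>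
  by Jensen's inequality (\<open>sparse_sum_exp_log_average\<close>). In the sum for \<open>\<psi>\<close>, the maximal cubes that
  contain a point have distinct \<open>\<psi>\<close>-levels once the sizes of \<open>A\<close> and \<open>A_inf(u)\<close> are fixed, so this sum is
  geometric and is bounded by the maximal function of \<open>\<psi>\<close> with respect to \<open>v\<close>. Summing over the sizes
  of \<open>A\<close> costs a geometric series, and summing over the sizes \<open>2\<^sup>k\<close> of \<open>A_inf(u)\<close> costs the sum of
  \<open>\<Psi>(2\<^sup>k) powr - p'\<close>, which the integrability of the bump makes finite (\<open>summable_dyadic_values\<close>).

  Both averages are handled by the dyadic maximal inequality for an arbitrary measure
  (\<open>maximal_inequality\<close>), which is what makes all constants independent of the weights.\<close>

section \<open>Dyadic levels and Hoelder inequalities\<close>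

definition level :: "real \<Rightarrow> int" where
  "level y = \<lfloor>log 2 y\<rfloor>"

lemma level_bounds:
  assumes "0 < y"
  shows "2 powr level y \<le> y" "y < 2 powr (level y + 1)"
proof -
  have "real_of_int (level y) \<le> log 2 y" "log 2 y < real_of_int (level y) + 1"
    unfolding level_def by linarith+
  then show "2 powr level y \<le> y" "y < 2 powr (level y + 1)"
    using assms by (simp_all add: le_log_iff log_less_iff)
qed

lemma level_mono: "0 < x \<Longrightarrow> x \<le> y \<Longrightarrow> level x \<le> level y"
  unfolding level_def by (intro floor_mono) simp

lemma less_twice_if_same_level:
  assumes "0 < x" "0 < y" "level x = level y"
  shows "x < 2 * y"
proof -
  have "x < 2 powr (level y + 1)" using level_bounds(2)[of x] assms by simp
  also have "\<dots> = 2 * 2 powr level y" by (simp add: powr_add)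
  also have "\<dots> \<le> 2 * y" using level_bounds(1)[of y] assms by simp
  finally show ?thesis .
qed

text \<open>Numbers on pairwise distinct dyadic levels are dominated by a geometric series that starts at the
  largest of them.\<close>

lemma sum_powr_distinct_levels:
  fixes x :: "'i \<Rightarrow> real"
  assumes fin: "finite T" and \<theta>: "0 < \<theta>" and "0 \<le> X"
    and x: "\<And>i. i \<in> T \<Longrightarrow> 0 < x i" "\<And>i. i \<in> T \<Longrightarrow> x i \<le> X"
    and inj: "inj_on (\<lambda>i. level (x i)) T"
  shows "(\<Sum>i\<in>T. x i powr \<theta>) \<le> 2 powr \<theta> / (1 - 2 powr - \<theta>) * X powr \<theta>"
proof (cases "T = {}")
  case True
  have "2 powr - \<theta> < 1" using \<theta> by (simp add: powr_minus field_simps)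
  then show ?thesis using True by simp
next
  case False
  then have X: "0 < X" using x by (meson ex_in_conv less_le_trans)
  define r where "r = 2 powr - \<theta>"
  have r: "0 < r" "r < 1" unfolding r_def using \<theta> by (simp_all add: powr_minus field_simps)
  define n where "n i = nat (level X - level (x i))" for i
  have lev: "level (x i) \<le> level X" if "i \<in> T" for i using level_mono x that by blast
  have n_inj: "inj_on n T"
  proof (rule inj_onI)
    fix i j assume "i \<in> T" "j \<in> T" "n i = n j"
    then show "i = j" using lev[of i] lev[of j] inj unfolding n_def inj_on_def by auto
  qed
  have x_bound: "x i powr \<theta> \<le> 2 powr \<theta> * X powr \<theta> * r ^ n i" if i: "i \<in> T" for i
  proof -
    have "x i powr \<theta> \<le> (2 powr (level (x i) + 1)) powr \<theta>"
      using level_bounds(2)[of "x i"] x[OF i] \<theta> by (intro powr_mono2) auto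
    also have "\<dots> = 2 powr \<theta> * (2 powr level X) powr \<theta> * r ^ n i"
    proof -
      have "r ^ n i = 2 powr (- \<theta> * real (n i))"
        unfolding r_def by (simp add: powr_powr flip: powr_realpow)
      moreover have "real (n i) = level X - level (x i)"
        using lev[OF i] unfolding n_def by simp
      ultimately show ?thesis
        by (simp add: powr_powr algebra_simps flip: powr_add)
    qed
    also have "\<dots> \<le> 2 powr \<theta> * X powr \<theta> * r ^ n i"
      using level_bounds(1)[OF X] \<theta> r by (intro mult_right_mono mult_left_mono powr_mono2) auto
    finally show ?thesis .
  qed
  have "(\<Sum>i\<in>T. r ^ n i) = (\<Sum>k\<in>n ` T. r ^ k)"
    using n_inj by (simp add: sum.reindex)
  also have "\<dots> \<le> (\<Sum>k. r ^ k)"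
    using r fin by (intro sum_le_suminf summable_geometric) auto
  also have "\<dots> = 1 / (1 - r)" using r by (simp add: suminf_geometric)
  finally have geo: "(\<Sum>i\<in>T. r ^ n i) \<le> 1 / (1 - r)" .
  have "(\<Sum>i\<in>T. x i powr \<theta>) \<le> (\<Sum>i\<in>T. 2 powr \<theta> * X powr \<theta> * r ^ n i)"
    by (intro sum_mono x_bound)
  also have "\<dots> = 2 powr \<theta> * X powr \<theta> * (\<Sum>i\<in>T. r ^ n i)"
    by (simp add: sum_distrib_left)
  also have "\<dots> \<le> 2 powr \<theta> * X powr \<theta> * (1 / (1 - r))"
    by (intro mult_left_mono geo) simp
  finally show ?thesis by (simp add: r_def field_simps)
qed

text \<open>Apply \<open>ln y \<le> y - 1\<close> to the ratio of each number to the weighted arithmetic mean.\<close>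

lemma weighted_am_gm3:
  fixes a b c :: real
  assumes "0 < a" "0 < b" "0 < c" "0 \<le> s" "0 \<le> t" "0 \<le> r" "s + t + r = 1"
  shows "a powr s * b powr t * c powr r \<le> s * a + t * b + r * c"
proof -
  define m where "m = s * a + t * b + r * c"
  have m: "0 < m"
  proof -
    have "s > 0 \<or> t > 0 \<or> r > 0" using assms by linarith
    moreover have "0 \<le> s * a" "0 \<le> t * b" "0 \<le> r * c" using assms by simp_all
    moreover have "0 < s \<Longrightarrow> 0 < s * a" "0 < t \<Longrightarrow> 0 < t * b" "0 < r \<Longrightarrow> 0 < r * c"
      using assms by simp_all
    ultimately show ?thesis unfolding m_def by linarith
  qed
  have ln: "ln y - ln m \<le> y / m - 1" if "0 < y" for y
    using ln_le_minus_one[of "y / m"] m that by (simp add: ln_div)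
  have "s * (ln a - ln m) + t * (ln b - ln m) + r * (ln c - ln m) \<le>
      s * (a / m - 1) + t * (b / m - 1) + r * (c / m - 1)"
    using assms by (intro add_mono mult_left_mono ln)
  also have "\<dots> = (s * a + t * b + r * c) / m - (s + t + r)"
    by (simp add: algebra_simps add_divide_distrib)
  also have "\<dots> = 0" using m assms by (simp add: m_def)
  finally have "s * ln a + t * ln b + r * ln c \<le> (s + t + r) * ln m"
    by (simp add: algebra_simps)
  then have "exp (s * ln a + t * ln b + r * ln c) \<le> exp (ln m)" using assms by simp
  then show ?thesis using assms m by (simp add: powr_def exp_add m_def)
qed

text \<open>Normalize the three sums to \<open>1\<close> and apply the weighted inequality of the means termwise. That
  the constant is \<open>1\<close> matters: below the inequality is iterated along the generations of a tree.\<close>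

lemma holder3:
  fixes a b c :: "'i \<Rightarrow> real"
  assumes fin: "finite I"
    and pos: "\<And>i. i \<in> I \<Longrightarrow> 0 < a i" "\<And>i. i \<in> I \<Longrightarrow> 0 < b i" "\<And>i. i \<in> I \<Longrightarrow> 0 < c i"
    and e: "0 \<le> s" "0 \<le> t" "0 \<le> r" "s + t + r = 1"
  shows "(\<Sum>i\<in>I. a i powr s * b i powr t * c i powr r) \<le> sum a I powr s * sum b I powr t * sum c I powr r"
proof (cases "I = {}")
  case False
  have A: "0 < sum a I" and B: "0 < sum b I" and C: "0 < sum c I"
    using fin False pos by (auto intro: sum_pos)
  let ?P = "sum a I powr s * sum b I powr t * sum c I powr r"
  have "a i powr s * b i powr t * c i powr r \<le>
      ?P * (s * (a i / sum a I) + t * (b i / sum b I) + r * (c i / sum c I))" if "i \<in> I" for i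
  proof -
    have "a i powr s * b i powr t * c i powr r =
        ?P * ((a i / sum a I) powr s * (b i / sum b I) powr t * (c i / sum c I) powr r)"
      using A B C pos[OF that] by (simp add: powr_divide)
    also have "\<dots> \<le> ?P * (s * (a i / sum a I) + t * (b i / sum b I) + r * (c i / sum c I))"
      using A B C pos[OF that] e by (intro mult_left_mono weighted_am_gm3) auto
    finally show ?thesis .
  qed
  then have "(\<Sum>i\<in>I. a i powr s * b i powr t * c i powr r) \<le>
      (\<Sum>i\<in>I. ?P * (s * (a i / sum a I) + t * (b i / sum b I) + r * (c i / sum c I)))"
    by (rule sum_mono)
  also have "\<dots> = ?P * (s * (sum a I / sum a I) + t * (sum b I / sum b I) + r * (sum c I / sum c I))"
    by (simp only: sum_distrib_left[symmetric] sum.distrib sum_divide_distrib[symmetric])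
  also have "\<dots> = ?P" using A B C e by simp
  finally show ?thesis .
qed simp

lemma holder2:
  fixes a b :: "'i \<Rightarrow> real"
  assumes "finite I" "\<And>i. i \<in> I \<Longrightarrow> 0 < a i" "\<And>i. i \<in> I \<Longrightarrow> 0 < b i"
    and "0 \<le> s" "0 \<le> t" "s + t = 1"
  shows "(\<Sum>i\<in>I. a i powr s * b i powr t) \<le> sum a I powr s * sum b I powr t"
proof (cases "I = {}")
  case False
  then show ?thesis
    using holder3[of I a b "\<lambda>_. 1" s t 0] assms by simp
qed simp

section \<open>Packing in laminar families\<close>

definition laminar :: "'a set set \<Rightarrow> bool" where
  "laminar S \<longleftrightarrow> (\<forall>Q\<in>S. \<forall>R\<in>S. Q \<inter> R = {} \<or> Q \<subseteq> R \<or> R \<subseteq> Q)"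

lemma laminar_subset: "laminar S \<Longrightarrow> T \<subseteq> S \<Longrightarrow> laminar T"
  unfolding laminar_def by blast

lemma maximal_above:
  assumes "finite F" "Q \<in> F"
  obtains R where "R \<in> F" "Q \<subseteq> R" "\<And>R'. R' \<in> F \<Longrightarrow> \<not> R \<subset> R'"
  using finite_has_maximal2[OF assms] by (metis less_le)

lemma maximal_disjoint:
  assumes "laminar F" "Q \<in> F" "R \<in> F" "Q \<noteq> R"
    and "\<And>R'. R' \<in> F \<Longrightarrow> \<not> Q \<subset> R'" "\<And>R'. R' \<in> F \<Longrightarrow> \<not> R \<subset> R'"
  shows "Q \<inter> R = {}"
proof -
  have "\<not> Q \<subset> R" "\<not> R \<subset> Q" using assms by auto
  then have "\<not> Q \<subseteq> R" "\<not> R \<subseteq> Q" using \<open>Q \<noteq> R\<close> by auto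
  then show ?thesis using assms(1-3) unfolding laminar_def by auto
qed

text \<open>Go down the tree of cubes generation by generation. By Hoelder's inequality the geometric means
  \<open>U\<^sup>s V\<^sup>t m\<^sup>r\<close> of the maximal cubes strictly inside \<open>R\<close> add up to at most the geometric mean of
  the totals; the totals of \<open>U\<close> and \<open>V\<close> do not grow, and sparseness halves the total of \<open>m\<close>. Each
  generation thus costs a factor \<open>2 powr - r < 1\<close>. The positive exponent of \<open>m\<close> is what makes the
  whole sum comparable to its first term, with no regularity assumed of \<open>U\<close> and \<open>V\<close>.\<close>

lemma geometric_mean_packing:
  fixes U V m :: "'a set \<Rightarrow> real"
  assumes lam: "laminar T" and fin: "finite T" and ne: "{} \<notin> T"
    and pos: "\<And>Q. Q \<in> T \<Longrightarrow> 0 < U Q" "\<And>Q. Q \<in> T \<Longrightarrow> 0 < V Q" "\<And>Q. Q \<in> T \<Longrightarrow> 0 < m Q"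
    and U: "\<And>C R. C \<subseteq> T \<Longrightarrow> R \<in> T \<Longrightarrow> disjoint C \<Longrightarrow> \<forall>Q\<in>C. Q \<subset> R \<Longrightarrow> sum U C \<le> U R"
    and V: "\<And>C R. C \<subseteq> T \<Longrightarrow> R \<in> T \<Longrightarrow> disjoint C \<Longrightarrow> \<forall>Q\<in>C. Q \<subset> R \<Longrightarrow> sum V C \<le> V R"
    and m: "\<And>C R. C \<subseteq> T \<Longrightarrow> R \<in> T \<Longrightarrow> disjoint C \<Longrightarrow> \<forall>Q\<in>C. Q \<subset> R \<Longrightarrow> sum m C \<le> m R / 2"
    and e: "0 \<le> s" "0 \<le> t" "0 < r" "s + t + r = 1"
    and G: "G \<subseteq> T" and R: "R \<in> T"
  shows "(\<Sum>Q | Q \<in> G \<and> Q \<subseteq> R. U Q powr s * V Q powr t * m Q powr r) \<le>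
     1 / (1 - 2 powr - r) * (U R powr s * V R powr t * m R powr r)"
  using R
proof (induction "card {Q \<in> G. Q \<subset> R}" arbitrary: R rule: less_induct)
  case less
  define L where "L Q = U Q powr s * V Q powr t * m Q powr r" for Q
  define C where "C = 1 / (1 - 2 powr - r)"
  have r2: "2 powr - r < 1" using e by (simp add: powr_minus field_simps)
  then have "0 < C" "C * (1 - 2 powr - r) = 1" unfolding C_def using e by simp_all
  then have C: "0 < C" "1 + C * 2 powr - r = C" by (simp_all add: algebra_simps)
  have L0: "0 \<le> L Q" for Q unfolding L_def by simp
  have finG: "finite G" using G fin finite_subset by blast
  define H where "H = {Q \<in> G. Q \<subset> R}"
  \<comment> \<open>The next generation below \<open>R\<close>.\<close>
  define K where "K = {Q \<in> H. \<forall>Q'\<in>H. \<not> Q \<subset> Q'}"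
  have H: "finite H" "H \<subseteq> T" using finG G unfolding H_def by auto
  then have Hlam: "laminar H" using lam laminar_subset by blast
  have "K \<subseteq> H" unfolding K_def by blast
  then have K: "K \<subseteq> H" "finite K" using H(1) finite_subset by blast+
  have Kdis: "disjoint K"
  proof (unfold disjoint_def, intro ballI impI)
    fix Q R' assume "Q \<in> K" "R' \<in> K" "Q \<noteq> R'"
    then show "Q \<inter> R' = {}" unfolding K_def by (intro maximal_disjoint[OF Hlam]) auto
  qed
  have KR: "\<forall>Q\<in>K. Q \<subset> R" using K unfolding H_def by blast
  have KT: "K \<subseteq> T" using K H by blast
  have IH: "sum L {Q \<in> G. Q \<subseteq> R'} \<le> C * L R'" if "R' \<in> K" for R'
  proof -
    have "{Q \<in> G. Q \<subset> R'} \<subset> {Q \<in> G. Q \<subset> R}"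
      using that K unfolding H_def by blast
    then have "card {Q \<in> G. Q \<subset> R'} < card {Q \<in> G. Q \<subset> R}"
      using finG by (intro psubset_card_mono) auto
    then show ?thesis using less.hyps[of R'] that KT unfolding L_def C_def by blast
  qed
  have "sum L K \<le> sum U K powr s * sum V K powr t * sum m K powr r"
    unfolding L_def using K KT pos e by (intro holder3) auto
  also have "\<dots> \<le> U R powr s * V R powr t * (m R / 2) powr r"
    using U[OF KT less.prems Kdis KR] V[OF KT less.prems Kdis KR] m[OF KT less.prems Kdis KR] e
      KT pos
    by (intro mult_mono powr_mono2 sum_nonneg) (auto simp: subset_iff less_imp_le)
  also have "\<dots> = 2 powr - r * L R"
    unfolding L_def using pos(3)[OF less.prems] by (simp add: powr_divide powr_minus field_simps)
  finally have LK: "sum L K \<le> 2 powr - r * L R" .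
  have "{Q \<in> G. Q \<subseteq> R} \<subseteq> insert R (\<Union>R'\<in>K. {Q \<in> G. Q \<subseteq> R'})"
  proof
    fix Q assume Q: "Q \<in> {Q \<in> G. Q \<subseteq> R}"
    show "Q \<in> insert R (\<Union>R'\<in>K. {Q \<in> G. Q \<subseteq> R'})"
    proof (cases "Q = R")
      case False
      then have "Q \<in> H" using Q unfolding H_def by auto
      then obtain R' where "R' \<in> H" "Q \<subseteq> R'" "\<And>R''. R'' \<in> H \<Longrightarrow> \<not> R' \<subset> R''"
        using maximal_above[OF H(1)] by metis
      then have "R' \<in> K" unfolding K_def by blast
      with \<open>Q \<subseteq> R'\<close> show ?thesis using Q by blast
    qed simp
  qed
  then have "sum L {Q \<in> G. Q \<subseteq> R} \<le> sum L (insert R (\<Union>R'\<in>K. {Q \<in> G. Q \<subseteq> R'}))"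
    using finG K L0 by (intro sum_mono2) auto
  also have "\<dots> \<le> L R + sum L (\<Union>R'\<in>K. {Q \<in> G. Q \<subseteq> R'})"
    using finG K L0 by (subst sum.insert_if) auto
  finally have top: "sum L {Q \<in> G. Q \<subseteq> R} \<le> L R + sum L (\<Union>R'\<in>K. {Q \<in> G. Q \<subseteq> R'})" .
  have "sum L (\<Union>R'\<in>K. {Q \<in> G. Q \<subseteq> R'}) = (\<Sum>R'\<in>K. sum L {Q \<in> G. Q \<subseteq> R'})"
  proof (rule sum.UNION_disjoint)
    show "\<forall>i\<in>K. \<forall>j\<in>K. i \<noteq> j \<longrightarrow> {Q \<in> G. Q \<subseteq> i} \<inter> {Q \<in> G. Q \<subseteq> j} = {}"
    proof (intro ballI impI, rule ccontr)
      fix i j assume ij: "i \<in> K" "j \<in> K" "i \<noteq> j" and "{Q \<in> G. Q \<subseteq> i} \<inter> {Q \<in> G. Q \<subseteq> j} \<noteq> {}"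
      then obtain Q where "Q \<in> G" "Q \<subseteq> i \<inter> j" by blast
      moreover have "i \<inter> j = {}" using Kdis ij unfolding disjoint_def by blast
      ultimately show False using ne G by auto
    qed
  qed (use finG K in auto)
  also have "\<dots> \<le> (\<Sum>R'\<in>K. C * L R')" by (intro sum_mono IH)
  also have "\<dots> = C * sum L K" by (simp add: sum_distrib_left)
  also have "\<dots> \<le> C * (2 powr - r * L R)" using LK C(1) by (intro mult_left_mono) auto
  finally have "sum L {Q \<in> G. Q \<subseteq> R} \<le> (1 + C * 2 powr - r) * L R" using top
    by (simp add: algebra_simps)
  then have "sum L {Q \<in> G. Q \<subseteq> R} \<le> C * L R" by (simp only: C(2))
  then show ?case unfolding L_def C_def .
qed

section \<open>The combinatorial core\<close>

lemma sum_le_sum_over_cover: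
  fixes c :: "'i \<Rightarrow> real"
  assumes "finite T" "finite M" "\<And>i. i \<in> T \<Longrightarrow> 0 \<le> c i"
    and cover: "\<And>i. i \<in> T \<Longrightarrow> \<exists>j\<in>M. P i j"
  shows "sum c T \<le> (\<Sum>j\<in>M. sum c {i \<in> T. P i j})"
proof -
  have "sum c T \<le> (\<Sum>i\<in>T. \<Sum>j\<in>M. if P i j then c i else 0)"
  proof (rule sum_mono)
    fix i assume i: "i \<in> T"
    then obtain j where "j \<in> M" "P i j" using cover by blast
    then have "c i = (if P i j then c i else 0)" by simp
    also have "\<dots> \<le> (\<Sum>j\<in>M. if P i j then c i else 0)"
      using \<open>j \<in> M\<close> assms i by (intro member_le_sum) auto
    finally show "c i \<le> (\<Sum>j\<in>M. if P i j then c i else 0)" .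
  qed
  also have "\<dots> = (\<Sum>j\<in>M. \<Sum>i\<in>T. if P i j then c i else 0)" by (rule sum.swap)
  also have "\<dots> = (\<Sum>j\<in>M. sum c {i \<in> T. P i j})"
    using assms(1) by (simp add: sum.inter_filter)
  finally show ?thesis .
qed

text \<open>The class of \<open>Q\<close> is its value under \<open>\<kappa>\<close>. Every cube lies below a maximal cube of its own class.\<close>

lemma sum_le_sum_over_maximal_in_class:
  fixes c :: "'a set \<Rightarrow> real"
  assumes "finite T" "\<And>Q. Q \<in> T \<Longrightarrow> 0 \<le> c Q"
  shows "sum c T \<le> (\<Sum>R | R \<in> T \<and> (\<forall>Q\<in>T. R \<subset> Q \<longrightarrow> \<kappa> Q \<noteq> \<kappa> R). sum c {Q \<in> T. Q \<subseteq> R \<and> \<kappa> Q = \<kappa> R})"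
proof (rule sum_le_sum_over_cover)
  fix Q assume "Q \<in> T"
  then have "finite {R \<in> T. \<kappa> R = \<kappa> Q}" "Q \<in> {R \<in> T. \<kappa> R = \<kappa> Q}" using assms by auto
  then obtain R where "R \<in> {R \<in> T. \<kappa> R = \<kappa> Q}" "Q \<subseteq> R"
    "\<And>R'. R' \<in> {R \<in> T. \<kappa> R = \<kappa> Q} \<Longrightarrow> \<not> R \<subset> R'" by (rule maximal_above) blast
  then show "\<exists>R\<in>{R. R \<in> T \<and> (\<forall>Q\<in>T. R \<subset> Q \<longrightarrow> \<kappa> Q \<noteq> \<kappa> R)}. Q \<subseteq> R \<and> \<kappa> Q = \<kappa> R"
    by (intro bexI[of _ R]) auto
qed (use assms in auto)

text \<open>The weight \<open>(1/2) ^ n\<close> makes the sum over \<open>n\<close> converge, and \<open>w\<close> is summable over \<open>k\<close>, so a bound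
  that is uniform over the classes of constant \<open>k\<close> and \<open>n\<close> suffices.\<close>

lemma sum_two_parameter_classes:
  fixes b :: "'i \<Rightarrow> real" and k n :: "'i \<Rightarrow> nat"
  assumes fin: "finite M" and b: "\<And>Q. Q \<in> M \<Longrightarrow> b Q \<le> (1 / 2) ^ n Q * w (k Q) * z Q"
    and w: "\<And>i. 0 \<le> w i" "summable w" and "0 \<le> Y"
    and Y: "\<And>i j. (\<Sum>Q | Q \<in> M \<and> k Q = i \<and> n Q = j. z Q) \<le> Y"
  shows "sum b M \<le> 2 * (\<Sum>i. w i) * Y"
proof -
  define I where "I = k ` M \<times> n ` M"
  have finI: "finite (k ` M)" "finite (n ` M)" using fin by auto
  have "sum b M \<le> (\<Sum>Q\<in>M. (1 / 2) ^ n Q * w (k Q) * z Q)" by (intro sum_mono b)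
  also have "\<dots> = (\<Sum>i\<in>k ` M. \<Sum>Q | Q \<in> M \<and> k Q = i. (1 / 2) ^ n Q * w (k Q) * z Q)"
    by (rule sum.image_gen[OF fin])
  also have "\<dots> = (\<Sum>i\<in>k ` M. \<Sum>j\<in>n ` M. \<Sum>Q | Q \<in> {Q \<in> M. k Q = i} \<and> n Q = j. (1 / 2) ^ n Q * w (k Q) * z Q)"
  proof (rule sum.cong)
    fix i
    show "(\<Sum>Q | Q \<in> M \<and> k Q = i. (1 / 2) ^ n Q * w (k Q) * z Q) =
      (\<Sum>j\<in>n ` M. \<Sum>Q | Q \<in> {Q \<in> M. k Q = i} \<and> n Q = j. (1 / 2) ^ n Q * w (k Q) * z Q)"
      using fin by (subst sum.group) auto
  qed simp
  also have "\<dots> = (\<Sum>i\<in>k ` M. \<Sum>j\<in>n ` M. (1 / 2) ^ j * w i * (\<Sum>Q | Q \<in> M \<and> k Q = i \<and> n Q = j. z Q))"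
    by (simp add: sum_distrib_left)
  also have "\<dots> \<le> (\<Sum>i\<in>k ` M. \<Sum>j\<in>n ` M. (1 / 2) ^ j * w i * Y)"
    using w by (intro sum_mono mult_left_mono Y) simp
  also have "\<dots> = (\<Sum>i\<in>k ` M. w i) * (\<Sum>j\<in>n ` M. (1 / 2) ^ j) * Y"
    unfolding sum_product unfolding sum_distrib_right by (simp only: mult_ac)
  also have "\<dots> \<le> (\<Sum>i. w i) * 2 * Y"
  proof (intro mult_right_mono mult_mono sum_nonneg suminf_nonneg)
    show "(\<Sum>i\<in>k ` M. w i) \<le> (\<Sum>i. w i)"
      using w finI by (intro sum_le_suminf) auto
    have "(\<Sum>j\<in>n ` M. (1 / 2) ^ j) \<le> (\<Sum>j. (1 / 2 :: real) ^ j)"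
      using finI by (intro sum_le_suminf summable_geometric) auto
    also have "\<dots> = 2" by (simp add: suminf_geometric)
    finally show "(\<Sum>j\<in>n ` M. (1 / 2) ^ j) \<le> (2 :: real)" .
  qed (use w \<open>0 \<le> Y\<close> in auto)
  finally show ?thesis by (simp add: mult_ac)
qed

text \<open>The combinatorial core. The numbers \<open>s\<close>, \<open>t\<close> stand for \<open>1/p\<close>, \<open>1/p'\<close>, the set functions \<open>U\<close>, \<open>V\<close>,
  \<open>m\<close> for the two weights and the underlying measure, \<open>x\<close> and \<open>y\<close> for (powers of) stopping averages
  of the two functions, and \<open>E\<close> for the \<open>A_inf\<close> characteristic of the weight behind \<open>U\<close>. Write
  \<open>L = A U\<^sup>s V\<^sup>t\<close>.

  Put two cubes into the same class if they agree in the dyadic sizes of \<open>E\<close>, of the ratio \<open>\<theta>\<close> of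
  \<open>A\<close> to the bound that the bump condition gives for it, and of \<open>x\<close> and \<open>y\<close>. Three facts are
  combined.

  Within a class \<open>A\<close> is constant up to a factor \<open>2\<close>. Since \<open>s + t = 1\<close>, splitting off the power
  \<open>A powr (1 + \<epsilon>)\<close> instead of \<open>A\<close> from \<open>L\<close> leaves a geometric mean of \<open>U\<close>, \<open>V\<close> and a positive
  power of \<open>m\<close>; hence by \<open>geometric_mean_packing\<close> the sum over the cubes of a class inside one of
  its cubes \<open>R\<close> is at most a constant times the term of \<open>R\<close>. Only the maximal cubes \<open>Mx\<close> of the
  classes remain.

  Hoelder's inequality separates the two functions. The bump condition supplies the factor
  \<open>E powr - s\<close>, which goes to \<open>x U\<close>, and \<open>\<Psi>(E)\<close> in the denominator, which goes to \<open>y V\<close>; the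
  \<open>x\<close>-factor is the quantity bounded by \<open>X\<close>.

  In the \<open>y\<close>-factor fix the sizes of \<open>E\<close> and \<open>\<theta>\<close>. If nested cubes of \<open>Mx\<close> had the same
  \<open>y\<close>-level, they would by hypothesis have the same \<open>x\<close>-level, so be in the same class, against
  maximality. Hence \<open>Y\<close> bounds that part, and the parts are summed by means of the powers of \<open>\<theta>\<close>
  and the summability of \<open>\<Psi>(2\<^sup>k) powr (-1/t)\<close>.\<close>

lemma one_sided_sparse_bound:
  fixes U V m E x y A :: "'a set \<Rightarrow> real" and \<Psi> :: "real \<Rightarrow> real"
  assumes lam: "laminar T" and fin: "finite T" and ne: "{} \<notin> T"
    and pos: "\<And>Q. Q \<in> T \<Longrightarrow> 0 < U Q" "\<And>Q. Q \<in> T \<Longrightarrow> 0 < V Q" "\<And>Q. Q \<in> T \<Longrightarrow> 0 < m Q"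
      "\<And>Q. Q \<in> T \<Longrightarrow> 0 < x Q" "\<And>Q. Q \<in> T \<Longrightarrow> 0 < y Q"
    and U: "\<And>C R. C \<subseteq> T \<Longrightarrow> R \<in> T \<Longrightarrow> disjoint C \<Longrightarrow> \<forall>Q\<in>C. Q \<subset> R \<Longrightarrow> sum U C \<le> U R"
    and V: "\<And>C R. C \<subseteq> T \<Longrightarrow> R \<in> T \<Longrightarrow> disjoint C \<Longrightarrow> \<forall>Q\<in>C. Q \<subset> R \<Longrightarrow> sum V C \<le> V R"
    and m: "\<And>C R. C \<subseteq> T \<Longrightarrow> R \<in> T \<Longrightarrow> disjoint C \<Longrightarrow> \<forall>Q\<in>C. Q \<subset> R \<Longrightarrow> sum m C \<le> m R / 2"
    and e: "0 < s" "0 < t" "s + t = 1" "0 < \<alpha>" "0 < \<beta>" "0 < \<epsilon>" "\<alpha> * \<epsilon> \<le> s" "\<beta> * \<epsilon> \<le> t"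
    and A: "\<And>Q. Q \<in> T \<Longrightarrow> A Q = (U Q / m Q) powr \<alpha> * (V Q / m Q) powr \<beta>"
    and E: "\<And>Q. Q \<in> T \<Longrightarrow> 1 \<le> E Q"
    and \<Psi>: "mono_on {1/2..} \<Psi>" "\<And>t. 1/2 \<le> t \<Longrightarrow> 0 < \<Psi> t" "summable (\<lambda>k. \<Psi> (2 ^ k) powr (- 1 / t))"
    and K: "0 < K" "\<And>Q. Q \<in> T \<Longrightarrow> A Q * E Q powr s * \<Psi> (E Q) \<le> K"
    and levels: "\<And>Q R. Q \<in> T \<Longrightarrow> R \<in> T \<Longrightarrow> Q \<subseteq> R \<Longrightarrow> level (y R) = level (y Q) \<Longrightarrow> level (x R) = level (x Q)"
    and X: "(\<Sum>Q\<in>T. x Q * U Q / E Q) \<le> X"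
    and Y: "\<And>G. G \<subseteq> T \<Longrightarrow> (\<And>Q R. Q \<in> G \<Longrightarrow> R \<in> G \<Longrightarrow> Q \<subset> R \<Longrightarrow> level (y Q) \<noteq> level (y R)) \<Longrightarrow>
      (\<Sum>Q\<in>G. y Q * V Q) \<le> Y"
  shows "(\<Sum>Q\<in>T. x Q powr s * y Q powr t * (A Q * U Q powr s * V Q powr t)) \<le>
     2 powr (3 + \<epsilon>) / (1 - 2 powr - (\<epsilon> * (\<alpha> + \<beta>))) * K * X powr s *
       (4 * (\<Sum>k. \<Psi> (2 ^ k) powr (- 1 / t)) * Y) powr t"
proof -
  define C where "C = 1 / (1 - 2 powr - (\<epsilon> * (\<alpha> + \<beta>)))"
  define k where "k Q = nat (level (E Q))" for Q
  \<comment> \<open>The bound for \<open>A\<close> that the bump condition yields for \<open>E \<ge> 2\<^sup>i\<close>.\<close>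
  define B where "B i = K * (2 ^ i) powr - s / \<Psi> (2 ^ i)" for i :: nat
  define \<theta> where "\<theta> Q = A Q / B (k Q)" for Q
  define n where "n Q = nat (- level (\<theta> Q))" for Q
  define \<kappa> where "\<kappa> Q = (k Q, n Q, level (x Q), level (y Q))" for Q
  define L where "L Q = A Q * U Q powr s * V Q powr t" for Q
  define c where "c Q = x Q powr s * y Q powr t * L Q" for Q
  define Mx where "Mx = {R. R \<in> T \<and> (\<forall>Q\<in>T. R \<subset> Q \<longrightarrow> \<kappa> Q \<noteq> \<kappa> R)}"
  have Mx: "Mx \<subseteq> T" "finite Mx" using fin unfolding Mx_def by auto
  have "2 powr - (\<epsilon> * (\<alpha> + \<beta>)) < 2 powr (0 :: real)" using e by (intro powr_less_mono) auto
  then have C: "0 < C" unfolding C_def by simp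
  have \<Psi>2: "0 < \<Psi> (2 ^ i)" for i :: nat
    using one_le_power[of "2::real" i] by (intro \<Psi>(2)) linarith
  have B: "0 < B i" for i unfolding B_def using \<Psi>2 K by simp
  have Apos: "0 < A Q" if "Q \<in> T" for Q using A[OF that] pos[OF that] by simp
  have kE: "2 ^ k Q \<le> E Q" "E Q < 2 * 2 ^ k Q" if Q: "Q \<in> T" for Q
  proof -
    have "level 1 \<le> level (E Q)" using E[OF Q] by (intro level_mono) auto
    then have "0 \<le> level (E Q)" by (simp add: level_def)
    then have "(2::real) ^ k Q = 2 powr level (E Q)"
      unfolding k_def by (simp flip: powr_realpow)
    then show "2 ^ k Q \<le> E Q" "E Q < 2 * 2 ^ k Q"
      using level_bounds[of "E Q"] E[OF Q] by (simp_all add: powr_add)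
  qed
  have \<theta>: "0 < \<theta> Q" "\<theta> Q \<le> 1" if Q: "Q \<in> T" for Q
  proof -
    show "0 < \<theta> Q" unfolding \<theta>_def using Apos[OF Q] B by simp
    have "A Q * (2 ^ k Q) powr s * \<Psi> (2 ^ k Q) \<le> A Q * E Q powr s * \<Psi> (E Q)"
      using kE[OF Q] E[OF Q] Apos[OF Q] \<Psi>2[of "k Q"] e one_le_power[of "2::real" "k Q"]
      by (intro mult_mono powr_mono2 mono_onD[OF \<Psi>(1)]) auto
    also have "\<dots> \<le> K" by (rule K(2)[OF Q])
    finally show "\<theta> Q \<le> 1" unfolding \<theta>_def B_def
      using K(1) \<Psi>2[of "k Q"] by (simp add: powr_minus field_simps)
  qed
  have \<theta>n: "\<theta> Q \<le> 2 * (1 / 2) ^ n Q" "level (\<theta> Q) = - int (n Q)" if Q: "Q \<in> T" for Q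
  proof -
    have "level (\<theta> Q) \<le> level 1" using \<theta>[OF Q] by (intro level_mono) auto
    then show lev: "level (\<theta> Q) = - int (n Q)" unfolding n_def by (simp add: level_def)
    have "\<theta> Q \<le> 2 powr (level (\<theta> Q) + 1)" using level_bounds(2)[OF \<theta>(1)[OF Q]] by simp
    then show "\<theta> Q \<le> 2 * (1 / 2) ^ n Q"
      by (simp add: lev powr_diff powr_realpow power_one_over)
  qed
  have A_same: "A Q \<le> 2 * A R" if "Q \<in> T" "R \<in> T" "\<kappa> Q = \<kappa> R" for Q R
  proof -
    have "\<theta> Q < 2 * \<theta> R"
      using that \<theta> \<theta>n(2) by (intro less_twice_if_same_level) (auto simp: \<kappa>_def)
    then show ?thesis using that B[of "k R"] unfolding \<theta>_def \<kappa>_def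
      by (simp add: divide_simps)
  qed
  have L_eq: "L Q = A Q powr (1 + \<epsilon>) *
      (U Q powr (s - \<alpha> * \<epsilon>) * V Q powr (t - \<beta> * \<epsilon>) * m Q powr (\<epsilon> * (\<alpha> + \<beta>)))" if Q: "Q \<in> T" for Q
  proof -
    have "A Q powr \<epsilon> * (U Q powr (s - \<alpha> * \<epsilon>) * V Q powr (t - \<beta> * \<epsilon>) * m Q powr (\<epsilon> * (\<alpha> + \<beta>)))
       = U Q powr s * V Q powr t"
      using pos[OF Q] unfolding A[OF Q]
      by (simp add: powr_mult powr_divide powr_powr powr_diff powr_add field_simps)
    then show ?thesis unfolding L_def using Apos[OF Q] by (simp add: powr_add mult.assoc)
  qed
  have packing: "sum c {Q \<in> T. Q \<subseteq> R \<and> \<kappa> Q = \<kappa> R} \<le> 2 powr (2 + \<epsilon>) * C * c R" if R: "R \<in> T" for R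
  proof -
    define P where "P Q = U Q powr (s - \<alpha> * \<epsilon>) * V Q powr (t - \<beta> * \<epsilon>) * m Q powr (\<epsilon> * (\<alpha> + \<beta>))" for Q
    define D where "D = 2 * (x R powr s * y R powr t) * (2 * A R) powr (1 + \<epsilon>)"
    have "c Q \<le> D * P Q" if Q: "Q \<in> T" "\<kappa> Q = \<kappa> R" for Q
    proof -
      have "x Q \<le> 2 * x R" "y Q \<le> 2 * y R"
        using less_twice_if_same_level[of "x Q" "x R"] less_twice_if_same_level[of "y Q" "y R"]
          pos Q R by (auto simp: \<kappa>_def less_imp_le)
      then have "c Q \<le> (2 * x R) powr s * (2 * y R) powr t * ((2 * A R) powr (1 + \<epsilon>) * P Q)"
        unfolding c_def L_eq[OF Q(1)] P_def[symmetric]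
        using A_same[OF Q(1) R Q(2)] pos[OF Q(1)] Apos[OF Q(1)] e
        by (intro mult_mono powr_mono2) (auto simp: P_def)
      also have "(2 * x R) powr s * (2 * y R) powr t = 2 * (x R powr s * y R powr t)"
        using pos[OF R] e by (simp add: powr_mult flip: powr_add)
      finally show ?thesis by (simp add: D_def mult_ac)
    qed
    then have "sum c {Q \<in> T. Q \<subseteq> R \<and> \<kappa> Q = \<kappa> R} \<le> (\<Sum>Q | Q \<in> {Q \<in> T. \<kappa> Q = \<kappa> R} \<and> Q \<subseteq> R. D * P Q)"
      by (intro order_trans[OF sum_mono sum_mono2]) (use fin in auto)
    also have "\<dots> = D * (\<Sum>Q | Q \<in> {Q \<in> T. \<kappa> Q = \<kappa> R} \<and> Q \<subseteq> R. P Q)"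
      by (simp add: sum_distrib_left)
    also have "\<dots> \<le> D * (C * P R)"
      unfolding C_def P_def using e pos
      by (intro mult_left_mono geometric_mean_packing[OF lam fin ne _ _ _ U V m _ _ _ _ _ R])
        (auto simp: D_def algebra_simps intro!: add_pos_pos mult_pos_pos)
    also have "\<dots> = 2 powr (2 + \<epsilon>) * C * c R"
      unfolding D_def c_def L_eq[OF R] P_def
      using Apos[OF R] by (simp add: powr_mult powr_add)
    finally show ?thesis .
  qed
  define a where "a Q = x Q * U Q / E Q" for Q
  define b where "b Q = y Q * V Q * \<theta> Q * \<Psi> (2 ^ k Q) powr (- 1 / t)" for Q
  have ab_pos: "0 < a Q" "0 < b Q" if "Q \<in> T" for Q
  proof -
    have "0 < E Q" using E[OF that] by linarith
    then show "0 < a Q" "0 < b Q"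
      using pos[OF that] \<theta>(1)[OF that] \<Psi>2[of "k Q"] unfolding a_def b_def by simp_all
  qed
  have "c Q \<le> 2 * K * (a Q powr s * b Q powr t)" if Q: "Q \<in> T" for Q
  proof -
    \<comment> \<open>Weaken \<open>\<theta>\<close> to \<open>\<theta>\<^sup>t\<close>: only the \<open>y\<close>-factor needs the decay in \<open>\<theta>\<close>.\<close>
    have "A Q = \<theta> Q * (K * (2 ^ k Q) powr - s / \<Psi> (2 ^ k Q))"
      unfolding \<theta>_def B_def[symmetric] using B[of "k Q"] by simp
    also have "\<dots> \<le> \<theta> Q powr t * (K * (2 * E Q powr - s) / \<Psi> (2 ^ k Q))"
    proof (intro mult_mono divide_right_mono mult_left_mono)
      have "\<theta> Q powr 1 \<le> \<theta> Q powr t" using \<theta>[OF Q] e by (intro powr_mono') auto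
      then show "\<theta> Q \<le> \<theta> Q powr t" using \<theta>[OF Q] by simp
      have "(2 ^ k Q) powr - s \<le> (E Q / 2) powr - s"
        using kE[OF Q] e E[OF Q] by (intro powr_mono2') auto
      also have "\<dots> = 2 powr s * E Q powr - s"
        using E[OF Q] by (simp add: powr_divide powr_minus) (simp add: divide_inverse)
      also have "\<dots> \<le> 2 powr 1 * E Q powr - s"
        using e by (intro mult_right_mono powr_mono) auto
      finally show "(2 ^ k Q) powr - s \<le> 2 * E Q powr - s" by simp
    qed (use \<Psi>2[of "k Q"] K in auto)
    finally have "c Q \<le> x Q powr s * y Q powr t *
       (\<theta> Q powr t * (K * (2 * E Q powr - s) / \<Psi> (2 ^ k Q)) * U Q powr s * V Q powr t)"
      unfolding c_def L_def by (intro mult_left_mono mult_right_mono) auto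
    also have "\<dots> = 2 * K * (a Q powr s * b Q powr t)"
      unfolding a_def b_def using pos[OF Q] \<theta>[OF Q] E[OF Q] \<Psi>2[of "k Q"] e
      by (simp add: powr_mult powr_divide powr_powr powr_minus field_simps)
    finally show ?thesis .
  qed
  then have "sum c Mx \<le> 2 * K * (\<Sum>Q\<in>Mx. a Q powr s * b Q powr t)"
    using Mx unfolding sum_distrib_left by (intro sum_mono) auto
  also have "\<dots> \<le> 2 * K * (sum a Mx powr s * sum b Mx powr t)"
    using Mx ab_pos K e by (intro mult_left_mono holder2) auto
  also have "\<dots> \<le> 2 * K * (X powr s * (4 * (\<Sum>k. \<Psi> (2 ^ k) powr (- 1 / t)) * Y) powr t)"
  proof (intro mult_left_mono mult_mono powr_mono2)
    have nn: "0 \<le> a Q" "0 \<le> b Q" if "Q \<in> T" for Q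
      using ab_pos[OF that] by simp_all
    show "0 \<le> sum a Mx" "0 \<le> sum b Mx" using nn Mx by (auto intro!: sum_nonneg)
    have "sum a Mx \<le> sum a T" using nn Mx fin by (intro sum_mono2) auto
    then show "sum a Mx \<le> X" using X unfolding a_def by simp
    \<comment> \<open>Fix the sizes of \<open>E\<close> and \<open>\<theta>\<close>; the factor \<open>2\<close> comes from \<open>\<theta> \<le> 2 (1/2)\<^sup>n\<close>.\<close>
    have "sum b Mx \<le> 2 * (\<Sum>i. 2 * \<Psi> (2 ^ i) powr (- 1 / t)) * Y"
    proof (rule sum_two_parameter_classes)
      fix Q assume "Q \<in> Mx"
      then have Q: "Q \<in> T" using Mx by blast
      have "b Q \<le> y Q * V Q * (2 * (1 / 2) ^ n Q) * \<Psi> (2 ^ k Q) powr (- 1 / t)"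
        unfolding b_def using pos[OF Q] \<theta>n[OF Q] by (intro mult_right_mono mult_left_mono) auto
      then show "b Q \<le> (1 / 2) ^ n Q * (2 * \<Psi> (2 ^ k Q) powr (- 1 / t)) * (y Q * V Q)"
        by (simp add: mult_ac)
    next
      show "0 \<le> Y" using Y[of "{}"] by simp
    next
      fix i j
      show "(\<Sum>Q | Q \<in> Mx \<and> k Q = i \<and> n Q = j. y Q * V Q) \<le> Y"
      proof (rule Y)
        fix Q R assume QR: "Q \<in> {Q \<in> Mx. k Q = i \<and> n Q = j}" "R \<in> {Q \<in> Mx. k Q = i \<and> n Q = j}" "Q \<subset> R"
        show "level (y Q) \<noteq> level (y R)"
        proof
          assume lev: "level (y Q) = level (y R)"
          then have "level (x R) = level (x Q)" using QR Mx levels[of Q R] by auto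
          then have "\<kappa> R = \<kappa> Q" using QR lev by (auto simp: \<kappa>_def)
          then show False using QR Mx unfolding Mx_def by auto
        qed
      qed (use Mx in auto)
    qed (use \<Psi>(3) Mx in \<open>auto intro: summable_mult\<close>)
    then show "sum b Mx \<le> 4 * (\<Sum>k. \<Psi> (2 ^ k) powr (- 1 / t)) * Y"
      using \<Psi>(3) by (simp add: suminf_mult)
  qed (use e K in auto)
  finally have "sum c Mx \<le> 2 * K * (X powr s * (4 * (\<Sum>k. \<Psi> (2 ^ k) powr (- 1 / t)) * Y) powr t)" .
  moreover have "sum c T \<le> 2 powr (2 + \<epsilon>) * C * sum c Mx"
  proof -
    have "sum c T \<le> (\<Sum>R\<in>Mx. sum c {Q \<in> T. Q \<subseteq> R \<and> \<kappa> Q = \<kappa> R})"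
      unfolding Mx_def using fin Apos
      by (intro sum_le_sum_over_maximal_in_class) (auto simp: c_def L_def less_imp_le)
    also have "\<dots> \<le> (\<Sum>R\<in>Mx. 2 powr (2 + \<epsilon>) * C * c R)"
      using Mx by (intro sum_mono packing) auto
    finally show ?thesis by (simp add: sum_distrib_left)
  qed
  ultimately have "sum c T \<le> 2 powr (2 + \<epsilon>) * C *
      (2 * K * (X powr s * (4 * (\<Sum>k. \<Psi> (2 ^ k) powr (- 1 / t)) * Y) powr t))"
    using C by (smt (verit) mult_left_mono mult_nonneg_nonneg powr_ge_zero)
  also have "\<dots> = 2 powr (3 + \<epsilon>) * C * K * X powr s * (4 * (\<Sum>k. \<Psi> (2 ^ k) powr (- 1 / t)) * Y) powr t"
    by (simp add: powr_add)
  finally show ?thesis unfolding c_def L_def C_def by simp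
qed

section \<open>Dyadic maximal functions\<close>

definition ancestor_max :: "'a set set \<Rightarrow> ('a set \<Rightarrow> real) \<Rightarrow> 'a set \<Rightarrow> real" where
  "ancestor_max S a Q = Max (a ` {R \<in> S. Q \<subseteq> R})"

text \<open>For \<open>a Q\<close> an average over \<open>Q\<close> this is the dyadic maximal function of the finite family \<open>S\<close>, which
  vanishes off the union of \<open>S\<close>.\<close>

definition maximal_fun :: "'a set set \<Rightarrow> ('a set \<Rightarrow> real) \<Rightarrow> 'a \<Rightarrow> real" where
  "maximal_fun S a z = Max (insert 0 ((\<lambda>R. a R * indicator R z) ` S))"

lemma ancestor_max_ge: "finite S \<Longrightarrow> R \<in> S \<Longrightarrow> Q \<subseteq> R \<Longrightarrow> a R \<le> ancestor_max S a Q"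
  unfolding ancestor_max_def by (intro Max_ge) auto

lemma ancestor_max_attained:
  assumes "finite S" "Q \<in> S"
  obtains R where "R \<in> S" "Q \<subseteq> R" "ancestor_max S a Q = a R"
proof -
  have "ancestor_max S a Q \<in> a ` {R \<in> S. Q \<subseteq> R}"
    unfolding ancestor_max_def using assms by (intro Max_in) auto
  then show thesis using that by auto
qed

lemma ancestor_max_antimono:
  assumes "finite S" "R \<in> S" "Q \<subseteq> R"
  shows "ancestor_max S a R \<le> ancestor_max S a Q"
proof -
  obtain R' where R': "R' \<in> S" "R \<subseteq> R'" "ancestor_max S a R = a R'"
    using ancestor_max_attained[OF assms(1,2)] .
  then show ?thesis using ancestor_max_ge[OF assms(1), of R' Q a] assms(3) by auto
qed

lemma maximal_fun_nonneg: "finite S \<Longrightarrow> 0 \<le> maximal_fun S a z"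
  unfolding maximal_fun_def by (intro Max_ge) auto

lemma maximal_fun_ge: "finite S \<Longrightarrow> R \<in> S \<Longrightarrow> z \<in> R \<Longrightarrow> a R \<le> maximal_fun S a z"
  unfolding maximal_fun_def by (intro Max_ge) (auto simp: image_iff intro!: bexI[of _ R])

lemma ancestor_max_le_maximal_fun:
  assumes "finite S" "Q \<in> S" "z \<in> Q"
  shows "ancestor_max S a Q \<le> maximal_fun S a z"
proof -
  obtain R where "R \<in> S" "Q \<subseteq> R" "ancestor_max S a Q = a R"
    using ancestor_max_attained[OF assms(1,2)] .
  then show ?thesis using maximal_fun_ge[OF assms(1), of R z a] assms(3) by auto
qed

lemma maximal_fun_cases:
  assumes "finite S"
  obtains "maximal_fun S a z = 0" | R where "R \<in> S" "z \<in> R" "maximal_fun S a z = a R"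
proof -
  have "maximal_fun S a z \<in> insert 0 ((\<lambda>R. a R * indicator R z) ` S)"
    unfolding maximal_fun_def using assms by (intro Max_in) auto
  then consider "maximal_fun S a z = 0" | R where "R \<in> S" "maximal_fun S a z = a R * indicator R z"
    by auto
  then show thesis
  proof cases
    case 2
    then show thesis using that by (cases "z \<in> R") auto
  qed (use that in blast)
qed

lemma borel_measurable_maximal_fun [measurable (raw)]:
  assumes "finite S" "S \<subseteq> sets N"
  shows "maximal_fun S a \<in> borel_measurable N"
proof -
  have "(\<lambda>z. Max (insert 0 ((\<lambda>R. a R * indicator R z) ` S))) \<in> borel_measurable N"
    using assms
  proof (induction S rule: finite_induct)
    case (insert R S)
    have "Max (insert 0 ((\<lambda>R. a R * indicator R z) ` insert R S)) =
       max (a R * indicator R z) (Max (insert 0 ((\<lambda>R. a R * indicator R z) ` S)))" for z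
      using insert.hyps by (simp add: insert_commute[of 0])
    moreover have "R \<in> sets N" "(\<lambda>z. Max (insert 0 ((\<lambda>R. a R * indicator R z) ` S))) \<in> borel_measurable N"
      using insert by auto
    ultimately show ?case
      by (simp only:) (intro borel_measurable_max borel_measurable_times borel_measurable_const
        borel_measurable_indicator)
  qed simp
  then show ?thesis unfolding maximal_fun_def[abs_def] .
qed

text \<open>The members of \<open>G\<close> that contain a given point form a chain, so their stopping values lie on distinct
  levels, and the sum is geometric.\<close>

lemma sum_indicator_distinct_levels:
  assumes lam: "laminar S" and fin: "finite S" and a: "\<And>Q. Q \<in> S \<Longrightarrow> 0 < a Q"
    and G: "G \<subseteq> S" and \<theta>: "0 < \<theta>"
    and lev: "\<And>Q R. Q \<in> G \<Longrightarrow> R \<in> G \<Longrightarrow> Q \<subset> R \<Longrightarrow>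
      level (ancestor_max S a Q) \<noteq> level (ancestor_max S a R)"
  shows "(\<Sum>Q\<in>G. ancestor_max S a Q powr \<theta> * indicator Q z) \<le>
    2 powr \<theta> / (1 - 2 powr - \<theta>) * maximal_fun S a z powr \<theta>"
proof -
  have finG: "finite G" using G fin finite_subset by blast
  have "(\<Sum>Q\<in>G. ancestor_max S a Q powr \<theta> * indicator Q z) =
      (\<Sum>Q | Q \<in> G \<and> z \<in> Q. ancestor_max S a Q powr \<theta>)"
    by (subst sum.inter_filter[OF finG]) (auto intro!: sum.cong)
  also have "\<dots> \<le> 2 powr \<theta> / (1 - 2 powr - \<theta>) * maximal_fun S a z powr \<theta>"
  proof (rule sum_powr_distinct_levels)
    show "inj_on (\<lambda>Q. level (ancestor_max S a Q)) {Q \<in> G. z \<in> Q}"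
    proof (rule inj_onI, rule ccontr)
      fix Q R assume QR: "Q \<in> {Q \<in> G. z \<in> Q}" "R \<in> {Q \<in> G. z \<in> Q}" "Q \<noteq> R"
        and eq: "level (ancestor_max S a Q) = level (ancestor_max S a R)"
      have "Q \<in> S" "R \<in> S" "Q \<inter> R \<noteq> {}" using QR G by auto
      then have "Q \<subseteq> R \<or> R \<subseteq> Q" using lam unfolding laminar_def by blast
      then have "Q \<subset> R \<or> R \<subset> Q" using QR by blast
      then show False using lev[of Q R] lev[of R Q] QR eq by auto
    qed
    fix Q assume Q: "Q \<in> {Q \<in> G. z \<in> Q}"
    then have QS: "Q \<in> S" using G by blast
    show "0 < ancestor_max S a Q"
      using ancestor_max_ge[OF fin QS order_refl, of a] a[OF QS] by linarith
    show "ancestor_max S a Q \<le> maximal_fun S a z"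
      using Q ancestor_max_le_maximal_fun[OF fin QS] by blast
  qed (use finG \<theta> maximal_fun_nonneg[OF fin] in auto)
  finally show ?thesis .
qed

lemma nn_integral_sum_indicator:
  assumes "finite I" "\<And>i. i \<in> I \<Longrightarrow> B i \<in> sets N" "\<And>i. i \<in> I \<Longrightarrow> 0 \<le> x i"
  shows "(\<integral>\<^sup>+z. ennreal (\<Sum>i\<in>I. x i * indicator (B i) z) \<partial>N) = (\<Sum>i\<in>I. ennreal (x i) * emeasure N (B i))"
proof -
  have "(\<integral>\<^sup>+z. ennreal (\<Sum>i\<in>I. x i * indicator (B i) z) \<partial>N) =
      (\<integral>\<^sup>+z. (\<Sum>i\<in>I. ennreal (x i) * indicator (B i) z) \<partial>N)"
    using assms(3) by (intro nn_integral_cong)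
      (auto simp: sum_ennreal[symmetric] ennreal_mult ennreal_indicator simp del: sum_ennreal intro!: sum.cong)
  also have "\<dots> = (\<Sum>i\<in>I. ennreal (x i) * emeasure N (B i))"
    using assms by (subst nn_integral_sum) (auto intro!: sum.cong nn_integral_cmult_indicator)
  finally show ?thesis .
qed

lemma sum_distinct_levels_le_integral:
  assumes lam: "laminar S" and fin: "finite S" and S: "S \<subseteq> sets N" and a: "\<And>Q. Q \<in> S \<Longrightarrow> 0 < a Q"
    and G: "G \<subseteq> S"
    and lev: "\<And>Q R. Q \<in> G \<Longrightarrow> R \<in> G \<Longrightarrow> Q \<subset> R \<Longrightarrow>
      level (ancestor_max S a Q) \<noteq> level (ancestor_max S a R)"
  shows "(\<Sum>Q\<in>G. ennreal (ancestor_max S a Q) * emeasure N Q) \<le>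
    4 * (\<integral>\<^sup>+z. ennreal (maximal_fun S a z) \<partial>N)"
proof -
  have finG: "finite G" using G fin finite_subset by blast
  have pos: "0 < ancestor_max S a Q" if "Q \<in> G" for Q
    using ancestor_max_ge[OF fin _ order_refl, of Q a] a[of Q] that G by force
  have "(\<Sum>Q\<in>G. ennreal (ancestor_max S a Q) * emeasure N Q) =
      (\<integral>\<^sup>+z. ennreal (\<Sum>Q\<in>G. ancestor_max S a Q * indicator Q z) \<partial>N)"
    using finG G S pos by (subst nn_integral_sum_indicator) (auto simp: less_imp_le)
  also have "\<dots> \<le> (\<integral>\<^sup>+z. 4 * ennreal (maximal_fun S a z) \<partial>N)"
  proof (rule nn_integral_mono)
    fix z
    have "(\<Sum>Q\<in>G. ancestor_max S a Q * indicator Q z) =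
      (\<Sum>Q\<in>G. ancestor_max S a Q powr 1 * indicator Q z)"
      using pos by (intro sum.cong) (auto simp: less_imp_le)
    also have "\<dots> \<le> 2 powr 1 / (1 - 2 powr - 1) * maximal_fun S a z powr 1"
      using sum_indicator_distinct_levels[OF lam fin a G zero_less_one lev, of z] by simp
    also have "\<dots> = 4 * maximal_fun S a z"
      using maximal_fun_nonneg[OF fin, of a z] by (simp add: powr_minus)
    finally show "ennreal (\<Sum>Q\<in>G. ancestor_max S a Q * indicator Q z) \<le> 4 * ennreal (maximal_fun S a z)"
      by (metis ennreal_leI ennreal_mult' ennreal_numeral zero_le_numeral)
  qed
  also have "\<dots> = 4 * (\<integral>\<^sup>+z. ennreal (maximal_fun S a z) \<partial>N)"
    using fin S by (intro nn_integral_cmult) measurable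
  finally show ?thesis .
qed

text \<open>The constant that Young's inequality produces in the maximal inequality.\<close>

definition maximal_const :: "real \<Rightarrow> real" where
  "maximal_const s = (4 * (2 powr (1 - 1 / s) / (1 - 2 powr - (1 - 1 / s)))) powr s"

text \<open>Doob's inequality, with dyadic levels in place of the distribution function. Let \<open>X\<close> be the maximal
  function of the \<open>s\<close>-th powers of the averages. At a point it is at most twice the stopping value
  \<open>x Q\<close> of some cube \<open>Q\<close> that is maximal in its level, and for such a cube the stopping value is the
  \<open>s\<close>-th power of the average over \<open>Q\<close> itself. So
  \<open>\<integral> X \<le> 2 \<Sum> x Q N(Q) = 2 \<integral> h \<Sum> x Q powr (1 - 1/s)\<close> over the maximal cubes \<open>Q\<close>, and the inner sum
  is geometric, so at most a multiple of \<open>X powr (1 - 1/s)\<close>. Young's inequality absorbs \<open>X\<close> into the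
  left-hand side, which is finite because \<open>S\<close> is.\<close>

lemma maximal_inequality_pos:
  fixes h :: "'a \<Rightarrow> real"
  assumes s: "1 < s"
    and lam: "laminar S" and fin: "finite S" and S: "S \<subseteq> sets N"
    and pos: "\<And>Q. Q \<in> S \<Longrightarrow> 0 < emeasure N Q" "\<And>Q. Q \<in> S \<Longrightarrow> emeasure N Q < \<infinity>"
    and [measurable]: "h \<in> borel_measurable N" and h: "\<And>z. 0 \<le> h z"
    and int: "\<And>Q. Q \<in> S \<Longrightarrow> (\<integral>\<^sup>+z\<in>Q. ennreal (h z) \<partial>N) < \<infinity>"
    and a: "\<And>Q. Q \<in> S \<Longrightarrow> a Q = (enn2real (\<integral>\<^sup>+z\<in>Q. ennreal (h z) \<partial>N) / measure N Q) powr s"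
    and apos: "\<And>Q. Q \<in> S \<Longrightarrow> 0 < a Q"
  shows "(\<integral>\<^sup>+z. ennreal (maximal_fun S a z) \<partial>N) \<le>
     ennreal (maximal_const s) * (\<integral>\<^sup>+z. ennreal (h z powr s) \<partial>N)"
proof -
  define \<theta> where "\<theta> = 1 - 1 / s"
  define D where "D = 2 * (2 powr \<theta> / (1 - 2 powr - \<theta>))"
  define x where "x = ancestor_max S a"
  define Mx where "Mx = {R \<in> S. \<forall>Q\<in>S. R \<subset> Q \<longrightarrow> level (x Q) \<noteq> level (x R)}"
  have \<theta>: "0 < \<theta>" "\<theta> < 1" using s unfolding \<theta>_def by auto
  have "2 powr - \<theta> < 2 powr (0::real)" using \<theta> by (intro powr_less_mono) auto
  then have D: "0 < D" unfolding D_def by simp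
  have Mx: "Mx \<subseteq> S" "finite Mx" using fin unfolding Mx_def by auto
  have xpos: "0 < x Q" if "Q \<in> S" for Q
    using ancestor_max_ge[OF fin that order_refl, of a] apos[OF that] unfolding x_def by linarith
  have x_eq: "x Q = a Q" if Q: "Q \<in> Mx" for Q
  proof -
    have QS: "Q \<in> S" using Q Mx by blast
    obtain R where R: "R \<in> S" "Q \<subseteq> R" "x Q = a R"
      unfolding x_def using ancestor_max_attained[OF fin QS, where a = a] by metis
    have "x R = x Q"
      using ancestor_max_antimono[OF fin R(1,2), of a] ancestor_max_ge[OF fin R(1) order_refl, of a] R
      unfolding x_def by linarith
    then have "\<not> Q \<subset> R" using Q R unfolding Mx_def by auto
    then show ?thesis using R by auto
  qed
  have cover: "maximal_fun S a z \<le> (\<Sum>Q\<in>Mx. 2 * x Q * indicator Q z)" for z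
  proof (rule maximal_fun_cases[OF fin, of a z])
    assume "maximal_fun S a z = 0"
    then show ?thesis using xpos Mx by (auto intro!: sum_nonneg mult_nonneg_nonneg simp: less_imp_le subset_iff)
  next
    fix R assume R: "R \<in> S" "z \<in> R" "maximal_fun S a z = a R"
    then have "finite {R' \<in> S. level (x R') = level (x R)}" "R \<in> {R' \<in> S. level (x R') = level (x R)}"
      using fin by auto
    then obtain Q where Q: "Q \<in> {R' \<in> S. level (x R') = level (x R)}" "R \<subseteq> Q"
      "\<And>R'. R' \<in> {R' \<in> S. level (x R') = level (x R)} \<Longrightarrow> \<not> Q \<subset> R'" by (rule maximal_above) blast
    then have "Q \<in> Mx" unfolding Mx_def by auto
    have "a R \<le> x R" unfolding x_def using fin R by (intro ancestor_max_ge) auto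
    also have "\<dots> \<le> 2 * x Q"
      using Q R xpos less_twice_if_same_level[of "x R" "x Q"] by auto
    also have "\<dots> = 2 * x Q * indicator Q z" using Q R by auto
    also have "\<dots> \<le> (\<Sum>Q\<in>Mx. 2 * x Q * indicator Q z)"
      using Mx xpos \<open>Q \<in> Mx\<close> by (intro member_le_sum) (auto simp: less_imp_le subset_iff)
    finally show ?thesis using R by simp
  qed
  have fin_int: "(\<integral>\<^sup>+z. ennreal (maximal_fun S a z) \<partial>N) < \<infinity>"
  proof -
    have "(\<integral>\<^sup>+z. ennreal (maximal_fun S a z) \<partial>N) \<le> (\<integral>\<^sup>+z. ennreal (\<Sum>Q\<in>Mx. 2 * x Q * indicator Q z) \<partial>N)"
      by (intro nn_integral_mono ennreal_leI cover)
    also have "\<dots> = (\<Sum>Q\<in>Mx. ennreal (2 * x Q) * emeasure N Q)"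
      using Mx S xpos by (intro nn_integral_sum_indicator) (auto simp: less_imp_le)
    also have "\<dots> < \<infinity>" using pos Mx by (auto simp: ennreal_mult_less_top subset_iff)
    finally show ?thesis .
  qed
  have x_avg: "ennreal (x Q) * emeasure N Q = (\<integral>\<^sup>+z. ennreal (h z * (x Q powr \<theta> * indicator Q z)) \<partial>N)"
    if Q: "Q \<in> Mx" for Q
  proof -
    have QS: "Q \<in> S" using Q Mx by blast
    define I where "I = enn2real (\<integral>\<^sup>+z\<in>Q. ennreal (h z) \<partial>N)"
    have I: "(\<integral>\<^sup>+z\<in>Q. ennreal (h z) \<partial>N) = ennreal I" "0 \<le> I" unfolding I_def using int[OF QS] by auto
    have \<mu>: "emeasure N Q = ennreal (measure N Q)"
      using pos(2)[OF QS] by (intro emeasure_eq_ennreal_measure) auto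
    then have \<mu>pos: "0 < measure N Q" using pos(1)[OF QS] by simp
    have xa: "x Q = (I / measure N Q) powr s" using x_eq[OF Q] a[OF QS] by (simp add: I_def)
    then have "0 < I" using xpos[OF QS] I(2) by (cases "I = 0") auto
    then have "x Q * measure N Q = x Q powr \<theta> * I"
      unfolding xa using \<mu>pos s by (simp add: powr_powr \<theta>_def right_diff_distrib powr_diff)
    moreover have "(\<integral>\<^sup>+z. ennreal (h z * (x Q powr \<theta> * indicator Q z)) \<partial>N) =
       (\<integral>\<^sup>+z. ennreal (x Q powr \<theta>) * (ennreal (h z) * indicator Q z) \<partial>N)"
      using h by (intro nn_integral_cong) (auto simp: indicator_def ennreal_mult' mult.commute)
    moreover have "\<dots> = ennreal (x Q powr \<theta>) * ennreal I"
      using QS S unfolding I(1)[symmetric] by (intro nn_integral_cmult) auto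
    ultimately show ?thesis
      using \<mu> xpos[OF QS] I by (simp flip: ennreal_mult)
  qed
  have meas: "(\<lambda>z. ennreal (h z * (x Q powr \<theta> * indicator Q z))) \<in> borel_measurable N" if "Q \<in> Mx" for Q
  proof -
    have [measurable]: "Q \<in> sets N" using that Mx S by blast
    show ?thesis by measurable
  qed
  have "(\<integral>\<^sup>+z. ennreal (maximal_fun S a z) \<partial>N) \<le> (\<integral>\<^sup>+z. ennreal (\<Sum>Q\<in>Mx. 2 * x Q * indicator Q z) \<partial>N)"
    by (intro nn_integral_mono ennreal_leI cover)
  also have "\<dots> = 2 * (\<Sum>Q\<in>Mx. ennreal (x Q) * emeasure N Q)"
    using Mx S xpos by (subst nn_integral_sum_indicator)
      (auto simp: less_imp_le subset_iff sum_distrib_left ennreal_mult mult.assoc intro!: sum.cong)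
  also have "(\<Sum>Q\<in>Mx. ennreal (x Q) * emeasure N Q) =
      (\<Sum>Q\<in>Mx. \<integral>\<^sup>+z. ennreal (h z * (x Q powr \<theta> * indicator Q z)) \<partial>N)"
    by (intro sum.cong x_avg) auto
  also have "\<dots> = (\<integral>\<^sup>+z. (\<Sum>Q\<in>Mx. ennreal (h z * (x Q powr \<theta> * indicator Q z))) \<partial>N)"
    using meas by (intro nn_integral_sum[symmetric]) blast
  also have "2 * \<dots> = (\<integral>\<^sup>+z. 2 * (\<Sum>Q\<in>Mx. ennreal (h z * (x Q powr \<theta> * indicator Q z))) \<partial>N)"
    using meas by (intro nn_integral_cmult[symmetric] borel_measurable_sum) blast
  also have "\<dots> \<le> (\<integral>\<^sup>+z. ennreal (1 / 2) * ennreal (maximal_fun S a z) +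
      ennreal ((2 * D) powr s / 2) * ennreal (h z powr s) \<partial>N)"
  proof (rule nn_integral_mono)
    fix z
    define X where "X = maximal_fun S a z"
    have X0: "0 \<le> X" unfolding X_def using fin by (rule maximal_fun_nonneg)
    have "(\<Sum>Q\<in>Mx. x Q powr \<theta> * indicator Q z) \<le> 2 powr \<theta> / (1 - 2 powr - \<theta>) * X powr \<theta>"
      unfolding x_def X_def
    proof (rule sum_indicator_distinct_levels[OF lam fin apos Mx(1) \<theta>(1)])
      fix Q R assume "Q \<in> Mx" "R \<in> Mx" "Q \<subset> R"
      then show "level (ancestor_max S a Q) \<noteq> level (ancestor_max S a R)"
        using Mx(1) unfolding Mx_def x_def by force
    qed
    then have "2 * h z * (\<Sum>Q\<in>Mx. x Q powr \<theta> * indicator Q z) \<le> 2 * h z * (2 powr \<theta> / (1 - 2 powr - \<theta>) * X powr \<theta>)"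
      using h by (intro mult_left_mono) auto
    also have "\<dots> = D * h z * X powr \<theta>" by (simp add: D_def)
    \<comment> \<open>Young's inequality: compare \<open>X\<close> with \<open>(2 D h)\<^sup>s\<close>.\<close>
    also have "\<dots> \<le> 1 / 2 * X + (2 * D) powr s / 2 * h z powr s"
    proof (cases "X \<le> (2 * D * h z) powr s")
      case True
      then have "X powr \<theta> \<le> ((2 * D * h z) powr s) powr \<theta>" using X0 \<theta> by (intro powr_mono2) auto
      also have "\<dots> = (2 * D * h z) powr (s - 1)" using s by (simp add: powr_powr \<theta>_def right_diff_distrib)
      finally have "D * h z * X powr \<theta> \<le> D * h z * (2 * D * h z) powr (s - 1)"
        using D h by (intro mult_left_mono) auto
      also have "\<dots> = (2 * D * h z) powr s / 2"
        using D h[of z] by (cases "h z = 0") (auto simp: powr_diff)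
      also have "\<dots> = (2 * D) powr s / 2 * h z powr s" using D h by (simp add: powr_mult)
      finally show ?thesis using X0 by simp
    next
      case False
      then have lt: "(2 * D * h z) powr s < X" by simp
      then have X: "0 < X" by (smt (verit) powr_ge_zero)
      have "((2 * D * h z) powr s) powr (1 / s) \<le> X powr (1 / s)"
        using lt s by (intro powr_mono2) auto
      then have "2 * D * h z \<le> X powr (1 / s)" using s D h by (simp add: powr_powr)
      then have "D * h z * X powr \<theta> \<le> X powr (1 / s) / 2 * X powr \<theta>"
        by (intro mult_right_mono) auto
      also have "\<dots> = X / 2" using X by (simp add: \<theta>_def flip: powr_add)
      finally show ?thesis by (simp add: add_increasing2)
    qed
    finally have "2 * h z * (\<Sum>Q\<in>Mx. x Q powr \<theta> * indicator Q z) \<le> 1 / 2 * X + (2 * D) powr s / 2 * h z powr s" .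
    then have "ennreal (2 * (\<Sum>Q\<in>Mx. h z * (x Q powr \<theta> * indicator Q z))) \<le>
       ennreal (1 / 2 * X + (2 * D) powr s / 2 * h z powr s)"
      by (intro ennreal_leI) (simp add: sum_distrib_left mult.assoc)
    also have "ennreal (2 * (\<Sum>Q\<in>Mx. h z * (x Q powr \<theta> * indicator Q z))) =
       2 * (\<Sum>Q\<in>Mx. ennreal (h z * (x Q powr \<theta> * indicator Q z)))"
      using h by (subst sum_ennreal) (simp_all add: ennreal_mult')
    also have "ennreal (1 / 2 * X + (2 * D) powr s / 2 * h z powr s) =
       ennreal (1 / 2) * ennreal X + ennreal ((2 * D) powr s / 2) * ennreal (h z powr s)"
      using X0 by (subst ennreal_plus) (simp_all only: ennreal_mult' powr_ge_zero mult_nonneg_nonneg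
        divide_nonneg_nonneg zero_le_numeral zero_le_one)
    finally show "2 * (\<Sum>Q\<in>Mx. ennreal (h z * (x Q powr \<theta> * indicator Q z))) \<le>
       ennreal (1 / 2) * ennreal (maximal_fun S a z) + ennreal ((2 * D) powr s / 2) * ennreal (h z powr s)"
      unfolding X_def .
  qed
  also have "\<dots> = ennreal (1 / 2) * (\<integral>\<^sup>+z. ennreal (maximal_fun S a z) \<partial>N) +
      ennreal ((2 * D) powr s / 2) * (\<integral>\<^sup>+z. ennreal (h z powr s) \<partial>N)"
    using fin S by (subst nn_integral_add) (auto simp: nn_integral_cmult)
  finally have main: "(\<integral>\<^sup>+z. ennreal (maximal_fun S a z) \<partial>N) \<le>
     ennreal (1 / 2) * (\<integral>\<^sup>+z. ennreal (maximal_fun S a z) \<partial>N) +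
      ennreal ((2 * D) powr s / 2) * (\<integral>\<^sup>+z. ennreal (h z powr s) \<partial>N)" .
  have const: "maximal_const s = (2 * D) powr s" by (simp add: maximal_const_def D_def \<theta>_def)
  show ?thesis
  proof (cases "(\<integral>\<^sup>+z. ennreal (h z powr s) \<partial>N) = \<infinity>")
    case True
    then show ?thesis using D by (simp add: const ennreal_mult_top)
  next
    case False
    define I where "I = enn2real (\<integral>\<^sup>+z. ennreal (maximal_fun S a z) \<partial>N)"
    define J where "J = enn2real (\<integral>\<^sup>+z. ennreal (h z powr s) \<partial>N)"
    have I: "(\<integral>\<^sup>+z. ennreal (maximal_fun S a z) \<partial>N) = ennreal I" "0 \<le> I"
      unfolding I_def using fin_int by auto
    have J: "(\<integral>\<^sup>+z. ennreal (h z powr s) \<partial>N) = ennreal J" "0 \<le> J"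
      unfolding J_def using False by (auto simp: less_top)
    have "ennreal I \<le> ennreal (1 / 2 * I + (2 * D) powr s / 2 * J)"
      using main I(2) J(2) unfolding I(1) J(1)
      by (subst ennreal_plus) (simp_all only: ennreal_mult' powr_ge_zero mult_nonneg_nonneg
        divide_nonneg_nonneg zero_le_numeral zero_le_one)
    then have "I \<le> 1 / 2 * I + (2 * D) powr s / 2 * J" using I J by (subst (asm) ennreal_le_iff) auto
    then have "I \<le> (2 * D) powr s * J" by simp
    then show ?thesis unfolding I J const using J by (simp flip: ennreal_mult')
  qed
qed

lemma maximal_inequality:
  fixes h :: "'a \<Rightarrow> real"
  assumes s: "1 < s"
    and lam: "laminar S" and fin: "finite S" and S: "S \<subseteq> sets N"
    and pos: "\<And>Q. Q \<in> S \<Longrightarrow> 0 < emeasure N Q" "\<And>Q. Q \<in> S \<Longrightarrow> emeasure N Q < \<infinity>"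
    and h: "h \<in> borel_measurable N" "\<And>z. 0 \<le> h z"
    and int: "\<And>Q. Q \<in> S \<Longrightarrow> (\<integral>\<^sup>+z\<in>Q. ennreal (h z) \<partial>N) < \<infinity>"
    and a: "\<And>Q. Q \<in> S \<Longrightarrow> a Q = (enn2real (\<integral>\<^sup>+z\<in>Q. ennreal (h z) \<partial>N) / measure N Q) powr s"
  shows "(\<integral>\<^sup>+z. ennreal (maximal_fun S a z) \<partial>N) \<le>
     ennreal (maximal_const s) * (\<integral>\<^sup>+z. ennreal (h z powr s) \<partial>N)"
proof -
  define S' where "S' = {Q \<in> S. 0 < a Q}"
  have S': "S' \<subseteq> S" "finite S'" using fin unfolding S'_def by auto
  have "maximal_fun S a z \<le> maximal_fun S' a z" for z
  proof (rule maximal_fun_cases[OF fin, of a z])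
    fix R assume R: "R \<in> S" "z \<in> R" "maximal_fun S a z = a R"
    then show ?thesis
      using maximal_fun_ge[OF S'(2), of R z a] maximal_fun_nonneg[OF S'(2), of a z]
      by (cases "0 < a R") (auto simp: S'_def)
  qed (simp add: maximal_fun_nonneg[OF S'(2)])
  then have "(\<integral>\<^sup>+z. ennreal (maximal_fun S a z) \<partial>N) \<le> (\<integral>\<^sup>+z. ennreal (maximal_fun S' a z) \<partial>N)"
    by (intro nn_integral_mono ennreal_leI)
  also have "\<dots> \<le> ennreal (maximal_const s) * (\<integral>\<^sup>+z. ennreal (h z powr s) \<partial>N)"
  proof (rule maximal_inequality_pos[OF s laminar_subset[OF lam S'(1)] S'(2)])
    show "S' \<subseteq> sets N" using S S' by blast
  qed (use S' pos h int a in \<open>auto simp: S'_def\<close>)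
  finally show ?thesis .
qed

section \<open>Sparse families and logarithmic averages\<close>

text \<open>What is left of a cube after the smaller members of the sparse family are removed carries half of its
  measure, and these remainders are disjoint. So the sum is at most twice the integral of the
  squared maximal function.\<close>

lemma sparse_sum_square_average:
  fixes h :: "'a \<Rightarrow> real"
  assumes lam: "laminar S" and fin: "finite S" and S: "S \<subseteq> sets M"
    and pos: "\<And>Q. Q \<in> S \<Longrightarrow> 0 < emeasure M Q" "\<And>Q. Q \<in> S \<Longrightarrow> emeasure M Q < \<infinity>"
    and sparse: "\<And>Q. Q \<in> S \<Longrightarrow> measure M (\<Union>{Q' \<in> S. Q' \<subset> Q}) \<le> measure M Q / 2"
    and h: "h \<in> borel_measurable M" "\<And>z. 0 \<le> h z"
    and int: "\<And>Q. Q \<in> S \<Longrightarrow> (\<integral>\<^sup>+z\<in>Q. ennreal (h z) \<partial>M) < \<infinity>"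
  shows "(\<Sum>Q\<in>S. ennreal (measure M Q * (enn2real (\<integral>\<^sup>+z\<in>Q. ennreal (h z) \<partial>M) / measure M Q)\<^sup>2)) \<le>
     ennreal (2 * maximal_const 2) * (\<integral>\<^sup>+z. ennreal ((h z)\<^sup>2) \<partial>M)"
proof -
  define a where "a Q = (enn2real (\<integral>\<^sup>+z\<in>Q. ennreal (h z) \<partial>M) / measure M Q)\<^sup>2" for Q
  define E where "E Q = Q - \<Union>{Q' \<in> S. Q' \<subset> Q}" for Q
  have Un: "\<Union>{Q' \<in> S. Q' \<subset> Q} \<in> sets M" for Q using fin S by (intro sets.finite_Union) auto
  have E: "E Q \<in> sets M" if "Q \<in> S" for Q using Un S that unfolding E_def by auto
  have large: "ennreal (measure M Q) \<le> 2 * emeasure M (E Q)" if Q: "Q \<in> S" for Q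
  proof -
    have Qm: "Q \<in> fmeasurable M" using pos(2)[OF Q] S Q by (auto intro: fmeasurableI)
    have Um: "\<Union>{Q' \<in> S. Q' \<subset> Q} \<in> fmeasurable M"
      by (rule fmeasurableI2[OF Qm _ Un]) blast
    have "measure M Q \<le> measure M (E Q \<union> \<Union>{Q' \<in> S. Q' \<subset> Q})"
      using Qm Um E[OF Q] unfolding E_def by (intro measure_mono_fmeasurable) auto
    also have "\<dots> \<le> measure M (E Q) + measure M (\<Union>{Q' \<in> S. Q' \<subset> Q})"
      using E[OF Q] Un by (rule measure_Un_le)
    finally have "measure M Q \<le> 2 * measure M (E Q)" using sparse[OF Q] by simp
    then have "ennreal (measure M Q) \<le> 2 * ennreal (measure M (E Q))"
      by (metis ennreal_leI ennreal_mult' ennreal_numeral zero_le_numeral)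
    also have "ennreal (measure M (E Q)) = emeasure M (E Q)"
      using fmeasurable_Diff[OF Qm Un] unfolding E_def by (rule emeasure_eq_measure2[symmetric])
    finally show ?thesis .
  qed
  have "(\<Sum>Q\<in>S. ennreal (measure M Q * a Q)) \<le> (\<Sum>Q\<in>S. 2 * (ennreal (a Q) * emeasure M (E Q)))"
  proof (rule sum_mono)
    fix Q assume "Q \<in> S"
    have "ennreal (measure M Q * a Q) = ennreal (a Q) * ennreal (measure M Q)"
      unfolding a_def by (simp add: ennreal_mult' mult.commute)
    also have "\<dots> \<le> ennreal (a Q) * (2 * emeasure M (E Q))"
      using large[OF \<open>Q \<in> S\<close>] by (intro mult_left_mono) auto
    finally show "ennreal (measure M Q * a Q) \<le> 2 * (ennreal (a Q) * emeasure M (E Q))"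
      by (simp add: mult_ac)
  qed
  also have "\<dots> = 2 * (\<integral>\<^sup>+z. ennreal (\<Sum>Q\<in>S. a Q * indicator (E Q) z) \<partial>M)"
    using fin E by (subst nn_integral_sum_indicator) (auto simp: a_def sum_distrib_left)
  also have "\<dots> \<le> 2 * (\<integral>\<^sup>+z. ennreal (maximal_fun S a z) \<partial>M)"
  proof (intro mult_left_mono nn_integral_mono ennreal_leI)
    fix z
    show "(\<Sum>Q\<in>S. a Q * indicator (E Q) z) \<le> maximal_fun S a z"
    proof (cases "\<exists>Q\<in>S. z \<in> E Q")
      case True
      then obtain Q where Q: "Q \<in> S" "z \<in> E Q" by blast
      have uniq: "R = Q" if "R \<in> S" "z \<in> E R" for R
      proof -
        have "Q \<inter> R \<noteq> {}" using Q that unfolding E_def by blast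
        then have "Q \<subseteq> R \<or> R \<subseteq> Q" using lam Q that unfolding laminar_def by blast
        moreover have "\<not> Q \<subset> R" "\<not> R \<subset> Q" using Q that unfolding E_def by blast+
        ultimately show ?thesis by blast
      qed
      have "(\<Sum>R\<in>S. a R * indicator (E R) z) = (\<Sum>R\<in>S. if R = Q then a R else 0)"
      proof (rule sum.cong[OF refl])
        fix R assume "R \<in> S"
        show "a R * indicator (E R) z = (if R = Q then a R else 0)"
        proof (cases "R = Q")
          case True
          then show ?thesis using Q(2) by simp
        next
          case False
          then have "z \<notin> E R" using uniq[OF \<open>R \<in> S\<close>] by blast
          then show ?thesis using False by simp
        qed
      qed
      also have "\<dots> = a Q" using fin Q by simp
      also have "\<dots> \<le> maximal_fun S a z" using fin Q by (intro maximal_fun_ge) (auto simp: E_def)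
      finally show ?thesis .
    next
      case False
      then have "(\<Sum>Q\<in>S. a Q * indicator (E Q) z) = 0" by (intro sum.neutral) auto
      then show ?thesis using maximal_fun_nonneg[OF fin] by simp
    qed
  qed simp
  also have "\<dots> \<le> 2 * (ennreal (maximal_const 2) * (\<integral>\<^sup>+z. ennreal (h z powr 2) \<partial>M))"
    by (intro mult_left_mono maximal_inequality[OF _ lam fin S pos h int]) (auto simp: a_def)
  also have "\<dots> = ennreal (2 * maximal_const 2) * (\<integral>\<^sup>+z. ennreal ((h z)\<^sup>2) \<partial>M)"
    using h(2) by (simp add: ennreal_mult' mult.assoc)
  finally show ?thesis unfolding a_def .
qed

text \<open>Jensen's inequality for the exponential function: integrate the tangent line of \<open>exp\<close> at the average
  \<open>L\<close> of \<open>l\<close>.\<close>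

lemma exp_average_le_average:
  fixes l h :: "'a \<Rightarrow> real"
  assumes Q: "Q \<in> sets M" "0 < measure M Q"
    and int: "set_integrable M Q l" "set_integrable M Q h"
    and le: "AE z in M. exp (l z) \<le> h z"
  shows "exp ((LINT z:Q|M. l z) / measure M Q) \<le> (LINT z:Q|M. h z) / measure M Q"
proof -
  define L where "L = (LINT z:Q|M. l z) / measure M Q"
  have one: "set_integrable M Q (\<lambda>_. 1 :: real)"
    using Q by (auto simp: set_integrable_def measure_def enn2real_positive_iff top.not_eq_extremum)
  have "(LINT z:Q|M. l z) \<le> (LINT z:Q|M. (L - 1) * 1 + h z * exp (- L))"
  proof (rule set_integral_mono_AE)
    show "set_integrable M Q (\<lambda>z. (L - 1) * 1 + h z * exp (- L))"
      by (intro set_integral_add set_integrable_mult_right set_integrable_mult_left one int)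
    show "AE z in M. z \<in> Q \<longrightarrow> l z \<le> (L - 1) * 1 + h z * exp (- L)"
      using le
    proof eventually_elim
      case (elim z)
      have "1 + (l z - L) \<le> exp (l z - L)" by (rule exp_ge_add_one_self)
      also have "\<dots> \<le> h z * exp (- L)" using elim by (simp add: exp_diff exp_minus divide_inverse)
      finally show ?case by simp
    qed
  qed (use int in auto)
  also have "\<dots> = (L - 1) * (LINT z:Q|M. 1) + (LINT z:Q|M. h z) * exp (- L)"
  proof -
    have "set_integrable M Q (\<lambda>_. (L - 1) * 1)" "set_integrable M Q (\<lambda>z. h z * exp (- L))"
      by (intro set_integrable_mult_right set_integrable_mult_left one int)+
    then show ?thesis by (simp only: set_integral_add set_integral_mult_right set_integral_mult_left)
  qed
  also have "(LINT z:Q|M. 1) = measure M Q"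
    using Q by (simp add: set_lebesgue_integral_def)
  finally have "L * measure M Q \<le> (L - 1) * measure M Q + (LINT z:Q|M. h z) * exp (- L)"
    using Q by (simp add: L_def)
  then have "measure M Q \<le> (LINT z:Q|M. h z) * exp (- L)" by (simp add: algebra_simps)
  then have "exp L * measure M Q \<le> (LINT z:Q|M. h z)"
    by (simp add: exp_minus field_simps)
  then show ?thesis using Q unfolding L_def[symmetric] by (simp add: field_simps)
qed

lemma nn_integral_eq_set_lebesgue_integral:
  fixes f :: "'a \<Rightarrow> real"
  assumes "set_integrable M Q f" "\<And>z. 0 \<le> f z"
  shows "(\<integral>\<^sup>+z\<in>Q. ennreal (f z) \<partial>M) = ennreal (LINT z:Q|M. f z)"
proof -
  have "(\<integral>\<^sup>+z\<in>Q. ennreal (f z) \<partial>M) = (\<integral>\<^sup>+z. ennreal (indicator Q z *\<^sub>R f z) \<partial>M)"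
    by (intro nn_integral_cong) (auto simp: indicator_def)
  also have "\<dots> = ennreal (LINT z:Q|M. f z)"
    unfolding set_lebesgue_integral_def using assms
    by (intro nn_integral_eq_integral) (auto simp: set_integrable_def)
  finally show ?thesis .
qed

text \<open>The quantity \<open>m(Q) exp(\<langle>ln u\<rangle>)\<close> is \<open>u(Q)\<close> divided by the \<open>A_inf\<close> characteristic, and unlike
  \<open>u(Q)\<close> it is summable over a sparse family, with weights \<open>x Q\<close> that are dominated by a function
  \<open>X\<close> on \<open>Q\<close>: by Jensen's inequality it is at most \<open>m(Q) \<langle>sqrt u\<rangle>\<^sup>2\<close>, the factor \<open>x Q\<close> may be moved
  under the average as \<open>sqrt X\<close>, and the square function estimate applies to \<open>h = sqrt (X u)\<close>.\<close>

lemma sparse_sum_exp_log_average: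
  fixes X u :: "'a \<Rightarrow> real"
  assumes lam: "laminar S" and fin: "finite S" and S: "S \<subseteq> sets M"
    and pos: "\<And>Q. Q \<in> S \<Longrightarrow> 0 < emeasure M Q" "\<And>Q. Q \<in> S \<Longrightarrow> emeasure M Q < \<infinity>"
    and sparse: "\<And>Q. Q \<in> S \<Longrightarrow> measure M (\<Union>{Q' \<in> S. Q' \<subset> Q}) \<le> measure M Q / 2"
    and [measurable]: "X \<in> borel_measurable M" "u \<in> borel_measurable M"
    and X0: "\<And>z. 0 \<le> X z" and u0: "\<And>z. 0 \<le> u z" and upos: "AE z in M. 0 < u z"
    and int: "\<And>Q. Q \<in> S \<Longrightarrow> set_integrable M Q u"
      "\<And>Q. Q \<in> S \<Longrightarrow> set_integrable M Q (\<lambda>z. ln (inverse (u z)))"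
    and x: "\<And>Q. Q \<in> S \<Longrightarrow> 0 \<le> x Q" "\<And>Q z. Q \<in> S \<Longrightarrow> z \<in> Q \<Longrightarrow> x Q \<le> X z"
  shows "(\<Sum>Q\<in>S. ennreal (x Q * (measure M Q * exp (- ((LINT z:Q|M. ln (inverse (u z))) / measure M Q))))) \<le>
     ennreal (2 * maximal_const 2) * (\<integral>\<^sup>+z. ennreal (X z * u z) \<partial>M)"
proof (cases "(\<integral>\<^sup>+z. ennreal (X z * u z) \<partial>M) = \<infinity>")
  case True
  have "0 < maximal_const 2" unfolding maximal_const_def by (simp add: powr_minus field_simps)
  then show ?thesis using True by (simp add: ennreal_mult_top)
next
  case False
  define h where "h z = sqrt (X z * u z)" for z
  have h: "h \<in> borel_measurable M" "\<And>z. 0 \<le> h z" unfolding h_def[abs_def] using X0 u0 by auto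
  have h2: "(h z)\<^sup>2 = X z * u z" for z unfolding h_def using X0 u0 by simp
  have Xu: "integrable M (\<lambda>z. X z * u z)"
    using False X0 u0 by (intro integrableI_nonneg) (auto simp: less_top)
  have one: "set_integrable M Q (\<lambda>_. 1 :: real)" if "Q \<in> S" for Q
    using pos(2)[OF that] S that by (auto simp: set_integrable_def)
  have sqrt_le: "sqrt t \<le> 1 + t" if "0 \<le> t" for t :: real
    using that by (intro real_le_lsqrt) (auto simp: power2_eq_square algebra_simps)
  have hint: "set_integrable M Q h" if "Q \<in> S" for Q
  proof (rule set_integrable_bound)
    show "set_integrable M Q (\<lambda>z. 1 + X z * u z)"
    proof (rule set_integral_add(1)[OF one[OF that]])
      show "set_integrable M Q (\<lambda>z. X z * u z)"
        unfolding set_integrable_def using S that Xu by (intro integrable_mult_indicator) auto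
    qed
    show "set_borel_measurable M Q h"
      using h(1) S that unfolding set_borel_measurable_def by auto
    show "AE z in M. z \<in> Q \<longrightarrow> norm (h z) \<le> norm (1 + X z * u z)"
      using X0 u0 sqrt_le by (intro AE_I2) (auto simp: h_def)
  qed
  have suint: "set_integrable M Q (\<lambda>z. sqrt (u z))" if "Q \<in> S" for Q
  proof (rule set_integrable_bound)
    show "set_integrable M Q (\<lambda>z. 1 + u z)"
      using one[OF that] int(1)[OF that] by (rule set_integral_add)
    show "set_borel_measurable M Q (\<lambda>z. sqrt (u z))"
      using S that unfolding set_borel_measurable_def by auto
    show "AE z in M. z \<in> Q \<longrightarrow> norm (sqrt (u z)) \<le> norm (1 + u z)"
      using u0 sqrt_le by (intro AE_I2) auto
  qed
  have nn: "(\<integral>\<^sup>+z\<in>Q. ennreal (h z) \<partial>M) = ennreal (LINT z:Q|M. h z)" if "Q \<in> S" for Q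
    using hint[OF that] h(2) by (rule nn_integral_eq_set_lebesgue_integral)
  have "x Q * (measure M Q * exp (- ((LINT z:Q|M. ln (inverse (u z))) / measure M Q))) \<le>
      measure M Q * (enn2real (\<integral>\<^sup>+z\<in>Q. ennreal (h z) \<partial>M) / measure M Q)\<^sup>2" if Q: "Q \<in> S" for Q
  proof -
    have \<mu>: "0 < measure M Q"
      using pos[OF Q] by (metis emeasure_eq_ennreal_measure ennreal_less_zero_iff less_irrefl infinity_ennreal_def)
    have QM: "Q \<in> sets M" using S Q by blast
    define l where "l z = - (1 / 2) * ln (inverse (u z))" for z
    have "exp ((LINT z:Q|M. l z) / measure M Q) \<le> (LINT z:Q|M. sqrt (u z)) / measure M Q"
    proof (rule exp_average_le_average[OF QM \<mu> _ suint[OF Q]])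
      show "set_integrable M Q l" unfolding l_def using int(2)[OF Q] by (intro set_integrable_mult_right)
      show "AE z in M. exp (l z) \<le> sqrt (u z)"
        using upos
      proof eventually_elim
        case (elim z)
        have "l z = ln (sqrt (u z))" using elim by (simp add: l_def ln_inverse ln_sqrt)
        then show ?case using elim by simp
      qed
    qed
    also have "(LINT z:Q|M. l z) = - (1 / 2) * (LINT z:Q|M. ln (inverse (u z)))"
      unfolding l_def by (rule set_integral_mult_right)
    finally have jensen: "exp (- (1 / 2) * (LINT z:Q|M. ln (inverse (u z))) / measure M Q) \<le>
      (LINT z:Q|M. sqrt (u z)) / measure M Q" .
    have "exp (- ((LINT z:Q|M. ln (inverse (u z))) / measure M Q)) =
      (exp (- (1 / 2) * (LINT z:Q|M. ln (inverse (u z))) / measure M Q))\<^sup>2"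
      by (simp add: power2_eq_square flip: exp_add)
    also have "\<dots> \<le> ((LINT z:Q|M. sqrt (u z)) / measure M Q)\<^sup>2"
      using jensen by (intro power_mono) auto
    finally have "x Q * (measure M Q * exp (- ((LINT z:Q|M. ln (inverse (u z))) / measure M Q))) \<le>
       x Q * (measure M Q * ((LINT z:Q|M. sqrt (u z)) / measure M Q)\<^sup>2)"
      using x(1)[OF Q] by (intro mult_left_mono) auto
    also have "\<dots> = measure M Q * ((LINT z:Q|M. sqrt (x Q) * sqrt (u z)) / measure M Q)\<^sup>2"
      using x(1)[OF Q] by (simp add: power_mult_distrib power_divide)
    also have "\<dots> \<le> measure M Q * ((LINT z:Q|M. h z) / measure M Q)\<^sup>2"
    proof (intro mult_left_mono power_mono divide_right_mono)
      show "(LINT z:Q|M. sqrt (x Q) * sqrt (u z)) \<le> (LINT z:Q|M. h z)"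
      proof (rule set_integral_mono[OF _ hint[OF Q]])
        show "set_integrable M Q (\<lambda>z. sqrt (x Q) * sqrt (u z))"
          using suint[OF Q] by (intro set_integrable_mult_right)
        show "sqrt (x Q) * sqrt (u z) \<le> h z" if "z \<in> Q" for z
          using x(2)[OF Q that] u0[of z] by (auto simp: h_def real_sqrt_mult intro!: mult_right_mono)
      qed
      show "0 \<le> (LINT z:Q|M. sqrt (x Q) * sqrt (u z)) / measure M Q"
        using x(1)[OF Q] u0 by (auto simp: set_lebesgue_integral_def intro!: divide_nonneg_nonneg mult_nonneg_nonneg Bochner_Integration.integral_nonneg)
    qed auto
    also have "(LINT z:Q|M. h z) = enn2real (\<integral>\<^sup>+z\<in>Q. ennreal (h z) \<partial>M)"
      unfolding nn[OF Q] using h(2) by (simp add: set_lebesgue_integral_def Bochner_Integration.integral_nonneg)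
    finally show ?thesis .
  qed
  then have "(\<Sum>Q\<in>S. ennreal (x Q * (measure M Q * exp (- ((LINT z:Q|M. ln (inverse (u z))) / measure M Q))))) \<le>
     (\<Sum>Q\<in>S. ennreal (measure M Q * (enn2real (\<integral>\<^sup>+z\<in>Q. ennreal (h z) \<partial>M) / measure M Q)\<^sup>2))"
    by (intro sum_mono ennreal_leI)
  also have "\<dots> \<le> ennreal (2 * maximal_const 2) * (\<integral>\<^sup>+z. ennreal ((h z)\<^sup>2) \<partial>M)"
    by (rule sparse_sum_square_average[OF lam fin S pos sparse h]) (auto simp: nn)
  finally show ?thesis by (simp add: h2)
qed

section \<open>Weights on a sparse collection\<close>

locale sparse_collection =
  fixes M :: "'a measure" and S :: "'a set set"
  assumes laminar: "laminar S" and finite: "finite S" and sets: "S \<subseteq> sets M"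
    and emeasure_pos: "Q \<in> S \<Longrightarrow> 0 < emeasure M Q"
    and emeasure_finite: "Q \<in> S \<Longrightarrow> emeasure M Q < \<infinity>"
    and sparse: "Q \<in> S \<Longrightarrow> measure M (\<Union>{Q' \<in> S. Q' \<subset> Q}) \<le> measure M Q / 2"
begin

lemma emeasure_eq: "Q \<in> S \<Longrightarrow> emeasure M Q = ennreal (measure M Q)"
  using emeasure_finite by (intro emeasure_eq_ennreal_measure) (auto simp: less_top)

lemma measure_pos: "Q \<in> S \<Longrightarrow> 0 < measure M Q"
  using emeasure_pos[of Q] emeasure_eq[of Q] by simp

lemma nonempty: "{} \<notin> S"
  using emeasure_pos by force

lemma sum_measure_le:
  assumes C: "C \<subseteq> S" "disjoint C" "\<And>Q. Q \<in> C \<Longrightarrow> Q \<subseteq> B" and N: "sets N = sets M"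
    and B: "B \<in> sets M" "emeasure N B \<noteq> \<infinity>"
  shows "sum (measure N) C \<le> measure N B"
proof -
  have finC: "finite C" using C(1) finite by (rule finite_subset)
  have Bf: "B \<in> fmeasurable N"
    by (rule fmeasurableI) (use B N in \<open>simp_all add: less_top\<close>)
  have CN: "Q \<in> sets N" if "Q \<in> C" for Q using that C(1) sets N by blast
  have fm: "Q \<in> fmeasurable N" if "Q \<in> C" for Q
    by (rule fmeasurableI2[OF Bf C(3)[OF that] CN[OF that]])
  have "sum (measure N) C = measure N (\<Union>C)"
  proof -
    have "pairwise disjnt C" using C(2) by (simp add: disjoint_def pairwise_def disjnt_def)
    then show ?thesis using measure_Union'[OF finC fm] by simp
  qed
  also have "\<dots> \<le> measure N B"
    by (rule measure_mono_fmeasurable[OF _ _ Bf]) (use finC CN C(3) in auto)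
  finally show ?thesis .
qed

lemma sum_measure_le_half:
  assumes C: "C \<subseteq> S" "disjoint C" "\<forall>Q\<in>C. Q \<subset> R" and R: "R \<in> S"
  shows "sum (measure M) C \<le> measure M R / 2"
proof -
  let ?B = "\<Union>{Q' \<in> S. Q' \<subset> R}"
  have B: "?B \<in> sets M" using finite sets by (intro sets.finite_Union) auto
  have "emeasure M ?B \<le> emeasure M R" using R sets by (intro emeasure_mono) auto
  then have "emeasure M ?B \<noteq> \<infinity>" using emeasure_finite[OF R] by (auto simp: less_top[symmetric] top_unique)
  then have "sum (measure M) C \<le> measure M ?B"
    using C by (intro sum_measure_le B) auto
  then show ?thesis using sparse[OF R] by simp
qed

end

locale sparse_weight = sparse_collection +
  fixes u :: "'a \<Rightarrow> real"
  assumes u_measurable [measurable]: "u \<in> borel_measurable M"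
    and u_nonneg: "0 \<le> u z" and u_pos: "AE z in M. 0 < u z"
    and u_integrable: "Q \<in> S \<Longrightarrow> set_integrable M Q u"
    and ln_integrable: "Q \<in> S \<Longrightarrow> set_integrable M Q (\<lambda>z. ln (inverse (u z)))"
begin

abbreviation \<nu> :: "'a measure" where
  "\<nu> \<equiv> density M (\<lambda>z. ennreal (u z))"

text \<open>The real number that \<open>A_exp\<close> denotes for a weight whose logarithm is integrable.\<close>

definition A_inf :: "'a set \<Rightarrow> real" where
  "A_inf Q = measure \<nu> Q / measure M Q * exp ((LINT z:Q|M. ln (inverse (u z))) / measure M Q)"

lemma emeasure_density_eq: "Q \<in> S \<Longrightarrow> emeasure \<nu> Q = ennreal (LINT z:Q|M. u z)"
  using sets u_nonneg u_integrable
  by (subst emeasure_density) (auto intro!: nn_integral_eq_set_lebesgue_integral)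

lemma measure_density_eq: "Q \<in> S \<Longrightarrow> measure \<nu> Q = (LINT z:Q|M. u z)"
  using u_nonneg emeasure_density_eq[of Q]
  by (simp add: measure_def set_lebesgue_integral_def Bochner_Integration.integral_nonneg)

lemma emeasure_density_pos: "Q \<in> S \<Longrightarrow> 0 < emeasure \<nu> Q"
proof -
  assume Q: "Q \<in> S"
  then have QM: "Q \<in> sets M" using sets by blast
  have "emeasure \<nu> Q \<noteq> 0"
  proof
    assume "emeasure \<nu> Q = 0"
    then have "Q \<in> null_sets \<nu>" using QM by auto
    then have "AE z in M. z \<in> Q \<longrightarrow> ennreal (u z) = 0"
      by (subst (asm) null_sets_density_iff) auto
    then have "AE z in M. z \<notin> Q"
      using u_pos by eventually_elim auto
    then have "emeasure M Q = 0" using AE_iff_null_sets[OF QM] by (auto dest: null_setsD1)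
    then show False using emeasure_pos[OF Q] by simp
  qed
  then show ?thesis by (simp add: zero_less_iff_neq_zero)
qed

lemma emeasure_density_finite: "Q \<in> S \<Longrightarrow> emeasure \<nu> Q < \<infinity>"
  using emeasure_density_eq by simp

lemma measure_density_pos: "Q \<in> S \<Longrightarrow> 0 < measure \<nu> Q"
  using emeasure_density_pos[of Q] emeasure_density_eq[of Q] measure_density_eq[of Q] by simp

lemma A_inf_ge_1:
  assumes Q: "Q \<in> S"
  shows "1 \<le> A_inf Q"
proof -
  have "exp ((LINT z:Q|M. - 1 * ln (inverse (u z))) / measure M Q) \<le> (LINT z:Q|M. u z) / measure M Q"
  proof (rule exp_average_le_average)
    show "set_integrable M Q (\<lambda>z. - 1 * ln (inverse (u z)))"
      using ln_integrable[OF Q] by (intro set_integrable_mult_right)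
    show "AE z in M. exp (- 1 * ln (inverse (u z))) \<le> u z"
      using u_pos by eventually_elim (simp add: ln_inverse)
  qed (use Q sets measure_pos u_integrable in auto)
  then have "exp (- ((LINT z:Q|M. ln (inverse (u z))) / measure M Q)) \<le> measure \<nu> Q / measure M Q"
    unfolding set_integral_mult_right measure_density_eq[OF Q] by simp
  then have "exp (- ((LINT z:Q|M. ln (inverse (u z))) / measure M Q)) *
       exp ((LINT z:Q|M. ln (inverse (u z))) / measure M Q) \<le> A_inf Q"
    unfolding A_inf_def by (intro mult_right_mono) auto
  then show ?thesis by (simp flip: exp_add)
qed

lemma density_sum_le:
  assumes "C \<subseteq> S" "R \<in> S" "disjoint C" "\<forall>Q\<in>C. Q \<subset> R"
  shows "sum (measure \<nu>) C \<le> measure \<nu> R"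
  using assms sets emeasure_density_finite[of R] by (intro sum_measure_le) auto

text \<open>The power is part of the definition because the maximal inequality and the level sets are used for
  powers of averages.\<close>

definition avg_pow :: "real \<Rightarrow> ('a \<Rightarrow> real) \<Rightarrow> 'a set \<Rightarrow> real" where
  "avg_pow s h Q = (enn2real (\<integral>\<^sup>+z\<in>Q. ennreal (h z) \<partial>\<nu>) / measure \<nu> Q) powr s"

text \<open>On a set of finite measure, \<open>h \<le> 1 + h\<^sup>s\<close> gives integrability.\<close>

lemma integral_finite:
  assumes s: "1 < s" and h: "h \<in> borel_measurable M" "\<And>z. 0 \<le> h z"
    and F: "(\<integral>\<^sup>+z. ennreal (h z powr s) \<partial>\<nu>) \<le> ennreal F" and Q: "Q \<in> S"
  shows "(\<integral>\<^sup>+z\<in>Q. ennreal (h z) \<partial>\<nu>) < \<infinity>"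
proof -
  have QM: "Q \<in> sets M" using Q sets by blast
  have "(\<integral>\<^sup>+z\<in>Q. ennreal (h z) \<partial>\<nu>) \<le> (\<integral>\<^sup>+z. indicator Q z + ennreal (h z powr s) \<partial>\<nu>)"
  proof (rule nn_integral_mono)
    fix z
    have "h z \<le> 1 + h z powr s"
    proof (cases "h z \<le> 1")
      case False
      then have "h z powr 1 \<le> h z powr s" using s by (intro powr_mono) auto
      then show ?thesis using False by simp
    qed (simp add: add_increasing2)
    then have "ennreal (h z) \<le> 1 + ennreal (h z powr s)"
      by (metis ennreal_1 ennreal_leI ennreal_plus powr_ge_zero zero_le_one)
    then show "ennreal (h z) * indicator Q z \<le> indicator Q z + ennreal (h z powr s)"
      by (auto simp: indicator_def)
  qed
  also have "\<dots> = emeasure \<nu> Q + (\<integral>\<^sup>+z. ennreal (h z powr s) \<partial>\<nu>)"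
    using QM h(1) by (subst nn_integral_add) auto
  also have "\<dots> < \<infinity>"
    using emeasure_density_finite[OF Q] F by (auto simp: less_top[symmetric] top_unique)
  finally show ?thesis .
qed

lemma maximal_density:
  assumes s: "1 < s" and h: "h \<in> borel_measurable M" "\<And>z. 0 \<le> h z"
    and F: "(\<integral>\<^sup>+z. ennreal (h z powr s) \<partial>\<nu>) \<le> ennreal F"
    and T: "T \<subseteq> S"
  shows "(\<integral>\<^sup>+z. ennreal (maximal_fun T (avg_pow s h) z) \<partial>\<nu>) \<le> ennreal (maximal_const s * F)"
proof -
  have "(\<integral>\<^sup>+z. ennreal (maximal_fun T (avg_pow s h) z) \<partial>\<nu>) \<le>
     ennreal (maximal_const s) * (\<integral>\<^sup>+z. ennreal (h z powr s) \<partial>\<nu>)"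
  proof (rule maximal_inequality[OF s laminar_subset[OF laminar T]])
    show "finite T" using T finite by (rule finite_subset)
    show "T \<subseteq> sets \<nu>" using T sets by auto
    show "h \<in> borel_measurable \<nu>" using h by simp
    fix Q assume "Q \<in> T"
    then have Q: "Q \<in> S" using T by blast
    show "(\<integral>\<^sup>+z\<in>Q. ennreal (h z) \<partial>\<nu>) < \<infinity>" by (rule integral_finite[OF s h F Q])
    show "0 < emeasure \<nu> Q" "emeasure \<nu> Q < \<infinity>"
      using emeasure_density_pos[OF Q] emeasure_density_finite[OF Q] by auto
  qed (use h in \<open>auto simp: avg_pow_def\<close>)
  also have "\<dots> \<le> ennreal (maximal_const s) * ennreal F"
    using F by (intro mult_left_mono) auto
  finally show ?thesis by (simp add: ennreal_mult' maximal_const_def)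
qed

text \<open>A Carleson embedding: after division by \<open>A_inf\<close> the masses of a weight over a sparse family behave
  like a Carleson sequence, with a constant that does not depend on the weight.\<close>

lemma sum_over_A_inf_le:
  assumes s: "1 < s" and h: "h \<in> borel_measurable M" "\<And>z. 0 \<le> h z"
    and F: "(\<integral>\<^sup>+z. ennreal (h z powr s) \<partial>\<nu>) \<le> ennreal F" "0 \<le> F"
    and pos: "\<And>Q. Q \<in> S \<Longrightarrow> 0 < avg_pow s h Q" and T: "T \<subseteq> S"
  shows "(\<Sum>Q\<in>T. ancestor_max S (avg_pow s h) Q * measure \<nu> Q / A_inf Q) \<le>
     2 * maximal_const 2 * maximal_const s * F"
proof -
  let ?x = "ancestor_max S (avg_pow s h)" and ?X = "maximal_fun S (avg_pow s h)"
  have x0: "0 \<le> ?x Q" if "Q \<in> S" for Q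
    using ancestor_max_ge[OF finite that order_refl, of "avg_pow s h"] pos[OF that] by linarith
  have Xm: "?X \<in> borel_measurable M" using finite sets by (rule borel_measurable_maximal_fun)
  have eq: "?x Q * measure \<nu> Q / A_inf Q =
      ?x Q * (measure M Q * exp (- ((LINT z:Q|M. ln (inverse (u z))) / measure M Q)))" if "Q \<in> S" for Q
    using measure_density_pos[OF that] measure_pos[OF that]
    by (simp add: A_inf_def exp_minus field_simps)
  have nn: "0 \<le> ?x Q * measure \<nu> Q / A_inf Q" if "Q \<in> S" for Q
    using x0[OF that] A_inf_ge_1[OF that] by simp
  have "ennreal (\<Sum>Q\<in>T. ?x Q * measure \<nu> Q / A_inf Q) \<le> ennreal (\<Sum>Q\<in>S. ?x Q * measure \<nu> Q / A_inf Q)"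
    using T nn finite by (intro ennreal_leI sum_mono2) auto
  also have "\<dots> = (\<Sum>Q\<in>S. ennreal (?x Q * (measure M Q * exp (- ((LINT z:Q|M. ln (inverse (u z))) / measure M Q)))))"
    using nn eq by (subst sum_ennreal[symmetric]) (auto intro!: sum.cong)
  also have "\<dots> \<le> ennreal (2 * maximal_const 2) * (\<integral>\<^sup>+z. ennreal (?X z * u z) \<partial>M)"
    by (rule sparse_sum_exp_log_average[OF laminar finite sets emeasure_pos emeasure_finite sparse
          Xm u_measurable maximal_fun_nonneg[OF finite] u_nonneg u_pos u_integrable ln_integrable x0
          ancestor_max_le_maximal_fun[OF finite]])
  also have "(\<integral>\<^sup>+z. ennreal (?X z * u z) \<partial>M) = (\<integral>\<^sup>+z. ennreal (?X z) \<partial>\<nu>)"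
    using Xm maximal_fun_nonneg[OF finite] u_nonneg
    by (subst nn_integral_density) (auto intro!: nn_integral_cong simp: ennreal_mult mult.commute)
  also have "ennreal (2 * maximal_const 2) * \<dots> \<le> ennreal (2 * maximal_const 2) * ennreal (maximal_const s * F)"
    using maximal_density[OF s h F(1) order_refl] by (intro mult_left_mono) auto
  also have "\<dots> = ennreal (2 * maximal_const 2 * maximal_const s * F)"
    using F(2) by (simp add: maximal_const_def mult.assoc flip: ennreal_mult')
  finally show ?thesis
    using F(2) by (subst (asm) ennreal_le_iff) (auto simp: maximal_const_def)
qed

text \<open>Here the masses are not divided by \<open>A_inf\<close>. Instead nested cubes have distinct levels, which bounds
  their sum at a point by a geometric series.\<close>

lemma sum_distinct_levels_le:
  assumes s: "1 < s" and h: "h \<in> borel_measurable M" "\<And>z. 0 \<le> h z"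
    and F: "(\<integral>\<^sup>+z. ennreal (h z powr s) \<partial>\<nu>) \<le> ennreal F" "0 \<le> F"
    and pos: "\<And>Q. Q \<in> S \<Longrightarrow> 0 < avg_pow s h Q" and G: "G \<subseteq> S"
    and lev: "\<And>Q R. Q \<in> G \<Longrightarrow> R \<in> G \<Longrightarrow> Q \<subset> R \<Longrightarrow>
      level (ancestor_max S (avg_pow s h) Q) \<noteq> level (ancestor_max S (avg_pow s h) R)"
  shows "(\<Sum>Q\<in>G. ancestor_max S (avg_pow s h) Q * measure \<nu> Q) \<le> 4 * maximal_const s * F"
proof -
  let ?x = "ancestor_max S (avg_pow s h)"
  have x0: "0 \<le> ?x Q" if "Q \<in> S" for Q
    using ancestor_max_ge[OF finite that order_refl, of "avg_pow s h"] pos[OF that] by linarith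
  have "ennreal (\<Sum>Q\<in>G. ?x Q * measure \<nu> Q) = (\<Sum>Q\<in>G. ennreal (?x Q) * emeasure \<nu> Q)"
    using G x0 by (subst sum_ennreal[symmetric])
      (auto intro!: sum.cong simp: ennreal_mult' emeasure_density_eq measure_density_eq[symmetric] subset_iff)
  also have "\<dots> \<le> 4 * (\<integral>\<^sup>+z. ennreal (maximal_fun S (avg_pow s h) z) \<partial>\<nu>)"
    by (rule sum_distinct_levels_le_integral[OF laminar finite _ pos G lev]) (use sets in auto)
  also have "\<dots> \<le> 4 * ennreal (maximal_const s * F)"
    using maximal_density[OF s h F(1) order_refl] by (intro mult_left_mono) auto
  also have "\<dots> = ennreal (4 * maximal_const s * F)"
    by (simp add: ennreal_mult' mult.assoc)
  finally show ?thesis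
    using F(2) by (subst (asm) ennreal_le_iff) (auto simp: maximal_const_def)
qed

end

section \<open>The bilinear estimate for finite families\<close>

lemma sparse_weight_subset:
  assumes "sparse_weight M S u" and T: "T \<subseteq> S"
  shows "sparse_weight M T u"
proof -
  interpret sparse_weight M S u by fact
  have "finite T" using T finite by (rule finite_subset)
  have sp: "measure M (\<Union>{Q' \<in> T. Q' \<subset> Q}) \<le> measure M Q / 2" if "Q \<in> T" for Q
  proof -
    have Q: "Q \<in> S" using that T by blast
    have Un: "\<Union>{Q' \<in> S'. Q' \<subset> Q} \<in> sets M" if "S' \<subseteq> S" for S'
    proof (rule sets.finite_Union)
      show "Finite_Set.finite {Q' \<in> S'. Q' \<subset> Q}" using finite_subset[OF that finite] by simp
    qed (use that sets in auto)
    have "Q \<in> fmeasurable M"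
      by (rule fmeasurableI) (use Q sets emeasure_finite in auto)
    then have "\<Union>{Q' \<in> S. Q' \<subset> Q} \<in> fmeasurable M"
      by (rule fmeasurableI2) (use Un in auto)
    then have "measure M (\<Union>{Q' \<in> T. Q' \<subset> Q}) \<le> measure M (\<Union>{Q' \<in> S. Q' \<subset> Q})"
      by (rule measure_mono_fmeasurable[rotated 2]) (use T Un in auto)
    then show ?thesis using sparse[OF Q] by simp
  qed
  show ?thesis
  proof
    show "laminar T" by (rule laminar_subset[OF laminar T])
    show "Finite_Set.finite T" by fact
    show "T \<subseteq> sets M" using T sets by blast
  qed (use T sp emeasure_pos emeasure_finite u_measurable u_nonneg u_pos u_integrable ln_integrable in auto)
qed

text \<open>The constant of \<open>half_sparse_bound\<close>: \<open>a\<close> and \<open>b\<close> are the exponents of the two maximal inequalities and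
  \<open>\<Sigma>\<close> is the sum of the series of the bump. The choice of \<open>\<epsilon>\<close> is the largest one for which
  \<open>\<alpha> \<epsilon> \<le> s\<close> and \<open>\<beta> \<epsilon> \<le> t\<close>.\<close>

definition bound_const :: "real \<Rightarrow> real \<Rightarrow> real \<Rightarrow> real \<Rightarrow> real \<Rightarrow> real \<Rightarrow> real \<Rightarrow> real" where
  "bound_const s t \<alpha> \<beta> a b \<Sigma> = (let \<epsilon> = min (s / \<alpha>) (t / \<beta>) in
     2 powr (3 + \<epsilon>) / (1 - 2 powr - (\<epsilon> * (\<alpha> + \<beta>))) *
     (2 * maximal_const 2 * maximal_const a) powr s * (16 * \<Sigma> * maximal_const b) powr t)"

lemma bound_const_nonneg:
  assumes "0 < s" "0 < t" "0 < \<alpha>" "0 < \<beta>"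
  shows "0 \<le> bound_const s t \<alpha> \<beta> a b \<Sigma>"
proof -
  have "2 powr - (min (s / \<alpha>) (t / \<beta>) * (\<alpha> + \<beta>)) < 2 powr (0 :: real)"
    using assms by (intro powr_less_mono) auto
  then show ?thesis unfolding bound_const_def Let_def by simp
qed

text \<open>The hypothesis on levels says that, going up from a cube of \<open>T\<close>, the \<open>y\<close>-level changes no later than
  the \<open>x\<close>-level. The bump in terms of \<open>u\<close> controls the sum over such cubes: the two hypotheses of the
  combinatorial core hold by the Carleson embedding for \<open>u\<close> and by the geometric series for \<open>v\<close>.\<close>

lemma half_sparse_bound:
  fixes u v \<phi> \<psi> :: "'a \<Rightarrow> real" and \<Psi> :: "real \<Rightarrow> real"
  assumes u: "sparse_weight M S u" and v: "sparse_weight M S v"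
    and e: "0 < s" "0 < t" "s + t = 1" "0 < \<alpha>" "0 < \<beta>" "1 < a" "1 < b"
    and \<phi>: "\<phi> \<in> borel_measurable M" "\<And>z. 0 \<le> \<phi> z"
    and \<psi>: "\<psi> \<in> borel_measurable M" "\<And>z. 0 \<le> \<psi> z"
    and F: "(\<integral>\<^sup>+z. ennreal (\<phi> z powr a) \<partial>density M (\<lambda>z. ennreal (u z))) \<le> ennreal F" "0 \<le> F"
    and G: "(\<integral>\<^sup>+z. ennreal (\<psi> z powr b) \<partial>density M (\<lambda>z. ennreal (v z))) \<le> ennreal G" "0 \<le> G"
    and U_def: "\<And>Q. U Q = measure (density M (\<lambda>z. ennreal (u z))) Q"
    and V_def: "\<And>Q. V Q = measure (density M (\<lambda>z. ennreal (v z))) Q"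
    and A_def: "\<And>Q. A Q = (U Q / measure M Q) powr \<alpha> * (V Q / measure M Q) powr \<beta>"
    and x_def: "\<And>Q. x Q = sparse_weight.avg_pow M u a \<phi> Q"
    and y_def: "\<And>Q. y Q = sparse_weight.avg_pow M v b \<psi> Q"
    and xy: "\<And>Q. Q \<in> S \<Longrightarrow> 0 < x Q" "\<And>Q. Q \<in> S \<Longrightarrow> 0 < y Q"
    and \<Psi>: "mono_on {1/2..} \<Psi>" "\<And>t. 1/2 \<le> t \<Longrightarrow> 0 < \<Psi> t" "summable (\<lambda>k. \<Psi> (2 ^ k) powr (- 1 / t))"
    and K: "0 < K" "\<And>Q. Q \<in> S \<Longrightarrow> A Q * sparse_weight.A_inf M u Q powr s * \<Psi> (sparse_weight.A_inf M u Q) \<le> K"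
    and T: "T \<subseteq> S"
    and levels: "\<And>Q R. Q \<in> T \<Longrightarrow> R \<in> T \<Longrightarrow> Q \<subseteq> R \<Longrightarrow>
      level (ancestor_max S y R) = level (ancestor_max S y Q) \<Longrightarrow>
      level (ancestor_max S x R) = level (ancestor_max S x Q)"
  shows "(\<Sum>Q\<in>T. x Q powr s * y Q powr t * (A Q * U Q powr s * V Q powr t)) \<le>
     bound_const s t \<alpha> \<beta> a b (\<Sum>k. \<Psi> (2 ^ k) powr (- 1 / t)) * K * F powr s * G powr t"
proof -
  interpret u: sparse_weight M S u by fact
  interpret v: sparse_weight M S v by fact
  define \<epsilon> where "\<epsilon> = min (s / \<alpha>) (t / \<beta>)"
  define \<Sigma> where "\<Sigma> = (\<Sum>k. \<Psi> (2 ^ k) powr (- 1 / t))"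
  have \<epsilon>: "0 < \<epsilon>" "\<alpha> * \<epsilon> \<le> s" "\<beta> * \<epsilon> \<le> t"
  proof -
    show "0 < \<epsilon>" using e by (simp add: \<epsilon>_def)
    have "\<epsilon> \<le> s / \<alpha>" "\<epsilon> \<le> t / \<beta>" unfolding \<epsilon>_def by simp_all
    then show "\<alpha> * \<epsilon> \<le> s" "\<beta> * \<epsilon> \<le> t" using e by (simp_all add: field_simps)
  qed
  have \<Sigma>: "0 \<le> \<Sigma>" unfolding \<Sigma>_def using \<Psi>(3) by (intro suminf_nonneg) auto
  let ?x = "ancestor_max S x" and ?y = "ancestor_max S y"
  have xx: "x Q \<le> ?x Q" "y Q \<le> ?y Q" if "Q \<in> S" for Q
    using that u.finite by (auto intro: ancestor_max_ge)
  have TS: "Q \<in> S" if "Q \<in> T" for Q using T that by blast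
  have x_eq: "x = u.avg_pow a \<phi>" and y_eq: "y = v.avg_pow b \<psi>"
    using x_def y_def by auto
  have UV: "0 < U Q" "0 < V Q" if "Q \<in> S" for Q
    unfolding U_def V_def using that u.measure_density_pos v.measure_density_pos by auto
  have "(\<Sum>Q\<in>T. x Q powr s * y Q powr t * (A Q * U Q powr s * V Q powr t)) \<le>
      (\<Sum>Q\<in>T. ?x Q powr s * ?y Q powr t * (A Q * U Q powr s * V Q powr t))"
    using xx xy e TS by (intro sum_mono mult_right_mono mult_mono powr_mono2)
      (auto simp: A_def less_imp_le)
  also have "\<dots> \<le> 2 powr (3 + \<epsilon>) / (1 - 2 powr - (\<epsilon> * (\<alpha> + \<beta>))) * K *
      (2 * maximal_const 2 * maximal_const a * F) powr s *
       (4 * (\<Sum>k. \<Psi> (2 ^ k) powr (- 1 / t)) * (4 * maximal_const b * G)) powr t"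
  proof (rule one_sided_sparse_bound[where m = "measure M" and E = u.A_inf and A = A and \<Psi> = \<Psi>])
    show "laminar T" by (rule laminar_subset[OF u.laminar T])
    show "finite T" using T u.finite by (rule finite_subset)
    show "{} \<notin> T" using T u.nonempty by blast
    fix C R assume CR: "C \<subseteq> T" "R \<in> T" "disjoint C" "\<forall>Q\<in>C. Q \<subset> R"
    then have CS: "C \<subseteq> S" using T by blast
    show "sum U C \<le> U R" using u.density_sum_le[OF CS TS[OF CR(2)] CR(3,4)] by (simp add: U_def)
    show "sum V C \<le> V R" using v.density_sum_le[OF CS TS[OF CR(2)] CR(3,4)] by (simp add: V_def)
    show "sum (measure M) C \<le> measure M R / 2" by (rule u.sum_measure_le_half[OF CS CR(3,4) TS[OF CR(2)]])
  next
    show "(\<Sum>Q\<in>T. ?x Q * U Q / u.A_inf Q) \<le> 2 * maximal_const 2 * maximal_const a * F"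
      using u.sum_over_A_inf_le[OF e(6) \<phi> F _ T] xy unfolding U_def x_eq by auto
  next
    fix H assume H: "H \<subseteq> T"
      "\<And>Q R. Q \<in> H \<Longrightarrow> R \<in> H \<Longrightarrow> Q \<subset> R \<Longrightarrow> level (?y Q) \<noteq> level (?y R)"
    show "(\<Sum>Q\<in>H. ?y Q * V Q) \<le> 4 * maximal_const b * G"
      unfolding V_def y_eq
      by (rule v.sum_distinct_levels_le[OF e(7) \<psi> G]) (use H T xy in \<open>auto simp: y_eq\<close>)
  next
    fix Q assume "Q \<in> T"
    then have Q: "Q \<in> S" by (rule TS)
    show "0 < ?x Q" "0 < ?y Q" using xx[OF Q] xy[OF Q] by linarith+
    show "0 < U Q" "0 < V Q" "0 < measure M Q" "1 \<le> u.A_inf Q"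
      using UV[OF Q] u.measure_pos[OF Q] u.A_inf_ge_1[OF Q] by auto
    show "A Q = (U Q / measure M Q) powr \<alpha> * (V Q / measure M Q) powr \<beta>" by (rule A_def)
    show "A Q * u.A_inf Q powr s * \<Psi> (u.A_inf Q) \<le> K" by (rule K(2)[OF Q])
  qed (fact e \<epsilon> \<Psi> K(1) levels)+
  also have "\<dots> = bound_const s t \<alpha> \<beta> a b \<Sigma> * K * F powr s * G powr t"
  proof -
    have "0 \<le> maximal_const a" for a unfolding maximal_const_def by simp
    then have "(2 * maximal_const 2 * maximal_const a * F) powr s =
        (2 * maximal_const 2 * maximal_const a) powr s * F powr s"
      "(4 * \<Sigma> * (4 * maximal_const b * G)) powr t = (16 * \<Sigma> * maximal_const b) powr t * G powr t"
      using F(2) G(2) \<Sigma> by (simp_all add: powr_mult[symmetric] mult_ac)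
    then show ?thesis
      unfolding bound_const_def Let_def \<Sigma>_def[symmetric] \<epsilon>_def[symmetric] by (simp add: mult_ac)
  qed
  finally show ?thesis unfolding \<Sigma>_def .
qed

text \<open>Going up from a cube, one of the two levels changes first, and this decides which of the two bumps is
  used for that cube. If neither alternative held for \<open>Q\<close>, there would be ancestors \<open>R1\<close>, where only
  the \<open>x\<close>-level has changed, and \<open>R2\<close>, where only the \<open>y\<close>-level has; but they are nested, and
  levels can only decrease on the way up. So each cube with non-zero term is in one of two families, and
  \<open>half_sparse_bound\<close> applies to both, the second time with the roles of \<open>u\<close> and \<open>v\<close> exchanged.\<close>

lemma finite_sparse_bound:
  fixes u v \<phi> \<psi> :: "'a \<Rightarrow> real" and \<Phi> \<Psi> :: "real \<Rightarrow> real"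
  assumes u: "sparse_weight M S u" and v: "sparse_weight M S v"
    and e: "0 < s" "0 < t" "s + t = 1" "0 < \<alpha>" "0 < \<beta>" "1 < a" "1 < b"
    and \<phi>: "\<phi> \<in> borel_measurable M" "\<And>z. 0 \<le> \<phi> z"
    and \<psi>: "\<psi> \<in> borel_measurable M" "\<And>z. 0 \<le> \<psi> z"
    and F: "(\<integral>\<^sup>+z. ennreal (\<phi> z powr a) \<partial>density M (\<lambda>z. ennreal (u z))) \<le> ennreal F" "0 \<le> F"
    and G: "(\<integral>\<^sup>+z. ennreal (\<psi> z powr b) \<partial>density M (\<lambda>z. ennreal (v z))) \<le> ennreal G" "0 \<le> G"
    and U_def: "\<And>Q. U Q = measure (density M (\<lambda>z. ennreal (u z))) Q"
    and V_def: "\<And>Q. V Q = measure (density M (\<lambda>z. ennreal (v z))) Q"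
    and A_def: "\<And>Q. A Q = (U Q / measure M Q) powr \<alpha> * (V Q / measure M Q) powr \<beta>"
    and x_def: "\<And>Q. x Q = sparse_weight.avg_pow M u a \<phi> Q"
    and y_def: "\<And>Q. y Q = sparse_weight.avg_pow M v b \<psi> Q"
    and \<Psi>: "mono_on {1/2..} \<Psi>" "\<And>t. 1/2 \<le> t \<Longrightarrow> 0 < \<Psi> t" "summable (\<lambda>k. \<Psi> (2 ^ k) powr (- 1 / t))"
    and \<Phi>: "mono_on {1/2..} \<Phi>" "\<And>t. 1/2 \<le> t \<Longrightarrow> 0 < \<Phi> t" "summable (\<lambda>k. \<Phi> (2 ^ k) powr (- 1 / s))"
    and K: "0 < K" "\<And>Q. Q \<in> S \<Longrightarrow> A Q * sparse_weight.A_inf M u Q powr s * \<Psi> (sparse_weight.A_inf M u Q) \<le> K"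
      "\<And>Q. Q \<in> S \<Longrightarrow> A Q * sparse_weight.A_inf M v Q powr t * \<Phi> (sparse_weight.A_inf M v Q) \<le> K"
  shows "(\<Sum>Q\<in>S. x Q powr s * y Q powr t * (A Q * U Q powr s * V Q powr t)) \<le>
     (bound_const s t \<alpha> \<beta> a b (\<Sum>k. \<Psi> (2 ^ k) powr (- 1 / t)) +
      bound_const t s \<beta> \<alpha> b a (\<Sum>k. \<Phi> (2 ^ k) powr (- 1 / s))) * K * F powr s * G powr t"
proof -
  \<comment> \<open>Levels make sense only for positive values, and the other terms vanish.\<close>
  define S' where "S' = {Q \<in> S. 0 < x Q \<and> 0 < y Q}"
  have S': "S' \<subseteq> S" unfolding S'_def by blast
  have u': "sparse_weight M S' u" and v': "sparse_weight M S' v"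
    using sparse_weight_subset[OF _ S'] u v by auto
  interpret u: sparse_weight M S u by fact
  interpret v: sparse_weight M S v by fact
  interpret u': sparse_weight M S' u by fact
  define f where "f Q = x Q powr s * y Q powr t * (A Q * U Q powr s * V Q powr t)" for Q
  let ?x = "ancestor_max S' x" and ?y = "ancestor_max S' y"
  define T1 where "T1 = {Q \<in> S'. \<forall>R\<in>S'. Q \<subseteq> R \<longrightarrow> level (?y R) = level (?y Q) \<longrightarrow> level (?x R) = level (?x Q)}"
  define T2 where "T2 = {Q \<in> S'. \<forall>R\<in>S'. Q \<subseteq> R \<longrightarrow> level (?x R) = level (?x Q) \<longrightarrow> level (?y R) = level (?y Q)}"
  have xy: "0 < x Q" "0 < y Q" and S'S: "Q \<in> S" if "Q \<in> S'" for Q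
    using that unfolding S'_def by auto
  have f0: "0 \<le> f Q" for Q unfolding f_def A_def by simp
  have pos: "0 < ?x Q" "0 < ?y Q" if "Q \<in> S'" for Q
    using ancestor_max_ge[OF u'.finite that order_refl, of x] ancestor_max_ge[OF u'.finite that order_refl, of y] that
    unfolding S'_def by auto
  have anti: "level (?x R) \<le> level (?x Q)" "level (?y R) \<le> level (?y Q)"
    if "Q \<subseteq> R" "Q \<in> S'" "R \<in> S'" for Q R
    using that pos u'.finite by (auto intro!: level_mono ancestor_max_antimono)
  have "S' \<subseteq> T1 \<union> T2"
  proof (rule subsetI, rule ccontr)
    fix Q assume Q: "Q \<in> S'" "Q \<notin> T1 \<union> T2"
    then obtain R1 R2 where R1: "R1 \<in> S'" "Q \<subseteq> R1" "level (?y R1) = level (?y Q)" "level (?x R1) \<noteq> level (?x Q)"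
      and R2: "R2 \<in> S'" "Q \<subseteq> R2" "level (?x R2) = level (?x Q)" "level (?y R2) \<noteq> level (?y Q)"
      unfolding T1_def T2_def by blast
    have "Q \<noteq> {}" using Q(1) u'.nonempty by blast
    then have "R1 \<inter> R2 \<noteq> {}" using R1(2) R2(2) by blast
    then have "R1 \<subseteq> R2 \<or> R2 \<subseteq> R1" using u'.laminar R1(1) R2(1) unfolding laminar_def by blast
    then show False
      using anti[of R1 R2] anti[of R2 R1] anti[of Q R1] anti[of Q R2] R1 R2 Q(1) by auto
  qed
  have "sum f S = sum f S'"
  proof (rule sum.mono_neutral_right[OF u.finite S'])
    have "0 \<le> x Q" "0 \<le> y Q" for Q unfolding x_def y_def u.avg_pow_def v.avg_pow_def by simp_all
    then show "\<forall>Q\<in>S - S'. f Q = 0" unfolding S'_def f_def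
      using e by (auto simp: less_le)
  qed
  also have "\<dots> \<le> sum f (T1 \<union> T2)"
    using u'.finite f0 \<open>S' \<subseteq> T1 \<union> T2\<close> by (intro sum_mono2) (auto simp: T1_def T2_def)
  also have "\<dots> \<le> sum f T1 + sum f T2"
  proof -
    have "finite T1" "finite T2" using u'.finite unfolding T1_def T2_def by auto
    then have "sum f T1 + sum f T2 = sum f (T1 \<union> T2) + sum f (T1 \<inter> T2)" by (simp add: sum.union_inter)
    then show ?thesis using sum_nonneg[of "T1 \<inter> T2" f] f0 by simp
  qed
  also have "sum f T1 \<le> bound_const s t \<alpha> \<beta> a b (\<Sum>k. \<Psi> (2 ^ k) powr (- 1 / t)) * K * F powr s * G powr t"
    unfolding f_def
  proof (rule half_sparse_bound[OF u' v' e \<phi> \<psi> F G U_def V_def A_def x_def y_def xy \<Psi> K(1) K(2)[OF S'S]])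
    fix Q R assume "Q \<in> T1" "R \<in> T1" "Q \<subseteq> R" "level (?y R) = level (?y Q)"
    then show "level (?x R) = level (?x Q)" unfolding T1_def by blast
  qed (auto simp: T1_def)
  also have "sum f T2 \<le> bound_const t s \<beta> \<alpha> b a (\<Sum>k. \<Phi> (2 ^ k) powr (- 1 / s)) * K * G powr t * F powr s"
  proof -
    have f': "f Q = y Q powr t * x Q powr s * (A Q * V Q powr t * U Q powr s)" for Q
      unfolding f_def by (simp add: mult_ac)
    have A': "A Q = (V Q / measure M Q) powr \<beta> * (U Q / measure M Q) powr \<alpha>" for Q
      unfolding A_def by (simp add: mult.commute)
    have e': "0 < t" "0 < s" "t + s = 1" "0 < \<beta>" "0 < \<alpha>" "1 < b" "1 < a" using e by auto
    show ?thesis unfolding f'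
    proof (rule half_sparse_bound[OF v' u' e' \<psi> \<phi> G F V_def U_def A' y_def x_def xy(2,1) \<Phi> K(1) K(3)[OF S'S]])
      fix Q R assume "Q \<in> T2" "R \<in> T2" "Q \<subseteq> R" "level (?x R) = level (?x Q)"
      then show "level (?y R) = level (?y Q)" unfolding T2_def by blast
    qed (auto simp: T2_def)
  qed
  finally show ?thesis unfolding f_def by (simp add: algebra_simps)
qed

section \<open>Exponents, bumps and cubes\<close>

text \<open>Since \<open>\<Psi>\<close> is increasing, the integral over \<open>[2\<^sup>k / 2, 2\<^sup>k)\<close> is at least half of the term of index
  \<open>k\<close>. The interval for \<open>k = 0\<close> begins at \<open>1/2\<close>.\<close>

lemma summable_dyadic_values:
  fixes \<Psi> g :: "real \<Rightarrow> real"
  assumes mono: "mono_on {1/2..} \<Psi>" and pos: "\<And>t. 1/2 \<le> t \<Longrightarrow> 0 < \<Psi> t" and q: "0 < q"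
    and g: "\<And>t. 1/2 \<le> t \<Longrightarrow> \<Psi> t powr - q / t \<le> g t"
    and fin: "(\<integral>\<^sup>+t\<in>{1/2..}. ennreal (g t) \<partial>lborel) < \<infinity>"
  shows "summable (\<lambda>k. \<Psi> (2 ^ k) powr - q)"
proof (rule summableI_nonneg_bounded)
  fix n
  define B where "B k = {2 ^ k / 2 ..< 2 ^ k :: real}" for k :: nat
  define c where "c k = \<Psi> (2 ^ k) powr - q / 2 ^ k" for k
  have uniq: "j = k" if t: "t \<in> B j" "t \<in> B k" for t j k
  proof -
    have no: False if "t \<in> B i" "t \<in> B l" "i < l" for i l
    proof -
      have "(2::real) * 2 ^ i \<le> 2 ^ l"
        using power_increasing[of "Suc i" l "2::real"] that by simp
      then show False using that unfolding B_def by simp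
    qed
    show ?thesis using no t by (meson linorder_neqE_nat)
  qed
  have pointwise: "(\<Sum>k<n. c k * indicator (B k) t) \<le> g t * indicator {1/2..} t" for t
  proof (cases "\<exists>k<n. t \<in> B k")
    case True
    then obtain k where k: "k < n" "t \<in> B k" by blast
    have t: "1 / 2 \<le> t" "t \<le> 2 ^ k"
    proof -
      have "2 ^ k / 2 \<le> t" "t < 2 ^ k" using k(2) unfolding B_def by auto
      then show "1 / 2 \<le> t" "t \<le> 2 ^ k" using one_le_power[of "2::real" k] by linarith+
    qed
    have "(\<Sum>j<n. c j * indicator (B j) t) = (\<Sum>j<n. if j = k then c j else 0)"
    proof (rule sum.cong[OF refl])
      fix j
      show "c j * indicator (B j) t = (if j = k then c j else 0)"
        using uniq[of t j k] k(2) by (cases "t \<in> B j") auto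
    qed
    also have "\<dots> = c k" using k by simp
    also have "\<dots> \<le> \<Psi> t powr - q / t"
    proof -
      have "\<Psi> t \<le> \<Psi> (2 ^ k)" using t by (intro mono_onD[OF mono]) auto
      then have "\<Psi> (2 ^ k) powr - q \<le> \<Psi> t powr - q" using pos[OF t(1)] q by (intro powr_mono2') auto
      then show ?thesis unfolding c_def using t by (intro frac_le) auto
    qed
    also have "\<dots> \<le> g t" using t(1) by (rule g)
    also have "\<dots> = g t * indicator {1/2..} t"
      using t by simp
    finally show ?thesis .
  next
    case False
    then have "(\<Sum>k<n. c k * indicator (B k) t) = 0" by (intro sum.neutral) auto
    moreover have "0 \<le> g t" if "1 / 2 \<le> t" using g[OF that] that by (smt (verit) divide_nonneg_nonneg powr_ge_zero)
    ultimately show ?thesis by (auto simp: indicator_def)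
  qed
  have "(\<Sum>k<n. ennreal (c k) * emeasure lborel (B k)) = (\<integral>\<^sup>+t. ennreal (\<Sum>k<n. c k * indicator (B k) t) \<partial>lborel)"
    by (subst nn_integral_sum_indicator) (auto simp: B_def c_def)
  also have "\<dots> \<le> (\<integral>\<^sup>+t\<in>{1/2..}. ennreal (g t) \<partial>lborel)"
  proof (rule nn_integral_mono)
    fix t
    show "ennreal (\<Sum>k<n. c k * indicator (B k) t) \<le> ennreal (g t) * indicator {1/2..} t"
      using ennreal_leI[OF pointwise[of t]] by (cases "t \<in> {1/2..}") simp_all
  qed
  also have "(\<Sum>k<n. ennreal (c k) * emeasure lborel (B k)) = ennreal (\<Sum>k<n. \<Psi> (2 ^ k) powr - q / 2)"
    by (subst sum_ennreal[symmetric]) (auto simp: B_def c_def intro!: sum.cong simp flip: ennreal_mult)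
  also have "(\<integral>\<^sup>+t\<in>{1/2..}. ennreal (g t) \<partial>lborel) =
      ennreal (enn2real (\<integral>\<^sup>+t\<in>{1/2..}. ennreal (g t) \<partial>lborel))"
    using fin by (intro ennreal_enn2real[symmetric]) simp
  finally have "(\<Sum>k<n. \<Psi> (2 ^ k) powr - q / 2) \<le> enn2real (\<integral>\<^sup>+t\<in>{1/2..}. ennreal (g t) \<partial>lborel)"
    by (subst (asm) ennreal_le_iff) (rule enn2real_nonneg)
  then show "(\<Sum>k<n. \<Psi> (2 ^ k) powr - q) \<le> 2 * enn2real (\<integral>\<^sup>+t\<in>{1/2..}. ennreal (g t) \<partial>lborel)"
    by (simp flip: sum_divide_distrib)
qed simp

lemma conj_exp_ereal: "1 < x \<Longrightarrow> conj_exp (ereal x) = ereal (x / (x - 1))"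
  unfolding conj_exp_def by (simp add: one_ereal_def field_simps)

lemma rconj_ereal: "1 < x \<Longrightarrow> rconj (ereal x) = x / (x - 1)"
  unfolding rconj_def by (simp add: conj_exp_ereal)

lemma rconj_infinity: "rconj \<infinity> = 1"
  unfolding rconj_def conj_exp_def by (simp add: one_ereal_def)

text \<open>The last three identities show that \<open>A_r\<close> and \<open>A_r'\<close> carry the same exponents: both are
  \<open>\<langle>v\<rangle> powr (1/p - 1/q0) * \<langle>u\<rangle> powr (1/p0 - 1/p)\<close>.\<close>

lemma exponent_identities:
  fixes p0 p :: real and q0 :: ereal
  assumes "1 \<le> p0" "p0 < p" "ereal p < q0"
  shows "1 < rconj p" "1 / rconj p = 1 - 1 / p"
    and "0 < rconj q0" "rconj q0 < rconj p" "1 / rconj q0 = 1 - real_of_ereal (1 / q0)"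
    and "real_of_ereal (1 / q0) < 1 / p"
    and "(1 / p - real_of_ereal (1 / q0)) * (r_exp p0 p q0 - 1) = 1 / p0 - 1 / p"
    and "1 / rconj p - real_of_ereal (1 / conj_exp p0) = 1 / p0 - 1 / p"
    and "(1 / p0 - 1 / p) * (rconj (r_exp p0 p q0) - 1) = 1 / p - real_of_ereal (1 / q0)"
proof -
  have p: "1 < p" using assms by linarith
  define c where "c = real_of_ereal (1 / q0)"
  have c: "0 \<le> c" "c < 1 / p" "rconj q0 = 1 / (1 - c)" "rconj (q0 / ereal p) = 1 / (1 - p * c)"
  proof -
    have "0 \<le> c \<and> c < 1 / p \<and> rconj q0 = 1 / (1 - c) \<and> rconj (q0 / ereal p) = 1 / (1 - p * c)"
    proof (cases q0)
      case (real q)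
      then have q: "p < q" "1 < q / p" using assms p by auto
      have "c = 1 / q" unfolding c_def real using q p by (simp add: one_ereal_def)
      moreover have "q0 / ereal p = ereal (q / p)" using real p by simp
      moreover have "1 < q" using q p by linarith
      moreover have "q / (q - 1) = 1 / (1 - 1 / q)" "q / p / (q / p - 1) = 1 / (1 - p * (1 / q))"
        using q p by (simp_all add: field_simps)
      ultimately show ?thesis using q p by (simp add: real rconj_ereal frac_less2)
    next
      case PInf
      then have "c = 0" "q0 / ereal p = \<infinity>" unfolding c_def using p by simp_all
      then show ?thesis using p PInf by (simp add: rconj_infinity)
    qed (use assms in auto)
    then show "0 \<le> c" "c < 1 / p" "rconj q0 = 1 / (1 - c)" "rconj (q0 / ereal p) = 1 / (1 - p * c)"
      by auto
  qed
  have pc: "p * c < 1" using c(2) p by (simp add: field_simps)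
  have c1: "c < 1" using c(2) p by (smt (verit) divide_less_eq_1_pos)
  show "1 < rconj p" "1 / rconj p = 1 - 1 / p"
    unfolding rconj_ereal[OF p] using p by (simp_all add: field_simps)
  show "0 < rconj q0" "1 / rconj q0 = 1 - real_of_ereal (1 / q0)"
    unfolding c(3) c_def[symmetric] using c1 by simp_all
  show "rconj q0 < rconj p" unfolding c(3) rconj_ereal[OF p] using c1 pc p by (simp add: field_simps)
  show "real_of_ereal (1 / q0) < 1 / p" using c(2) unfolding c_def .
  have r: "r_exp p0 p q0 - 1 = (p / p0 - 1) / (1 - p * c)" unfolding r_exp_def c(4) by simp
  show ar: "(1 / p - real_of_ereal (1 / q0)) * (r_exp p0 p q0 - 1) = 1 / p0 - 1 / p"
    unfolding r c_def[symmetric] using pc p assms by (simp add: divide_simps)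
  show "1 / rconj p - real_of_ereal (1 / conj_exp p0) = 1 / p0 - 1 / p"
  proof (cases "p0 = 1")
    case True
    then have "conj_exp p0 = \<infinity>" unfolding conj_exp_def by (simp add: one_ereal_def divide_ereal_def)
    then show ?thesis using True \<open>1 / rconj p = 1 - 1 / p\<close> by simp
  next
    case False
    then have "1 < p0" using assms by simp
    then show ?thesis unfolding \<open>1 / rconj p = 1 - 1 / p\<close>
      by (simp add: conj_exp_ereal one_ereal_def field_simps)
  qed
  have r1: "0 < r_exp p0 p q0 - 1" unfolding r using assms pc by simp
  then have "rconj (r_exp p0 p q0) - 1 = 1 / (r_exp p0 p q0 - 1)"
    by (subst rconj_ereal) (simp_all add: field_simps)
  then show "(1 / p0 - 1 / p) * (rconj (r_exp p0 p q0) - 1) = 1 / p - real_of_ereal (1 / q0)"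
    using r1 ar[symmetric] by simp
qed

text \<open>Some small ball lies in a compact neighbourhood, and doubling passes from it to all larger balls.\<close>

lemma emeasure_ball_finite:
  fixes M :: "'a::metric_space measure"
  assumes lc: "locally compact (UNIV :: 'a set)" and M: "doubling_measure M"
  shows "emeasure M (ball x r) < \<infinity>"
proof -
  obtain U K where U: "openin (top_of_set UNIV) U" "compact K" "x \<in> U" "U \<subseteq> K"
    using locallyE[OF lc, of UNIV x] by auto
  then obtain e where e: "0 < e" "ball x e \<subseteq> U" by (auto simp: open_contains_ball)
  have [simp]: "sets M = sets borel" using M unfolding doubling_measure_def by blast
  have "\<exists>A::real. \<forall>x r. 0 < r \<longrightarrow> emeasure M (ball x (2 * r)) \<le> ennreal A * emeasure M (ball x r)"
    using M unfolding doubling_measure_def by (elim conjE)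
  then obtain A :: real where "\<forall>x r. 0 < r \<longrightarrow> emeasure M (ball x (2 * r)) \<le> ennreal A * emeasure M (ball x r)" ..
  then have A: "0 < r \<Longrightarrow> emeasure M (ball x (2 * r)) \<le> ennreal A * emeasure M (ball x r)" for x r
    by simp
  have fin: "emeasure M (ball x (2 ^ n * e)) < \<infinity>" for n
  proof (induction n)
    case 0
    have "emeasure M (ball x e) \<le> emeasure M K"
      using U e by (intro emeasure_mono) (auto intro: borel_compact)
    also have "\<dots> < \<infinity>" using M U unfolding doubling_measure_def by blast
    finally show ?case by simp
  next
    case (Suc n)
    have "emeasure M (ball x (2 * (2 ^ n * e))) \<le> ennreal A * emeasure M (ball x (2 ^ n * e))"
      using e by (intro A) simp
    also have "\<dots> < \<infinity>" using Suc by (simp add: ennreal_mult_less_top)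
    finally show ?case by (simp add: mult.assoc)
  qed
  obtain n where "r / e < 2 ^ n" using real_arch_pow[of 2 "r / e"] by auto
  then have "ball x r \<subseteq> ball x (2 ^ n * e)"
    using e by (intro subset_ball) (simp add: field_simps)
  then have "emeasure M (ball x r) \<le> emeasure M (ball x (2 ^ n * e))"
    by (intro emeasure_mono) auto
  then show ?thesis using fin[of n] by (rule le_less_trans)
qed

lemma dyadic_systemD:
  assumes "dyadic_system D"
  shows "countable (D k)" "D k \<subseteq> sets borel"
    and "\<forall>Q\<in>cubes D. \<forall>R\<in>cubes D. Q \<inter> R = {} \<or> Q \<subseteq> R \<or> R \<subseteq> Q"
    and "\<exists>\<delta> c C :: real. 0 < \<delta> \<and> \<delta> < 1 \<and> 0 < c \<and> c \<le> C \<and>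
        (\<forall>k. \<forall>Q\<in>D k. \<exists>z. ball z (c * \<delta> powi k) \<subseteq> Q \<and> Q \<subseteq> ball z (C * \<delta> powi k))"
  using assms unfolding dyadic_system_def by (elim conjE; simp)+

lemma cube_measure:
  fixes M :: "'a::metric_space measure"
  assumes lc: "locally compact (UNIV :: 'a set)" and M: "doubling_measure M"
    and D: "dyadic_system D" and Q: "Q \<in> cubes D"
  shows "Q \<in> sets M" "0 < emeasure M Q" "emeasure M Q < \<infinity>"
proof -
  have sM: "sets M = sets borel" using M unfolding doubling_measure_def by blast
  obtain k where k: "Q \<in> D k" using Q unfolding cubes_def by blast
  show QM: "Q \<in> sets M" using dyadic_systemD(2)[OF D] k unfolding sM by blast
  obtain \<delta> c C z where b: "0 < \<delta>" "0 < c" "ball z (c * \<delta> powi k) \<subseteq> Q" "Q \<subseteq> ball z (C * \<delta> powi k)"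
    using dyadic_systemD(4)[OF D] k by meson
  have "0 < emeasure M (ball z (c * \<delta> powi k))"
  proof -
    have "0 < c * \<delta> powi k" using b by (simp add: zero_less_power_int)
    then have "open (ball z (c * \<delta> powi k)) \<and> ball z (c * \<delta> powi k) \<noteq> {}" by simp
    then show ?thesis using M unfolding doubling_measure_def by blast
  qed
  also have "\<dots> \<le> emeasure M Q" using b(3) QM by (rule emeasure_mono)
  finally show "0 < emeasure M Q" .
  have "emeasure M Q \<le> emeasure M (ball z (C * \<delta> powi k))"
    using b(4) by (rule emeasure_mono) (simp add: sM)
  also have "\<dots> < \<infinity>" by (rule emeasure_ball_finite[OF lc M])
  finally show "emeasure M Q < \<infinity>" .
qed

text \<open>Finiteness of \<open>A_exp\<close> is what gives integrability over cubes, which need not be relatively compact.\<close>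

lemma sparse_weight_cubes:
  fixes M :: "'a::metric_space measure"
  assumes lc: "locally compact (UNIV :: 'a set)" and M: "doubling_measure M"
    and D: "dyadic_system D" and S: "sparse_family M D S"
    and T: "finite T" "T \<subseteq> S"
    and u: "weight M u" "\<And>z. 0 \<le> u z" and A: "\<And>Q. Q \<in> cubes D \<Longrightarrow> A_exp M u Q \<noteq> \<infinity>"
  shows "sparse_weight M T u"
proof
  have cube: "Q \<in> cubes D" if "Q \<in> T" for Q using that T S unfolding sparse_family_def by blast
  show "laminar T" using dyadic_systemD(3)[OF D] cube unfolding laminar_def by blast
  show "finite T" by fact
  show "T \<subseteq> sets M" using cube_measure(1)[OF lc M D] cube by blast
  show "u \<in> borel_measurable M" "AE z in M. 0 < u z" using u unfolding weight_def by auto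
  show "0 \<le> u z" for z by fact
  fix Q assume Q: "Q \<in> T"
  show fin: "0 < emeasure M Q" "emeasure M Q < \<infinity>"
    using cube_measure[OF lc M D cube[OF Q]] by auto
  show "set_integrable M Q u" "set_integrable M Q (\<lambda>z. ln (inverse (u z)))"
    using A[OF cube[OF Q]] unfolding A_exp_def by (auto split: if_splits)
  have "countable (cubes D)" using dyadic_systemD(1)[OF D] unfolding cubes_def by (intro countable_UN) auto
  then have "countable {Q' \<in> S. Q' \<subset> Q}"
    by (rule countable_subset[rotated]) (use S in \<open>auto simp: sparse_family_def\<close>)
  then have "\<Union>{Q' \<in> S. Q' \<subset> Q} \<in> sets M"
    by (rule sets.countable_Union) (use S cube_measure(1)[OF lc M D] in \<open>auto simp: sparse_family_def\<close>)
  then have "emeasure M (\<Union>{Q' \<in> T. Q' \<subset> Q}) \<le> emeasure M (\<Union>{Q' \<in> S. Q' \<subset> Q})"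
    by (rule emeasure_mono[rotated]) (use T in auto)
  also have "\<dots> \<le> emeasure M Q / 2" using S T Q unfolding sparse_family_def by blast
  also have "\<dots> = ennreal (measure M Q / 2)"
  proof -
    have "emeasure M Q = ennreal (measure M Q)"
      using fin by (intro emeasure_eq_ennreal_measure) auto
    then show ?thesis by (simp add: divide_ennreal[symmetric])
  qed
  finally show "measure M (\<Union>{Q' \<in> T. Q' \<subset> Q}) \<le> measure M Q / 2"
    unfolding measure_def[of M "\<Union>{Q' \<in> T. Q' \<subset> Q}"] by (rule enn2real_leI[rotated]) simp
qed

section \<open>The bump theorem\<close>

lemma epowr_ennreal: "0 \<le> x \<Longrightarrow> epowr (ennreal x) a = ennreal (x powr a)"
  unfolding epowr_def by simp

context sparse_weight
begin

lemma avg_weight: "Q \<in> S \<Longrightarrow> avg M Q (\<lambda>x. ennreal (u x)) = ennreal (measure \<nu> Q / measure M Q)"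
  unfolding avg_def
  using nn_integral_eq_set_lebesgue_integral[OF u_integrable u_nonneg, of Q] measure_density_eq[of Q]
    emeasure_eq[of Q] measure_pos[of Q] measure_density_pos[of Q]
  by (simp add: divide_ennreal)

lemma A_exp_eq: "Q \<in> S \<Longrightarrow> A_exp M u Q = ennreal (A_inf Q)"
  unfolding A_exp_def A_inf_def using u_integrable ln_integrable measure_density_pos[of Q] measure_pos[of Q]
  by (simp add: avg_weight flip: ennreal_mult')

text \<open>The change of variables \<open>|f|\<^sup>e = \<phi> u\<close>. The exponent in \<open>u = w powr (e / (e - P))\<close> is such that
  \<open>u powr (1 - P / e) = w\<close>, so that the norm of \<open>f\<close> in \<open>L\<^sup>P(w)\<close> becomes a norm of \<open>\<phi>\<close> with respect to
  \<open>u\<close>, and the average of \<open>|f|\<^sup>e\<close> becomes the average of \<open>\<phi>\<close> with respect to \<open>u\<close> times that of \<open>u\<close>.\<close>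

lemma power_average_eq:
  fixes f w :: "'a \<Rightarrow> real"
  assumes e: "0 < e" "e < P"
    and w: "AE z in M. 0 < w z" and uw: "u = (\<lambda>z. w z powr (e / (e - P)))"
    and f [measurable]: "f \<in> borel_measurable M" and wm [measurable]: "w \<in> borel_measurable M"
    and F: "(\<integral>\<^sup>+z. ennreal (\<bar>f z\<bar> powr P * w z) \<partial>M) \<le> ennreal F"
  shows "(\<integral>\<^sup>+z. ennreal ((\<bar>f z\<bar> powr e / u z) powr (P / e)) \<partial>\<nu>) \<le> ennreal F" (is ?norm)
    and "Q \<in> S \<Longrightarrow> epowr (avg M Q (\<lambda>z. ennreal (\<bar>f z\<bar> powr e))) (1 / e) =
      ennreal (avg_pow (P / e) (\<lambda>z. \<bar>f z\<bar> powr e / u z) Q powr (1 / P) * (measure \<nu> Q / measure M Q) powr (1 / e))"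
      (is "_ \<Longrightarrow> ?average Q")
proof -
  have "(\<integral>\<^sup>+z. ennreal ((\<bar>f z\<bar> powr e / u z) powr (P / e)) \<partial>\<nu>) =
      (\<integral>\<^sup>+z. ennreal (u z) * ennreal ((\<bar>f z\<bar> powr e / u z) powr (P / e)) \<partial>M)"
    by (rule nn_integral_density) measurable
  also have "\<dots> = (\<integral>\<^sup>+z. ennreal (\<bar>f z\<bar> powr P * w z) \<partial>M)"
  proof (rule nn_integral_cong_AE)
    show "AE z in M. ennreal (u z) * ennreal ((\<bar>f z\<bar> powr e / u z) powr (P / e)) = ennreal (\<bar>f z\<bar> powr P * w z)"
      using w
    proof eventually_elim
      case (elim z)
      have u0: "0 < u z" using elim by (simp add: uw)
      have "u z * (\<bar>f z\<bar> powr e / u z) powr (P / e) = \<bar>f z\<bar> powr P * (u z powr 1 / u z powr (P / e))"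
        using u0 e by (simp add: powr_divide powr_powr)
      also have "u z powr 1 / u z powr (P / e) = u z powr (1 - P / e)" by (simp only: powr_diff)
      also have "\<dots> = w z powr (e / (e - P) * (1 - P / e))" unfolding uw by (simp add: powr_powr)
      also have "e / (e - P) * (1 - P / e) = 1" using e by (simp add: field_simps)
      finally show ?case using elim u0 by (simp flip: ennreal_mult')
    qed
  qed
  finally show norm: ?norm using F by simp
  assume Q: "Q \<in> S"
  then have [measurable]: "Q \<in> sets M" using sets by blast
  let ?h = "\<lambda>z. \<bar>f z\<bar> powr e / u z"
  define I where "I = enn2real (\<integral>\<^sup>+z\<in>Q. ennreal (?h z) \<partial>\<nu>)"
  have "(\<integral>\<^sup>+z\<in>Q. ennreal (?h z) \<partial>\<nu>) < \<infinity>"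
    by (rule integral_finite[OF _ _ _ norm Q]) (use e u_nonneg in auto)
  then have I: "(\<integral>\<^sup>+z\<in>Q. ennreal (?h z) \<partial>\<nu>) = ennreal I" "0 \<le> I" unfolding I_def by auto
  have "(\<integral>\<^sup>+z\<in>Q. ennreal (?h z) \<partial>\<nu>) = (\<integral>\<^sup>+z. ennreal (u z) * (ennreal (?h z) * indicator Q z) \<partial>M)"
    by (rule nn_integral_density) measurable
  also have "\<dots> = (\<integral>\<^sup>+z\<in>Q. ennreal (\<bar>f z\<bar> powr e) \<partial>M)"
  proof (rule nn_integral_cong_AE)
    show "AE z in M. ennreal (u z) * (ennreal (?h z) * indicator Q z) = ennreal (\<bar>f z\<bar> powr e) * indicator Q z"
      using u_pos by eventually_elim (auto simp: indicator_def simp flip: ennreal_mult')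
  qed
  finally have "(\<integral>\<^sup>+z\<in>Q. ennreal (\<bar>f z\<bar> powr e) \<partial>M) = ennreal I" unfolding I(1) by (rule sym)
  then have "avg M Q (\<lambda>z. ennreal (\<bar>f z\<bar> powr e)) = ennreal (I / measure M Q)"
    unfolding avg_def using I(2) emeasure_eq[OF Q] measure_pos[OF Q] by (simp add: divide_ennreal)
  then have "epowr (avg M Q (\<lambda>z. ennreal (\<bar>f z\<bar> powr e))) (1 / e) = ennreal ((I / measure M Q) powr (1 / e))"
    using I measure_pos[OF Q] by (simp add: epowr_ennreal)
  also have "(I / measure M Q) powr (1 / e) = (I / measure \<nu> Q) powr (1 / e) * (measure \<nu> Q / measure M Q) powr (1 / e)"
    using I measure_pos[OF Q] measure_density_pos[OF Q] by (simp flip: powr_mult)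
  also have "(I / measure \<nu> Q) powr (1 / e) = avg_pow (P / e) ?h Q powr (1 / P)"
    unfolding avg_pow_def I_def[symmetric] using e by (simp add: powr_powr)
  finally show "?average Q" .
qed

end

lemma Lp_spaceD:
  assumes f: "f \<in> Lp_space M w P"
  obtains F where "0 \<le> F" "f \<in> borel_measurable M"
    "(\<integral>\<^sup>+z. ennreal (\<bar>f z\<bar> powr P * w z) \<partial>M) = ennreal F" "Lp_norm M w P f = ennreal (F powr (1 / P))"
proof -
  define I where "I = (\<integral>\<^sup>+z. ennreal (\<bar>f z\<bar> powr P * w z) \<partial>M)"
  have f': "Lp_norm M w P f < \<infinity>" "f \<in> borel_measurable M" using f unfolding Lp_space_def by auto
  then have "I \<noteq> \<infinity>" unfolding Lp_norm_def I_def[symmetric] epowr_def by (auto split: if_splits)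
  then obtain F where F: "I = ennreal F" "0 \<le> F" by (cases I) auto
  show thesis
  proof (rule that[OF F(2) f'(2)])
    show "Lp_norm M w P f = ennreal (F powr (1 / P))"
      unfolding Lp_norm_def I_def[symmetric] F(1) by (rule epowr_ennreal[OF F(2)])
  qed (use F(1) in \<open>simp add: I_def\<close>)
qed

lemma sparse_form_le:
  assumes "\<And>T. finite T \<Longrightarrow> T \<subseteq> S \<Longrightarrow>
     (\<Sum>Q\<in>T. epowr (avg M Q (\<lambda>x. ennreal (\<bar>f x\<bar> powr p0))) (1 / p0) *
            epowr (avg M Q (\<lambda>x. ennreal (\<bar>g x\<bar> powr rconj q0))) (1 / rconj q0) *
            emeasure M Q) \<le> B"
  shows "sparse_form M S p0 q0 f g \<le> B"
proof -
  have "sparse_form M S p0 q0 f g = (SUP T\<in>{T. finite T \<and> T \<subseteq> S}.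
     \<Sum>Q\<in>T. epowr (avg M Q (\<lambda>x. ennreal (\<bar>f x\<bar> powr p0))) (1 / p0) *
            epowr (avg M Q (\<lambda>x. ennreal (\<bar>g x\<bar> powr rconj q0))) (1 / rconj q0) * emeasure M Q)"
    unfolding sparse_form_def by (rule nonneg_infsum_complete) simp
  also have "\<dots> \<le> B" using assms by (intro SUP_least) auto
  finally show ?thesis .
qed

text \<open>The sum over a finite subfamily is brought into the form of \<open>finite_sparse_bound\<close>; the constant there
  is the same for all subfamilies.\<close>

lemma sparse_form_bound:
  fixes M :: "'a::{metric_space, second_countable_topology} measure" and \<Phi> \<Psi> :: "real \<Rightarrow> real"
  assumes lc: "locally compact (UNIV :: 'a set)" and M: "doubling_measure M" and D: "dyadic_system D"
    and e: "1 \<le> p0" "p0 < p" "ereal p < q0"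
    and \<Phi>: "mono_on {1/2..} \<Phi>" "\<And>t. 1/2 \<le> t \<Longrightarrow> 0 < \<Phi> t" "summable (\<lambda>k. \<Phi> (2 ^ k) powr - p)"
    and \<Psi>: "mono_on {1/2..} \<Psi>" "\<And>t. 1/2 \<le> t \<Longrightarrow> 0 < \<Psi> t" "summable (\<lambda>k. \<Psi> (2 ^ k) powr - rconj p)"
    and S: "sparse_family M D S" and w: "weight M w" and \<sigma>: "weight M \<sigma>"
    and u_def: "u = (\<lambda>x. w x powr (p0 / (p0 - p)))"
    and v_def: "v = (\<lambda>x. \<sigma> x powr (rconj q0 / (rconj q0 - rconj p)))"
    and u: "weight M u" and v: "weight M v"
    and K: "bump_r M D p0 p q0 \<Phi> v u \<le> ennreal K" "bump_r' M D p0 p q0 \<Psi> u v \<le> ennreal K" "0 \<le> K"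
    and f: "f \<in> Lp_space M w p" and g: "g \<in> Lp_space M \<sigma> (rconj p)"
  defines "C \<equiv> bound_const (1 / p) (1 / rconj p) (1 / p0 - 1 / p) (1 / p - real_of_ereal (1 / q0))
        (p / p0) (rconj p / rconj q0) (\<Sum>k. \<Psi> (2 ^ k) powr - rconj p) +
      bound_const (1 / rconj p) (1 / p) (1 / p - real_of_ereal (1 / q0)) (1 / p0 - 1 / p)
        (rconj p / rconj q0) (p / p0) (\<Sum>k. \<Phi> (2 ^ k) powr - p)"
  shows "sparse_form M S p0 q0 f g \<le> ennreal (C * K) * Lp_norm M w p f * Lp_norm M \<sigma> (rconj p) g"
proof -
  note ex = exponent_identities[OF e]
  define \<alpha> where "\<alpha> = 1 / p0 - 1 / p"
  define \<beta> where "\<beta> = 1 / p - real_of_ereal (1 / q0)"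
  define p' where "p' = rconj p"
  define e' where "e' = rconj q0"
  have p: "0 < p" "0 < p0" "1 < p" "1 < p'" using e ex(1) by (auto simp: p'_def)
  have \<alpha>: "0 < \<alpha>" unfolding \<alpha>_def using e by (simp add: frac_less2)
  have \<beta>: "0 < \<beta>" unfolding \<beta>_def using ex(6) by simp
  have e'p: "0 < e'" "e' < p'" unfolding e'_def p'_def using ex by auto
  have st: "1 / p + 1 / p' = 1" "1 / p0 = \<alpha> + 1 / p" "1 / e' = \<beta> + 1 / p'"
    using ex(2,5) unfolding \<alpha>_def \<beta>_def p'_def e'_def by simp_all
  have u0: "0 \<le> u z" and v0: "0 \<le> v z" for z unfolding u_def v_def by simp_all
  obtain F where F: "0 \<le> F" "f \<in> borel_measurable M"
    "(\<integral>\<^sup>+z. ennreal (\<bar>f z\<bar> powr p * w z) \<partial>M) = ennreal F" "Lp_norm M w p f = ennreal (F powr (1 / p))"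
    using Lp_spaceD[OF f] .
  obtain G where G: "0 \<le> G" "g \<in> borel_measurable M"
    "(\<integral>\<^sup>+z. ennreal (\<bar>g z\<bar> powr p' * \<sigma> z) \<partial>M) = ennreal G" "Lp_norm M \<sigma> p' g = ennreal (G powr (1 / p'))"
    using Lp_spaceD[OF g] unfolding p'_def .
  have Au: "A_exp M u Q \<noteq> \<infinity>" and Av: "A_exp M v Q \<noteq> \<infinity>"
    and Ku: "A_r' M p0 p q0 u v Q * epowr (A_exp M u Q) (1 / p) * ennreal (\<Psi> (enn2real (A_exp M u Q))) \<le> ennreal K"
    and Kv: "A_r M p0 p q0 v u Q * epowr (A_exp M v Q) (1 / p') * ennreal (\<Phi> (enn2real (A_exp M v Q))) \<le> ennreal K"
    if Q: "Q \<in> cubes D" for Q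
  proof -
    have "(if A_exp M u Q = \<infinity> then \<infinity> else A_r' M p0 p q0 u v Q * epowr (A_exp M u Q) (1 / p) *
        ennreal (\<Psi> (enn2real (A_exp M u Q)))) \<le> ennreal K"
      using K(2) unfolding bump_r'_def by (rule order_trans[OF SUP_upper[OF Q]])
    then show "A_exp M u Q \<noteq> \<infinity>" "A_r' M p0 p q0 u v Q * epowr (A_exp M u Q) (1 / p) *
        ennreal (\<Psi> (enn2real (A_exp M u Q))) \<le> ennreal K"
      by (auto split: if_splits simp: top_unique)
    have "(if A_exp M v Q = \<infinity> then \<infinity> else A_r M p0 p q0 v u Q * epowr (A_exp M v Q) (1 / p') *
        ennreal (\<Phi> (enn2real (A_exp M v Q)))) \<le> ennreal K"
      using K(1) unfolding bump_r_def p'_def by (rule order_trans[OF SUP_upper[OF Q]])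
    then show "A_exp M v Q \<noteq> \<infinity>" "A_r M p0 p q0 v u Q * epowr (A_exp M v Q) (1 / p') *
        ennreal (\<Phi> (enn2real (A_exp M v Q))) \<le> ennreal K"
      by (auto split: if_splits simp: top_unique)
  qed
  show ?thesis
  proof (rule sparse_form_le)
    fix T assume T: "finite T" "T \<subseteq> S"
    interpret u: sparse_weight M T u by (rule sparse_weight_cubes[OF lc M D S T u u0 Au])
    interpret v: sparse_weight M T v by (rule sparse_weight_cubes[OF lc M D S T v v0 Av])
    have cube: "Q \<in> cubes D" if "Q \<in> T" for Q using that T S unfolding sparse_family_def by blast
    define U where "U Q = measure (density M (\<lambda>z. ennreal (u z))) Q" for Q
    define V where "V Q = measure (density M (\<lambda>z. ennreal (v z))) Q" for Q
    define A where "A Q = (U Q / measure M Q) powr \<alpha> * (V Q / measure M Q) powr \<beta>" for Q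
    define \<phi> where "\<phi> z = \<bar>f z\<bar> powr p0 / u z" for z
    define \<psi> where "\<psi> z = \<bar>g z\<bar> powr e' / v z" for z
    define x where "x = u.avg_pow (p / p0) \<phi>"
    define y where "y = v.avg_pow (p' / e') \<psi>"
    have w': "w \<in> borel_measurable M" "AE z in M. 0 < w z" and \<sigma>': "\<sigma> \<in> borel_measurable M" "AE z in M. 0 < \<sigma> z"
      using w \<sigma> unfolding weight_def by auto
    note fu = u.power_average_eq[OF p(2) e(2) w'(2) u_def F(2) w'(1) eq_refl[OF F(3)], folded \<phi>_def]
    note gv = v.power_average_eq[OF e'p \<sigma>'(2) v_def[folded e'_def p'_def] G(2) \<sigma>'(1) eq_refl[OF G(3)], folded \<psi>_def]
    have pos: "0 < U Q" "0 < V Q" "0 < measure M Q" if "Q \<in> T" for Q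
      using u.measure_density_pos[OF that] v.measure_density_pos[OF that] u.measure_pos[OF that]
      unfolding U_def V_def by auto
    have Apos: "0 < A Q" if "Q \<in> T" for Q unfolding A_def using pos[OF that] by simp
    have A_r': "A_r' M p0 p q0 u v Q = ennreal (A Q)" if Q: "Q \<in> T" for Q
      unfolding A_r'_def Let_def ex(8) ex(9) u.avg_weight[OF Q] v.avg_weight[OF Q]
      using pos[OF Q] by (simp add: epowr_ennreal A_def ennreal_mult' U_def V_def \<alpha>_def \<beta>_def)
    have A_r: "A_r M p0 p q0 v u Q = ennreal (A Q)" if Q: "Q \<in> T" for Q
      unfolding A_r_def Let_def ex(7) u.avg_weight[OF Q] v.avg_weight[OF Q]
      using pos[OF Q] by (simp add: epowr_ennreal A_def ennreal_mult' U_def V_def \<alpha>_def \<beta>_def mult.commute)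
    have Ku': "A Q * u.A_inf Q powr (1 / p) * \<Psi> (u.A_inf Q) \<le> K"
      and Kv': "A Q * v.A_inf Q powr (1 / p') * \<Phi> (v.A_inf Q) \<le> K" if Q: "Q \<in> T" for Q
    proof -
      have E: "0 \<le> u.A_inf Q" "0 \<le> v.A_inf Q" "0 \<le> A Q"
        using u.A_inf_ge_1[OF Q] v.A_inf_ge_1[OF Q] Apos[OF Q] by auto
      have "ennreal (A Q * u.A_inf Q powr (1 / p) * \<Psi> (u.A_inf Q)) \<le> ennreal K"
        using Ku[OF cube[OF Q]] E \<Psi>(2)[of "u.A_inf Q"] u.A_inf_ge_1[OF Q]
        unfolding A_r'[OF Q] u.A_exp_eq[OF Q] by (simp add: epowr_ennreal ennreal_mult')
      then show "A Q * u.A_inf Q powr (1 / p) * \<Psi> (u.A_inf Q) \<le> K"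
        using K(3) by (simp add: ennreal_le_iff)
      have "ennreal (A Q * v.A_inf Q powr (1 / p') * \<Phi> (v.A_inf Q)) \<le> ennreal K"
        using Kv[OF cube[OF Q]] E \<Phi>(2)[of "v.A_inf Q"] v.A_inf_ge_1[OF Q]
        unfolding A_r[OF Q] v.A_exp_eq[OF Q] by (simp add: epowr_ennreal ennreal_mult')
      then show "A Q * v.A_inf Q powr (1 / p') * \<Phi> (v.A_inf Q) \<le> K"
        using K(3) by (simp add: ennreal_le_iff)
    qed
    let ?t = "\<lambda>Q. x Q powr (1 / p) * y Q powr (1 / p') * (A Q * U Q powr (1 / p) * V Q powr (1 / p'))"
    have term_eq: "epowr (avg M Q (\<lambda>x. ennreal (\<bar>f x\<bar> powr p0))) (1 / p0) *
            epowr (avg M Q (\<lambda>x. ennreal (\<bar>g x\<bar> powr e'))) (1 / e') * emeasure M Q = ennreal (?t Q)"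
      if Q: "Q \<in> T" for Q
    proof -
      let ?m = "measure M Q"
      have "(U Q / ?m) powr (1 / p0) * (V Q / ?m) powr (1 / e') * ?m powr (1 / p + 1 / p') =
          A Q * U Q powr (1 / p) * V Q powr (1 / p')"
        unfolding st(2,3) A_def using pos[OF Q] by (simp add: powr_add powr_divide)
      then have eq: "?t Q = x Q powr (1 / p) * (U Q / ?m) powr (1 / p0) * (y Q powr (1 / p') * (V Q / ?m) powr (1 / e')) * ?m"
        using pos[OF Q] by (simp add: st(1) mult_ac)
      show ?thesis
        unfolding fu(2)[OF Q] gv(2)[OF Q] u.emeasure_eq[OF Q] eq
        by (simp add: x_def y_def U_def V_def ennreal_mult')
    qed
    have bound: "sum ?t T \<le> C * K * F powr (1 / p) * G powr (1 / p')"
    proof (cases "T = {}")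
      case True
      have "0 \<le> C" unfolding C_def \<alpha>_def[symmetric] \<beta>_def[symmetric] p'_def[symmetric]
        using p \<alpha> \<beta> by (intro add_nonneg_nonneg bound_const_nonneg) auto
      then show ?thesis using True K(3) by simp
    next
      case False
      then obtain Q where Q: "Q \<in> T" by blast
      have "0 < A Q * u.A_inf Q powr (1 / p) * \<Psi> (u.A_inf Q)"
        using Apos[OF Q] u.A_inf_ge_1[OF Q] \<Psi>(2)[of "u.A_inf Q"] by simp
      \<comment> \<open>A single cube forces the bump constants to be positive.\<close>
      then have K0: "0 < K" using Ku'[OF Q] by linarith
      have inv: "- 1 / (1 / p) = - p" "- 1 / (1 / p') = - p'" by simp_all
      have "sum ?t T \<le> (bound_const (1 / p) (1 / p') \<alpha> \<beta> (p / p0) (p' / e') (\<Sum>k. \<Psi> (2 ^ k) powr (- 1 / (1 / p'))) +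
        bound_const (1 / p') (1 / p) \<beta> \<alpha> (p' / e') (p / p0) (\<Sum>k. \<Phi> (2 ^ k) powr (- 1 / (1 / p)))) *
          K * F powr (1 / p) * G powr (1 / p')"
      proof (rule finite_sparse_bound[OF u.sparse_weight_axioms v.sparse_weight_axioms])
        show "(\<integral>\<^sup>+z. ennreal (\<phi> z powr (p / p0)) \<partial>density M (\<lambda>z. ennreal (u z))) \<le> ennreal F" by (rule fu(1))
        show "(\<integral>\<^sup>+z. ennreal (\<psi> z powr (p' / e')) \<partial>density M (\<lambda>z. ennreal (v z))) \<le> ennreal G" by (rule gv(1))
        show "\<phi> \<in> borel_measurable M" "\<psi> \<in> borel_measurable M"
          unfolding \<phi>_def[abs_def] \<psi>_def[abs_def]
          using F(2) G(2) u.u_measurable v.u_measurable by measurable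
        show "0 \<le> \<phi> z" "0 \<le> \<psi> z" for z unfolding \<phi>_def \<psi>_def using u0 v0 by simp_all
        show "1 < p / p0" "1 < p' / e'" using e e'p p by simp_all
        show "summable (\<lambda>k. \<Psi> (2 ^ k) powr (- 1 / (1 / p')))" using \<Psi>(3) unfolding inv p'_def[symmetric] .
        show "summable (\<lambda>k. \<Phi> (2 ^ k) powr (- 1 / (1 / p)))" unfolding inv by (rule \<Phi>(3))
        show "0 < 1 / p" "0 < 1 / p'" using p by simp_all
        show "x Q = u.avg_pow (p / p0) \<phi> Q" "y Q = v.avg_pow (p' / e') \<psi> Q" for Q
          by (simp_all add: x_def y_def)
      qed (fact st(1) \<alpha> \<beta> F(1) G(1) U_def V_def A_def \<Psi>(1,2) \<Phi>(1,2) K0 Ku' Kv')+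
      then show ?thesis
        unfolding inv C_def \<alpha>_def[symmetric] \<beta>_def[symmetric] p'_def[symmetric] e'_def[symmetric] .
    qed
    have "(\<Sum>Q\<in>T. epowr (avg M Q (\<lambda>x. ennreal (\<bar>f x\<bar> powr p0))) (1 / p0) *
            epowr (avg M Q (\<lambda>x. ennreal (\<bar>g x\<bar> powr e'))) (1 / e') * emeasure M Q) = (\<Sum>Q\<in>T. ennreal (?t Q))"
      by (rule sum.cong[OF refl term_eq])
    also have "\<dots> = ennreal (sum ?t T)"
      using Apos by (intro sum_ennreal) (auto simp: less_imp_le)
    also have "\<dots> \<le> ennreal (C * K * F powr (1 / p) * G powr (1 / p'))"
      by (rule ennreal_leI[OF bound])
    also have "\<dots> = ennreal (C * K) * Lp_norm M w p f * Lp_norm M \<sigma> p' g"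
      unfolding F(4) G(4) by (simp add: ennreal_mult'')
    finally show "(\<Sum>Q\<in>T. epowr (avg M Q (\<lambda>x. ennreal (\<bar>f x\<bar> powr p0))) (1 / p0) *
            epowr (avg M Q (\<lambda>x. ennreal (\<bar>g x\<bar> powr rconj q0))) (1 / rconj q0) * emeasure M Q)
        \<le> ennreal (C * K) * Lp_norm M w p f * Lp_norm M \<sigma> (rconj p) g"
      unfolding e'_def p'_def .
  qed
qed

theorem theorem1p9:
  fixes M :: "'a::{metric_space, second_countable_topology} measure"
    and D :: "int \<Rightarrow> 'a set set"
    and p0 p :: real and q0 :: ereal
    and \<Phi> \<Psi> :: "real \<Rightarrow> real"
  assumes "locally compact (UNIV :: 'a set)"
    and "doubling_measure M"
    and "dyadic_system D"
    and "1 \<le> p0" and "p0 < p" and "ereal p < q0"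
    and "mono_on {1/2..} \<Phi>" and "\<And>t. 1/2 \<le> t \<Longrightarrow> 0 < \<Phi> t"
    and "mono_on {1/2..} \<Psi>" and "\<And>t. 1/2 \<le> t \<Longrightarrow> 0 < \<Psi> t"
    and "(\<integral>\<^sup>+t\<in>{1/2..}. ennreal ((1 / \<Phi> t powr p + 1 / \<Psi> t powr rconj p) / t) \<partial>lborel) < \<infinity>"
  shows "\<exists>C::real. 0 < C \<and>
    (\<forall>S w \<sigma> u v.
       sparse_family M D S \<and> weight M w \<and> weight M \<sigma> \<and>
       u = (\<lambda>x. w x powr (p0 / (p0 - p))) \<and>
       v = (\<lambda>x. \<sigma> x powr (rconj q0 / (rconj q0 - rconj p))) \<and>
       weight M u \<and> weight M v \<longrightarrow>
       best_const M S p0 p q0 w \<sigma>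
         \<le> ennreal C * (bump_r M D p0 p q0 \<Phi> v u + bump_r' M D p0 p q0 \<Psi> u v))"
proof -
  note ex = exponent_identities[OF assms(4-6)]
  have p: "0 < p" "0 < rconj p" using assms ex(1) by auto
  have \<Phi>: "summable (\<lambda>k. \<Phi> (2 ^ k) powr - p)"
  proof (rule summable_dyadic_values[OF assms(7,8) p(1) _ assms(11)])
    fix t :: real assume "1 / 2 \<le> t"
    then show "\<Phi> t powr - p / t \<le> (1 / \<Phi> t powr p + 1 / \<Psi> t powr rconj p) / t"
      by (intro divide_right_mono) (simp_all add: powr_minus_divide)
  qed
  have \<Psi>: "summable (\<lambda>k. \<Psi> (2 ^ k) powr - rconj p)"
  proof (rule summable_dyadic_values[OF assms(9,10) p(2) _ assms(11)])
    fix t :: real assume "1 / 2 \<le> t"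
    then show "\<Psi> t powr - rconj p / t \<le> (1 / \<Phi> t powr p + 1 / \<Psi> t powr rconj p) / t"
      by (intro divide_right_mono) (simp_all add: powr_minus_divide)
  qed
  define C where "C = bound_const (1 / p) (1 / rconj p) (1 / p0 - 1 / p) (1 / p - real_of_ereal (1 / q0))
        (p / p0) (rconj p / rconj q0) (\<Sum>k. \<Psi> (2 ^ k) powr - rconj p) +
      bound_const (1 / rconj p) (1 / p) (1 / p - real_of_ereal (1 / q0)) (1 / p0 - 1 / p)
        (rconj p / rconj q0) (p / p0) (\<Sum>k. \<Phi> (2 ^ k) powr - p)"
  have "0 < 1 / p0 - 1 / p" using assms by (simp add: frac_less2)
  then have C: "0 \<le> C" unfolding C_def
    using p ex(6) by (intro add_nonneg_nonneg bound_const_nonneg) auto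
  show ?thesis
  proof (intro exI[of _ "C + 1"] conjI allI impI)
    show "0 < C + 1" using C by simp
    fix S w \<sigma> u v
    assume H: "sparse_family M D S \<and> weight M w \<and> weight M \<sigma> \<and>
       u = (\<lambda>x. w x powr (p0 / (p0 - p))) \<and>
       v = (\<lambda>x. \<sigma> x powr (rconj q0 / (rconj q0 - rconj p))) \<and>
       weight M u \<and> weight M v"
    let ?B = "bump_r M D p0 p q0 \<Phi> v u + bump_r' M D p0 p q0 \<Psi> u v"
    show "best_const M S p0 p q0 w \<sigma> \<le> ennreal (C + 1) * ?B"
    proof (cases "?B = \<infinity>")
      case True
      have "0 < C + 1" using C by simp
      then have "ennreal (C + 1) * ?B = \<infinity>"
        unfolding True by (simp add: ennreal_mult_top del: ennreal_plus)
      then show ?thesis by simp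
    next
      case False
      define K where "K = enn2real ?B"
      have K: "?B = ennreal K" "0 \<le> K" unfolding K_def using False by (auto simp: less_top)
      have le: "bump_r M D p0 p q0 \<Phi> v u \<le> ennreal K" "bump_r' M D p0 p q0 \<Psi> u v \<le> ennreal K"
        unfolding K(1)[symmetric] by simp_all
      have "sparse_form M S p0 q0 f g \<le> ennreal (C + 1) * ?B * Lp_norm M w p f * Lp_norm M \<sigma> (rconj p) g"
        if fg: "f \<in> Lp_space M w p" "g \<in> Lp_space M \<sigma> (rconj p)" for f g
      proof -
        have "sparse_form M S p0 q0 f g \<le> ennreal (C * K) * Lp_norm M w p f * Lp_norm M \<sigma> (rconj p) g"
          unfolding C_def
          by (rule sparse_form_bound[OF assms(1-6) assms(7,8) \<Phi> assms(9,10) \<Psi> _ _ _ _ _ _ _ le K(2) fg])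
            (use H in auto)
        also have "\<dots> \<le> ennreal (C + 1) * ?B * Lp_norm M w p f * Lp_norm M \<sigma> (rconj p) g"
        proof (intro mult_right_mono)
          have "ennreal (C * K) \<le> ennreal ((C + 1) * K)"
            using K(2) by (intro ennreal_leI mult_right_mono) auto
          also have "\<dots> = ennreal (C + 1) * ?B"
            unfolding K(1) using C by (intro ennreal_mult') simp
          finally show "ennreal (C * K) \<le> ennreal (C + 1) * ?B" .
        qed auto
        finally show ?thesis .
      qed
      then show ?thesis unfolding best_const_def by (intro Inf_lower) simp
    qed
  qed
qed

end
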